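(* Let $f\in S_{k+1/2}(\Gamma_0(8))$. Then $f\in S^-_{k+1/2}(8)$ if and only if $\widetilde{V}_4f=-f=\widetilde{V}'_4f$.
   Context: Let $k$ be a positive integer. For $4\mid N$, $S_{k+1/2}(\Gamma_0(N))$ is the space of holomorphic cusp forms of weight $k+1/2$ on $\Gamma_0(N)$ with trivial character in Shimura's sense (automorphy factor $j(\alpha,z)=\varepsilon_d^{-1}\left(\frac{c}{d}\right)(cz+d)^{1/2}$, $\varepsilon_d=1$ or $i$ as $d\equiv1,3\pmod4$), with Petersson inner product. Slash: $f|[\alpha,\phi]_{k+1/2}(z)=f(\alpha z)\phi(z)^{-2k-1}$ for $\alpha\in\mathrm{GL}_2(\mathbb{R})^+$ and holomorphic $\phi$ with $\phi^2=t\det(\alpha)^{-1/2}(cz+d)$, $|t|=1$ (principal square roots). Let $\zeta_8=(1-i^{2k+1})/\sqrt2$. Operators: $\widetilde{W}_4f=\overline{\zeta_8}\,f|[\begin{pmatrix}4n'&m'\\4&8\end{pmatrix},(2z+4)^{1/2}]_{k+1/2}$ on $S_{k+1/2}(\Gamma_0(4))$ ($8n'-m'=1$ fixed); on $S_{k+1/2}(\Gamma_0(8))$: $\widetilde{V}_4f=f|[\begin{pmatrix}1&0\\4&1\end{pmatrix},(4z+1)^{1/2}]_{k+1/2}$, $\widetilde{W}_8f=\frac1{\sqrt2}\overline{\zeta_8}\sum_{s=0}^1f|[\begin{pmatrix}16n-8ms&m\\16-128s&16\end{pmatrix},((4-32s)z+4)^{1/2}]_{k+1/2}$ ($16n-m=1$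 fixed), $\widetilde{V}'_4=\widetilde{W}_8\widetilde{V}_4\widetilde{W}_8$. $S^+(4)$ is Kohnen's plus space ($a_n=0$ unless $(-1)^kn\equiv0,1\pmod4$) in $S_{k+1/2}(\Gamma_0(4))$; $S^-(4)$ is the orthogonal complement of $S^+(4)+\widetilde{W}_4S^+(4)$ in $S_{k+1/2}(\Gamma_0(4))$; $S^-_{k+1/2}(8)$ is the orthogonal complement in $S_{k+1/2}(\Gamma_0(8))$ of $S^+(4)+\widetilde{W}_4S^+(4)+\widetilde{W}_8\widetilde{W}_4S^+(4)+S^-(4)+\widetilde{W}_8S^-(4)$. *)

theory Defs
  imports
    "HOL-Complex_Analysis.Complex_Analysis"
    "HOL-Number_Theory.Residues"
    "HOL-Library.Function_Algebras"
    "HOL-Library.Set_Algebras"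
begin

definition uhp :: "complex set" where
  "uhp = {z. Im z > 0}"

definition mat2 :: "'a::zero \<Rightarrow> 'a \<Rightarrow> 'a \<Rightarrow> 'a \<Rightarrow> 'a^2^2" where
  "mat2 a b c d = vector [vector [a, b], vector [c, d]]"

definition moebius :: "real^2^2 \<Rightarrow> complex \<Rightarrow> complex" where
  "moebius A z = (of_real (A$1$1) * z + of_real (A$1$2)) / (of_real (A$2$1) * z + of_real (A$2$2))"

text \<open>
  Functions on the upper half-plane are total functions on \<^typ>\<open>complex\<close> that vanish off
  \<^const>\<open>uhp\<close>, so that equality of functions is equality on the upper half-plane.
\<close>

definition slash ::
  "nat \<Rightarrow> real^2^2 \<Rightarrow> (complex \<Rightarrow> complex) \<Rightarrow> (complex \<Rightarrow> complex) \<Rightarrow> complex \<Rightarrow> complex" where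
  "slash k A \<phi> f =
     (\<lambda>z. if z \<in> uhp then f (moebius A z) * \<phi> z powi (- 2 * int k - 1) else 0)"

text \<open>
  Shimura's extension of the quadratic residue symbol $(c/d)$ to all odd \<open>d\<close>. The product is the
  Jacobi symbol $(c/|d|)$; the sign is $-1$ exactly if \<open>c\<close> and \<open>d\<close> are both negative, and
  $(0/{\pm 1}) = 1$.
\<close>

definition shimura_symbol :: "int \<Rightarrow> int \<Rightarrow> int" where
  "shimura_symbol c d = (if c < 0 \<and> d < 0 then - 1 else 1) *
     (\<Prod>p\<in>#prime_factorization (nat \<bar>d\<bar>). Legendre c (int p))"

definition theta_eps :: "int \<Rightarrow> complex" where
  "theta_eps d = (if d mod 4 = 1 then 1 else \<i>)"

definition theta_factor :: "int \<Rightarrow> int \<Rightarrow> complex \<Rightarrow> complex" where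
  "theta_factor c d z =
     inverse (theta_eps d) * of_int (shimura_symbol c d) * csqrt (of_int c * z + of_int d)"

definition has_fourier_expansion ::
  "nat \<Rightarrow> real \<Rightarrow> (complex \<Rightarrow> complex) \<Rightarrow> (nat \<Rightarrow> complex) \<Rightarrow> bool" where
  "has_fourier_expansion h r f a \<longleftrightarrow>
     (\<forall>z\<in>uhp. (\<lambda>n. a n * exp (2 * of_real pi * \<i> * of_real (real n + r) * z / of_nat h)) sums f z)"

text \<open>
  The slash by \<open>mat2 a b c d\<close> in \<open>SL\<^sub>2(\<int>)\<close> moves the cusp $a/c$ to infinity. At an irregular cusp
  the exponents $(n + r)/h$ have a shift $0 < r < 1$ and are all positive; at a regular cusp $r = 0$
  and only the constant term has to vanish.
\<close>

definition vanishes_at_cusps :: "nat \<Rightarrow> (complex \<Rightarrow> complex) \<Rightarrow> bool" where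
  "vanishes_at_cusps k f \<longleftrightarrow>
     (\<forall>a b c d :: int. a * d - b * c = 1 \<longrightarrow>
        (\<exists>h r u. h > 0 \<and> 0 \<le> r \<and> r < 1 \<and> (r = 0 \<longrightarrow> u 0 = 0) \<and>
           has_fourier_expansion h r
             (slash k (mat2 (of_int a) (of_int b) (of_int c) (of_int d))
                (\<lambda>z. csqrt (of_int c * z + of_int d)) f) u))"

text \<open>The space $S_{k+1/2}(\Gamma_0(N))$ with trivial character, meaningful for $4 \mid N$.\<close>

definition cusp_forms :: "nat \<Rightarrow> nat \<Rightarrow> (complex \<Rightarrow> complex) set" where
  "cusp_forms k N = {f.
     f holomorphic_on uhp \<and> (\<forall>z. z \<notin> uhp \<longrightarrow> f z = 0) \<and>
     (\<forall>a b c d :: int. a * d - b * c = 1 \<and> int N dvd c \<longrightarrow>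
        slash k (mat2 (of_int a) (of_int b) (of_int c) (of_int d)) (theta_factor c d) f = f) \<and>
     vanishes_at_cusps k f}"

definition Gamma0 :: "nat \<Rightarrow> (real^2^2) set" where
  "Gamma0 N = {mat2 (of_int a) (of_int b) (of_int c) (of_int d) | a b c d :: int.
     a * d - b * c = 1 \<and> int N dvd c}"

text \<open>The coset space $\Gamma_0(N) \backslash SL_2(\mathbb{Z})$, where \<open>SL\<^sub>2(\<int>) = Gamma0 1\<close>.\<close>

definition Gamma0_cosets :: "nat \<Rightarrow> (real^2^2) set set" where
  "Gamma0_cosets N = {(\<lambda>B. B ** A) ` Gamma0 N | A. A \<in> Gamma0 1}"

definition std_fund_domain :: "complex set" where
  "std_fund_domain = {z \<in> uhp. \<bar>Re z\<bar> \<le> 1 / 2 \<and> 1 \<le> cmod z}"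

definition petersson_integrand ::
  "nat \<Rightarrow> (complex \<Rightarrow> complex) \<Rightarrow> (complex \<Rightarrow> complex) \<Rightarrow> complex \<Rightarrow> complex" where
  "petersson_integrand k f g z = f z * cnj (g z) * of_real (Im z powr (real k + 1 / 2))"

text \<open>
  The (unnormalised) Petersson inner product, i.e. the integral of
  $f \overline{g}\, y^{k+1/2}\, dx\, dy / y^2$ over a fundamental domain of $\Gamma_0(N)$, assembled
  from the translates of the standard one of $SL_2(\mathbb{Z})$ by coset representatives. The
  integrand is $\Gamma_0(N)$-invariant, so the choice of representatives is immaterial.
\<close>

definition petersson ::
  "nat \<Rightarrow> nat \<Rightarrow> (complex \<Rightarrow> complex) \<Rightarrow> (complex \<Rightarrow> complex) \<Rightarrow> complex" where
  "petersson k N f g =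
     (\<Sum>C\<in>Gamma0_cosets N.
        (LINT z:std_fund_domain|lborel.
           petersson_integrand k f g (moebius (SOME A. A \<in> C) z) / of_real ((Im z)\<^sup>2)))"

definition orth_complement ::
  "nat \<Rightarrow> nat \<Rightarrow> (complex \<Rightarrow> complex) set \<Rightarrow> (complex \<Rightarrow> complex) set" where
  "orth_complement k N U = {f \<in> cusp_forms k N. \<forall>g\<in>U. petersson k N f g = 0}"

definition zeta8 :: "nat \<Rightarrow> complex" where
  "zeta8 k = (1 - \<i> ^ (2 * k + 1)) / of_real (sqrt 2)"

text \<open>
  The parameters of \<open>W4\<close> and \<open>W8\<close> are the integers fixed in the definition of these operators,
  subject to $8n' - m' = 1$ and $16n - m = 1$ respectively.
\<close>

definition W4 :: "nat \<Rightarrow> int \<Rightarrow> int \<Rightarrow> (complex \<Rightarrow> complex) \<Rightarrow> complex \<Rightarrow> complex" where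
  "W4 k n' m' f = (\<lambda>z. cnj (zeta8 k) *
     slash k (mat2 (of_int (4 * n')) (of_int m') 4 8) (\<lambda>z. csqrt (2 * z + 4)) f z)"

definition V4 :: "nat \<Rightarrow> (complex \<Rightarrow> complex) \<Rightarrow> complex \<Rightarrow> complex" where
  "V4 k f = slash k (mat2 1 0 4 1) (\<lambda>z. csqrt (4 * z + 1)) f"

definition W8 :: "nat \<Rightarrow> int \<Rightarrow> int \<Rightarrow> (complex \<Rightarrow> complex) \<Rightarrow> complex \<Rightarrow> complex" where
  "W8 k n m f = (\<lambda>z. 1 / of_real (sqrt 2) * cnj (zeta8 k) *
     (\<Sum>s::int = 0..1.
        slash k (mat2 (of_int (16 * n - 8 * m * s)) (of_int m) (of_int (16 - 128 * s)) 16)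
          (\<lambda>z. csqrt (of_int (4 - 32 * s) * z + 4)) f z))"

definition V4' :: "nat \<Rightarrow> int \<Rightarrow> int \<Rightarrow> (complex \<Rightarrow> complex) \<Rightarrow> complex \<Rightarrow> complex" where
  "V4' k n m f = W8 k n m (V4 k (W8 k n m f))"

definition plus_space4 :: "nat \<Rightarrow> (complex \<Rightarrow> complex) set" where
  "plus_space4 k = {f \<in> cusp_forms k 4. \<exists>a. has_fourier_expansion 1 0 f a \<and>
     (\<forall>n. ((- 1) ^ k * int n) mod 4 \<notin> {0, 1} \<longrightarrow> a n = 0)}"

definition minus_space4 :: "nat \<Rightarrow> int \<Rightarrow> int \<Rightarrow> (complex \<Rightarrow> complex) set" where
  "minus_space4 k n' m' = orth_complement k 4 (plus_space4 k + W4 k n' m' ` plus_space4 k)"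

definition minus_space8 :: "nat \<Rightarrow> int \<Rightarrow> int \<Rightarrow> int \<Rightarrow> int \<Rightarrow> (complex \<Rightarrow> complex) set" where
  "minus_space8 k n' m' n m = orth_complement k 8
     (plus_space4 k + W4 k n' m' ` plus_space4 k + W8 k n m ` W4 k n' m' ` plus_space4 k +
      minus_space4 k n' m' + W8 k n m ` minus_space4 k n' m')"

end

theory Submission
  imports Defs "HOL-Number_Theory.Quadratic_Reciprocity"
begin

text \<open>
  \<open>V4\<close> fixes the forms of level $4$, and $f + V_4 f$ has level $4$ for every $f$ of level $8$. Unfolding
  the Petersson norm to the whole half-plane shows that \<open>V4\<close> and \<open>W8\<close> are isometries: \<open>V4\<close> because
  its matrix normalises $\Gamma_0(8)$, and \<open>W8\<close> by the parallelogram law on $\Gamma_0(16)$. Hence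
  $V_4 f = -f$ means $f \perp S(4)$ and, as \<open>W8\<close> is a self-adjoint involution, $V'_4 f = -f$ means
  $f \perp W_8 S(4)$. Cauchy's estimates show that finitely many Fourier coefficients at the cusps
  determine a form, so orthogonal projections exist and $S(4) = S^+(4) + W_4 S^+(4) + S^-(4)$. As
  \<open>W8\<close> fixes $S^+(4)$, the space $S(4) + W_8 S(4)$ is the one whose orthogonal complement is
  $S^-(8)$.
\<close>

section \<open>The Jacobi symbol and the theta multiplier\<close>

text \<open>Two kinds of choices obstruct direct computation: principal square roots, whose products
  are right only up to sign, and coset representatives picked by \<open>SOME\<close>. The signs are
  settled by a cocycle identity for \<open>theta_factor\<close>, proved on generators of Gamma0(4)
  from quadratic reciprocity; at the cusps it is enough to know fourth powers. The representatives
  disappear because norms are integrals of the square of \<open>hnorm\<close>, on which Gamma0(N)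
  acts trivially; inner products come back by polarisation. \<open>W8\<close> is a sum of two
  slashes by matrices that do not normalise Gamma0(8), so it cannot be treated like
  \<open>V4\<close>. It is the Fricke slash of level 16 followed by the trace from level 16 to level
  8, and both the Fricke matrix and the translation by 1/2 normalise Gamma0(16): hence the detour
  through that level. The condition at the cusps is handled as exponential decay of
  \<open>hnorm\<close>, which, unlike an expansion of fixed width, passes through any rational
  matrix of positive determinant. Projections are required because S^-(4) is defined as an
  orthogonal complement, and S(4) has to be regained from its three parts.\<close>

lemma Legendre_cong: "[a = b] (mod p) \<Longrightarrow> Legendre a p = Legendre b p"
  by (simp add: Legendre_def QuadRes_def cong_def)

lemma Legendre_values: "Legendre a p \<in> {-1, 0, 1}"
  by (simp add: Legendre_def)

text \<open>Euler's criterion determines Legendre symbols only modulo p. Values in {-1, 0, 1} differ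
  by at most 2, so for p > 2 a congruence between them is an equality.\<close>

lemma small_cong_imp_eq:
  fixes x y :: int
  assumes "x \<in> {-1,0,1}" "y \<in> {-1,0,1}" "p > 2" "[x = y] (mod p)"
  shows "x = y"
proof -
  have "p dvd x - y" using assms(4) by (simp add: cong_iff_dvd_diff)
  moreover have "\<bar>x - y\<bar> \<le> 2" using assms(1,2) by auto
  ultimately show ?thesis using assms(3) zdvd_imp_le[of p "\<bar>x - y\<bar>"] by (cases "x = y") auto
qed

lemma Legendre_mult:
  assumes "prime p" "2 < p"
  shows "Legendre (a * b) (int p) = Legendre a (int p) * Legendre b (int p)"
proof (rule small_cong_imp_eq)
  show "Legendre a (int p) * Legendre b (int p) \<in> {-1,0,1}"
    by (simp add: Legendre_def)
  have "[Legendre (a * b) p = a ^ ((p-1) div 2) * b ^ ((p-1) div 2)] (mod p)"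
    using euler_criterion[OF assms, of "a*b"] by (simp add: power_mult_distrib)
  moreover have "[Legendre a p * Legendre b p = a ^ ((p-1) div 2) * b ^ ((p-1) div 2)] (mod p)"
    by (intro cong_mult euler_criterion assms)
  ultimately show "[Legendre (a * b) p = Legendre a p * Legendre b p] (mod p)"
    by (metis cong_sym cong_trans)
qed (use assms Legendre_values in auto)

lemma Legendre_minus_one:
  assumes "prime p" "2 < p"
  shows "Legendre (-1) (int p) = (-1) ^ ((p - 1) div 2)"
  by (rule small_cong_imp_eq[OF Legendre_values _ _ euler_criterion[OF assms]])
     (use assms in \<open>auto simp: minus_one_power_iff\<close>)

text \<open>Gauss's lemma with multiplier 2: for h = (p - 1)/2 the multiples 2, 4, ..., 2h are
  already reduced modulo p, and those exceeding h come from h div 2 < x \<le> h. The parity of their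
  number depends on p mod 8 alone.\<close>

lemma Legendre_two:
  assumes "prime p" "2 < p"
  shows "Legendre 2 (int p) = (if p mod 8 = 1 \<or> p mod 8 = 7 then 1 else -1)"
proof -
  have odd: "odd p" using assms prime_odd_nat by auto
  interpret GAUSS p 2
    by unfold_locales (use assms odd in \<open>auto simp: cong_0_iff dest: zdvd_imp_le\<close>)
  define h where "h = (int p - 1) div 2"
  have h: "int p = 2 * h + 1" using p_eq2 by (simp add: h_def)
  have "C = (\<lambda>x. 2 * x) ` {0<..h}"
  proof -
    have "C = (\<lambda>x. (x * 2) mod int p) ` {0<..h}"
      by (simp add: C_def B_def A_def h_def image_image)
    also have "\<dots> = (\<lambda>x. 2 * x) ` {0<..h}"
      by (rule image_cong) (auto simp: h)
    finally show ?thesis .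
  qed
  then have E: "E = (\<lambda>x. 2 * x) ` {h div 2 <.. h}"
    unfolding E_def h_def[symmetric] using h p_ge_2 by (auto simp: image_iff; presburger)
  have "card E = nat (h - h div 2)"
    unfolding E by (subst card_image) (auto simp: inj_on_def)
  then have L: "Legendre 2 p = (-1) ^ nat (h - h div 2)"
    using gauss_lemma by simp
  have "0 < h" using h p_ge_2 by linarith
  then have "even (nat (h - h div 2)) \<longleftrightarrow> even (h - h div 2)" by (subst even_nat_iff) auto
  also have "\<dots> \<longleftrightarrow> int p mod 8 = 1 \<or> int p mod 8 = 7"
  proof -
    obtain q r where "h = 4 * q + r" "r \<in> {0, 1, 2, 3}"
      by (rule that[of "h div 4" "h mod 4"]) auto
    then show ?thesis unfolding h by auto presburger+
  qed
  also have "int p mod 8 = int (p mod 8)" by (simp add: zmod_int)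
  finally show ?thesis using L by (simp add: minus_one_power_iff)
qed

section \<open>The Jacobi symbol, its reciprocity law and its periods\<close>

lemma odd_mod_4: "odd n \<Longrightarrow> n mod 4 = 1 \<or> n mod 4 = (3::nat)"
  by presburger

lemma odd_mod_8: "odd n \<Longrightarrow> n mod 8 = 1 \<or> n mod 8 = 3 \<or> n mod 8 = 5 \<or> n mod 8 = (7::nat)"
  by presburger

lemma mod_mult_cong_nat: "a mod m = x \<Longrightarrow> b mod m = y \<Longrightarrow> a * b mod m = x * y mod (m::nat)"
  by (metis mod_mult_eq)

text \<open>The product inside \<open>shimura_symbol\<close>, without the sign. With a natural
  number at the bottom it can be studied by induction on odd prime factors.\<close>

definition jacobi :: "int \<Rightarrow> nat \<Rightarrow> int" where
  "jacobi c n = (\<Prod>p\<in>#prime_factorization n. Legendre c (int p))"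

lemma jacobi_1 [simp]: "jacobi c 1 = 1" "jacobi c (Suc 0) = 1"
  by (auto simp: jacobi_def)

lemma jacobi_prime: "prime p \<Longrightarrow> jacobi c p = Legendre c (int p)"
  by (simp add: jacobi_def prime_factorization_prime)

lemma jacobi_mult_right: "m > 0 \<Longrightarrow> n > 0 \<Longrightarrow> jacobi c (m * n) = jacobi c m * jacobi c n"
  by (simp add: jacobi_def prime_factorization_mult)

lemma odd_prime_dvd: "prime p \<Longrightarrow> p dvd n \<Longrightarrow> odd n \<Longrightarrow> 2 < (p::nat)"
  using prime_ge_2_nat[of p] by (cases "p = 2") auto

lemma odd_prime_induct [consumes 1, case_names one mult]:
  assumes "odd n" "P 1"
    "\<And>p n. prime p \<Longrightarrow> 2 < p \<Longrightarrow> odd p \<Longrightarrow> odd n \<Longrightarrow> P n \<Longrightarrow> P (p * n)"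
  shows "P (n::nat)"
  using assms(1)
proof (induction n rule: less_induct)
  case (less n)
  show ?case
  proof (cases "n = 1")
    case False
    then obtain p where p: "prime p" "p dvd n" by (meson prime_factor_nat)
    then obtain m where m: "n = p * m" by auto
    have "2 < p" using odd_prime_dvd p less.prems by blast
    moreover have "odd m" "odd p" using less.prems m by auto
    moreover have "m < n" using m \<open>2 < p\<close> \<open>odd m\<close> odd_pos[of m] by (simp add: n_less_m_mult_n)
    ultimately show ?thesis using less.IH assms(3) p m by blast
  qed (use assms in simp)
qed

lemma jacobi_mult_left:
  assumes "odd n"
  shows "jacobi (a * b) n = jacobi a n * jacobi b n"
  using assms
  by (induction n rule: odd_prime_induct)
     (auto simp: jacobi_mult_right jacobi_prime Legendre_mult odd_pos)

lemma jacobi_cong: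
  assumes "odd n" "[a = b] (mod int n)"
  shows "jacobi a n = jacobi b n"
  using assms
proof (induction n rule: odd_prime_induct)
  case (mult p n)
  from mult.prems have "[a = b] (mod int p)" "[a = b] (mod int n)"
    by (auto simp: cong_iff_dvd_diff intro: dvd_mult_left dvd_mult_right)
  with mult show ?case by (simp add: jacobi_mult_right jacobi_prime odd_pos Legendre_cong)
qed simp

lemma jacobi_one_left: "odd n \<Longrightarrow> jacobi 1 n = 1"
proof (induction n rule: odd_prime_induct)
  case (mult p n)
  have "Legendre 1 p = 1"
    using mult unfolding Legendre_def QuadRes_def
    by (auto simp: cong_0_iff dest: zdvd_imp_le intro!: exI[of _ 1])
  with mult show ?case by (simp add: jacobi_mult_right jacobi_prime odd_pos)
qed simp

lemma jacobi_minus_one: "odd n \<Longrightarrow> jacobi (-1) n = (if n mod 4 = 1 then 1 else -1)"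
proof (induction n rule: odd_prime_induct)
  case (mult p n)
  have "Legendre (-1) p = (if p mod 4 = 1 then 1 else -1)"
    using mult(1-3) unfolding Legendre_minus_one[OF mult(1,2)] minus_one_power_iff by (auto; presburger)
  moreover note odd_mod_4[OF \<open>odd p\<close>] odd_mod_4[OF \<open>odd n\<close>]
  moreover have "p * n mod 4 = (p mod 4) * (n mod 4) mod 4" by (simp add: mod_mult_eq)
  ultimately show ?case using mult.IH mult.hyps
    by (auto simp: jacobi_mult_right jacobi_prime odd_pos)
qed simp

lemma jacobi_two: "odd n \<Longrightarrow> jacobi 2 n = (if n mod 8 = 1 \<or> n mod 8 = 7 then 1 else -1)"
proof (induction n rule: odd_prime_induct)
  case (mult p n)
  note odd_mod_8[OF \<open>odd p\<close>] odd_mod_8[OF \<open>odd n\<close>]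
  moreover have "jacobi 2 (p * n) = jacobi 2 p * jacobi 2 n" "jacobi 2 p = Legendre 2 p"
    using mult by (auto simp: jacobi_mult_right jacobi_prime odd_pos)
  ultimately show ?case using mult.IH Legendre_two[OF mult(1,2)]
    by - ((elim disjE; frule (1) mod_mult_cong_nat[of p 8 _ n]), simp_all)
qed simp

lemma Legendre_self: "Legendre (int p) (int p) = 0"
  by (simp add: Legendre_def cong_0_iff)

text \<open>Quadratic reciprocity multiplied over the prime factors of n. The sign is multiplicative
  in n because it depends on n mod 4 only; for a factor equal to p both symbols vanish.\<close>

lemma jacobi_prime_left:
  assumes "prime p" "2 < p" "odd n"
  shows "jacobi (int p) n = Legendre (int n) (int p) * (if p mod 4 = 3 \<and> n mod 4 = 3 then -1 else 1)"
  using assms(3)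
proof (induction n rule: odd_prime_induct)
  case one
  show ?case using jacobi_one_left[of p] jacobi_prime[of p 1] assms prime_odd_nat by auto
next
  case (mult q n)
  have op: "odd p" using assms prime_odd_nat by auto
  have *: "Legendre (int p) (int q) = Legendre (int q) (int p) * (if p mod 4 = 3 \<and> q mod 4 = 3 then -1 else 1)"
  proof (cases "p = q")
    case False
    have "Legendre (int p) q \<in> {-1,1}" "Legendre (int q) p \<in> {-1,1}"
      using mult False assms primes_dvd_imp_eq[of p q] primes_dvd_imp_eq[of q p]
      by (auto simp: Legendre_def cong_0_iff)
    moreover have "even ((p - 1) div 2 * ((q - 1) div 2)) \<longleftrightarrow> \<not> (p mod 4 = 3 \<and> q mod 4 = 3)"
      using op mult(3) by (simp; presburger)
    ultimately show ?thesis
      using Quadratic_Reciprocity[OF assms(1,2) mult(1,2) False]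
      by (auto simp: minus_one_power_iff split: if_splits)
  qed (simp add: Legendre_self)
  note odd_mod_4[OF \<open>odd q\<close>] odd_mod_4[OF \<open>odd n\<close>]
  moreover have "q * n mod 4 = (q mod 4) * (n mod 4) mod 4" by (simp add: mod_mult_eq)
  ultimately show ?case using mult.IH mult.hyps *
    by (auto simp: jacobi_mult_right jacobi_prime odd_pos Legendre_mult[OF assms(1,2)])
qed

text \<open>Euler's form of reciprocity: for c > 0 the bottom matters only up to sign modulo 4c. The
  top is split into primes. For p = 2, negation preserves the set of residues 1 and 7 modulo 8. For
  odd p, the factor (-1/p) that comes from m = -n modulo p cancels the change of the reciprocity
  sign caused by m = -n modulo 4.\<close>

lemma jacobi_periodic_nat:
  fixes c :: nat
  assumes "c > 0" "odd m" "odd n" "4 * int c dvd int m - int n \<or> 4 * int c dvd int m + int n"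
  shows "jacobi (int c) m = jacobi (int c) n"
  using assms
proof (induction c rule: less_induct)
  case (less c)
  show ?case
  proof (cases "c = 1")
    case False
    then obtain p d where p: "prime p" "c = p * d"
      by (metis prime_factor_nat dvdE)
    with less.prems have d: "d > 0" "d < c" using prime_gt_1_nat[of p] by auto
    have dd: "4 * int d dvd int m - int n \<or> 4 * int d dvd int m + int n"
      using less.prems(4) p(2) dvd_trans[of "4 * int d" "4 * int c"] by auto
    have pp: "4 * int p dvd int m - int n \<or> 4 * int p dvd int m + int n"
      using less.prems(4) p(2) dvd_trans[of "4 * int p" "4 * int c"] by auto
    have "jacobi (int p) m = jacobi (int p) n"
    proof (cases "p = 2")
      case True
      then have "8 dvd int m - int n \<or> 8 dvd int m + int n"
        using pp by simp
      then have "(m mod 8 = 1 \<or> m mod 8 = 7) \<longleftrightarrow> (n mod 8 = 1 \<or> n mod 8 = 7)"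
      proof
        assume "8 dvd int m - int n"
        then have "m mod 8 = n mod 8" by (metis cong_iff_dvd_diff cong_int_iff cong_def of_nat_numeral)
        then show ?thesis by simp
      next
        assume "8 dvd int m + int n"
        then have "8 dvd m + n" by (metis int_dvd_int_iff of_nat_add of_nat_numeral)
        then have "(m mod 8 + n mod 8) mod 8 = 0" by (simp add: mod_add_eq)
        moreover have "m mod 8 + n mod 8 < 16" by (rule add_less_mono[of _ 8 _ 8, simplified]) auto
        moreover have *: "x mod 8 = 0 \<Longrightarrow> x < 16 \<Longrightarrow> x = 0 \<or> x = 8" for x :: nat by presburger
        ultimately have "m mod 8 + n mod 8 = 0 \<or> m mod 8 + n mod 8 = 8" by (intro *)
        then show ?thesis by auto
      qed
      then show ?thesis using True less.prems by (simp add: jacobi_two)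
    next
      case False
      then have p2: "2 < p" "odd p" using p prime_ge_2_nat[of p] prime_odd_nat[of p] by auto
      from pp show ?thesis
      proof
        assume a: "4 * int p dvd int m - int n"
        have "[int m = int n] (mod p)" using a dvd_mult_right by (auto simp: cong_iff_dvd_diff)
        moreover have "m mod 4 = 3 \<longleftrightarrow> n mod 4 = 3"
        proof -
          have "4 dvd int m - int n" using a dvd_mult_left by blast
          then show ?thesis by presburger
        qed
        ultimately show ?thesis using p p2 less.prems
          by (simp add: jacobi_prime_left Legendre_cong[of "int m" "int n"])
      next
        assume a: "4 * int p dvd int m + int n"
        have "[int m = -1 * int n] (mod p)"
          using a dvd_mult_right by (auto simp: cong_iff_dvd_diff)
        then have L: "Legendre (int m) p = Legendre (-1) p * Legendre (int n) p"
          using Legendre_cong Legendre_mult p p2 by metis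
        moreover have "m mod 4 = 3 \<longleftrightarrow> n mod 4 = 1"
        proof -
          have "4 dvd int m + int n" using a dvd_mult_left by blast
          then show ?thesis by presburger
        qed
        moreover note odd_mod_4[OF \<open>odd n\<close>] odd_mod_4[OF \<open>odd p\<close>]
        ultimately show ?thesis using p p2 less.prems jacobi_minus_one[of p]
          by (auto simp: jacobi_prime_left jacobi_prime)
      qed
    qed
    moreover have "jacobi (int d) m = jacobi (int d) n"
      using less.IH d dd less.prems by blast
    ultimately show ?thesis using p less.prems by (simp add: jacobi_mult_left)
  qed (use less.prems in \<open>simp add: jacobi_one_left\<close>)
qed

lemma jacobi_four_mult: "odd n \<Longrightarrow> jacobi (4 * c) n = jacobi c n"
proof -
  assume n: "odd n"
  then have "jacobi 2 n * jacobi 2 n = 1" by (simp add: jacobi_two)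
  then show ?thesis using jacobi_mult_left[OF n, of 2 2] jacobi_mult_left[OF n, of 4 c] by simp
qed

lemma jacobi_periodic:
  fixes c :: int
  assumes "c \<noteq> 0" "4 dvd c" "odd m" "odd n"
  shows "c dvd int m - int n \<Longrightarrow> jacobi c m = jacobi c n"
    and "c dvd int m + int n \<Longrightarrow> jacobi c m = sgn c * jacobi c n"
proof -
  obtain e where e: "c = 4 * e" using assms(2) by auto
  have pos: "jacobi (int (nat \<bar>e\<bar>)) m = jacobi (int (nat \<bar>e\<bar>)) n"
    if "c dvd int m - int n \<or> c dvd int m + int n"
  proof (rule jacobi_periodic_nat)
    have "4 * int (nat \<bar>e\<bar>) = \<bar>c\<bar>" using e by (simp add: abs_mult)
    then show "4 * int (nat \<bar>e\<bar>) dvd int m - int n \<or> 4 * int (nat \<bar>e\<bar>) dvd int m + int n"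
      using that by simp
  qed (use assms e in auto)
  have J: "jacobi c i = (if e < 0 then jacobi (-1) i else 1) * jacobi (int (nat \<bar>e\<bar>)) i" if "odd i" for i
    using that jacobi_mult_left[OF that, of "-1" "-e"] by (auto simp: e jacobi_four_mult)
  have 4: "4 dvd int m - int n" if "c dvd int m - int n" using that assms(2) dvd_trans by blast
  have 5: "4 dvd int m + int n" if "c dvd int m + int n" using that assms(2) dvd_trans by blast
  show "jacobi c m = jacobi c n" if "c dvd int m - int n"
  proof -
    have "m mod 4 = 1 \<longleftrightarrow> n mod 4 = 1" using 4[OF that] by presburger
    then show ?thesis using pos that assms(3,4) unfolding J[OF assms(3)] J[OF assms(4)] by (simp add: jacobi_minus_one)
  qed
  show "jacobi c m = sgn c * jacobi c n" if "c dvd int m + int n"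
  proof -
    have "m mod 4 = 1 \<longleftrightarrow> n mod 4 = 3" using 5[OF that] by presburger
    moreover note odd_mod_4[OF assms(4)]
    ultimately show ?thesis using pos that assms(1,3,4) e unfolding J[OF assms(3)] J[OF assms(4)]
      by (auto simp: jacobi_minus_one sgn_if)
  qed
qed

lemma shimura_symbol_jacobi:
  "shimura_symbol c d = (if c < 0 \<and> d < 0 then - 1 else 1) * jacobi c (nat \<bar>d\<bar>)"
  by (simp add: shimura_symbol_def jacobi_def)

lemma jacobi_coprime:
  assumes "odd n" "coprime c (int n)"
  shows "jacobi c n \<in> {-1, 1}"
  using assms
proof (induction n rule: odd_prime_induct)
  case (mult p n)
  have "\<not> int p dvd c"
    using mult.prems mult.hyps by (metis coprime_common_divisor dvd_triv_left int_dvd_int_iff not_prime_unit of_nat_mult prime_nat_int_transfer)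
  then have "Legendre c p \<in> {-1, 1}" by (simp add: Legendre_def cong_0_iff)
  moreover have "jacobi c n \<in> {-1, 1}" using mult by simp
  ultimately show ?case using mult.hyps by (auto simp: jacobi_mult_right jacobi_prime odd_pos)
qed simp

lemma shimura_symbol_values:
  assumes "odd d" "coprime c d"
  shows "shimura_symbol c d \<in> {-1, 1}"
  using jacobi_coprime[of "nat \<bar>d\<bar>" c] assms by (auto simp: shimura_symbol_jacobi even_nat_iff)

text \<open>If d and c + d have opposite signs, then |d| and |c + d| add up to a multiple of c, and
  the resulting \<open>sgn c\<close> is undone by the sign in \<open>shimura_symbol\<close>. That
  convention is what makes the symbol periodic in the signed d.\<close>

lemma shimura_symbol_add:
  assumes "odd d" "4 dvd c" "coprime c d"
  shows "shimura_symbol c (c + d) = shimura_symbol c d"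
proof (cases "c = 0")
  case False
  have od: "odd (nat \<bar>d\<bar>)" "odd (nat \<bar>c + d\<bar>)" using assms by (auto simp: even_nat_iff)
  have 1: "c dvd int (nat \<bar>c + d\<bar>) - int (nat \<bar>d\<bar>)" if "(d < 0) = (c + d < 0)"
    using that by (auto simp: abs_if)
  have 2: "c dvd int (nat \<bar>c + d\<bar>) + int (nat \<bar>d\<bar>)" if "(d < 0) \<noteq> (c + d < 0)"
    using that by (auto simp: abs_if)
  show ?thesis
    using jacobi_periodic[OF False assms(2) od(2,1)] 1 2 False
    by (cases "(d < 0) = (c + d < 0)") (auto simp: shimura_symbol_jacobi sgn_if)
qed auto

section \<open>Branches of the square root and the theta multiplier on generators\<close>

declare csqrt.simps [simp del]

text \<open>\<open>moebius\<close> with integer entries, so that determinants and congruences are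
  computed in \<open>int\<close>.\<close>

definition mob :: "int \<Rightarrow> int \<Rightarrow> int \<Rightarrow> int \<Rightarrow> complex \<Rightarrow> complex" where
  "mob a b c d z = (of_int a * z + of_int b) / (of_int c * z + of_int d)"

lemma factors_pos: "0 < 2 * a * b \<Longrightarrow> 0 \<le> a \<Longrightarrow> a > 0 \<and> (b::real) > 0"
  and factors_neg: "2 * a * b < 0 \<Longrightarrow> 0 \<le> a \<Longrightarrow> a > 0 \<and> (b::real) < 0"
  by (auto simp: zero_less_mult_iff mult_less_0_iff)

lemma csqrt_upper: "Im z > 0 \<Longrightarrow> Re (csqrt z) > 0 \<and> Im (csqrt z) > 0"
  and csqrt_lower: "Im z < 0 \<Longrightarrow> Re (csqrt z) > 0 \<and> Im (csqrt z) < 0"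
proof -
  have *: "Im z = 2 * Re (csqrt z) * Im (csqrt z)"
    by (metis Im_power2 power2_csqrt)
  show "Im z > 0 \<Longrightarrow> Re (csqrt z) > 0 \<and> Im (csqrt z) > 0"
    using factors_pos[OF _ Re_csqrt] unfolding * .
  show "Im z < 0 \<Longrightarrow> Re (csqrt z) > 0 \<and> Im (csqrt z) < 0"
    using factors_neg[OF _ Re_csqrt] unfolding * .
qed

lemma csqrt_mult_Re:
  assumes "Re (csqrt x * csqrt y) > 0"
  shows "csqrt (x * y) = csqrt x * csqrt y"
  by (rule csqrt_unique) (use assms in \<open>auto simp: power_mult_distrib\<close>)

text \<open>The roots lie in the open first and fourth quadrants, so their product has positive real
  part and is the principal root.\<close>

lemma csqrt_mult_quadrants:
  assumes "Im x > 0" "Im y < 0"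
  shows "csqrt (x * y) = csqrt x * csqrt y"
proof (rule csqrt_mult_Re)
  have "Im (csqrt x) * Im (csqrt y) < 0" "Re (csqrt x) * Re (csqrt y) > 0"
    using csqrt_upper[OF assms(1)] csqrt_lower[OF assms(2)] by (auto simp: mult_pos_neg)
  then show "Re (csqrt x * csqrt y) > 0" by simp
qed

text \<open>Both roots lie in the first quadrant and their product in the upper half-plane; the sign
  is read off from the half-plane that contains the principal root of \<open>x * y\<close>.\<close>

lemma csqrt_mult_upper:
  assumes "Im x > 0" "Im y > 0"
  shows "Im (csqrt (x * y)) \<ge> 0 \<Longrightarrow> csqrt (x * y) = csqrt x * csqrt y"
    and "Im (x * y) < 0 \<Longrightarrow> csqrt (x * y) = - (csqrt x * csqrt y)"
proof -
  let ?p = "csqrt x * csqrt y"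
  have p: "Im ?p > 0"
    using csqrt_upper[OF assms(1)] csqrt_upper[OF assms(2)] by (auto intro: add_pos_pos)
  have "?p\<^sup>2 = (csqrt (x * y))\<^sup>2" by (simp add: power_mult_distrib)
  then have or: "csqrt (x * y) = ?p \<or> csqrt (x * y) = - ?p"
    by (metis power2_eq_iff)
  show "csqrt (x * y) = ?p" if "Im (csqrt (x * y)) \<ge> 0"
    using or p that by auto
  show "csqrt (x * y) = - ?p" if "Im (x * y) < 0"
    using or p csqrt_lower[OF that] by auto
qed

lemma uhp_denom_nonzero:
  assumes "Im z > 0" "c \<noteq> 0 \<or> d \<noteq> (0::real)"
  shows "of_real c * z + of_real d \<noteq> 0"
  using assms by (auto simp: complex_eq_iff)

lemma uhp_denom_nonzero_int:
  assumes "Im z > 0" "coprime c (d::int)"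
  shows "of_int c * z + of_int d \<noteq> 0"
  using assms by (auto simp: complex_eq_iff)

lemma Im_mob:
  assumes "a * d - b * c = 1"
  shows "Im (mob a b c d z) = Im z / (cmod (of_int c * z + of_int d))\<^sup>2"
proof -
  have "real_of_int a * of_int d - of_int b * of_int c = 1"
    using assms by (metis of_int_1 of_int_diff of_int_mult)
  moreover have "Im ((of_int a * z + of_int b) * cnj (of_int c * z + of_int d))
      = (real_of_int a * of_int d - of_int b * of_int c) * Im z"
    by (simp add: algebra_simps)
  ultimately have "Im ((of_int a * z + of_int b) * cnj (of_int c * z + of_int d)) = Im z" by simp
  then show ?thesis
    unfolding mob_def complex_div_cnj[of "of_int a * z + of_int b"] by (simp flip: of_real_power)
qed

lemma coprime_det: "a * d - b * c = (1::int) \<Longrightarrow> coprime c d"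
  by (metis coprimeI dvd_diff dvd_mult dvd_mult2 dvd_mult_right mult.commute)

lemma coprime_det': "a * d - b * c = (1::int) \<Longrightarrow> coprime a b"
  by (metis coprimeI dvd_diff dvd_mult dvd_mult2 dvd_mult_right mult.commute)

lemma mob_uhp:
  assumes "a * d - b * c = 1" "Im z > 0"
  shows "Im (mob a b c d z) > 0"
  using uhp_denom_nonzero_int[OF assms(2) coprime_det[OF assms(1)]] assms
  by (simp add: Im_mob)

lemma mob_mult:
  assumes "a' * d' - b' * c' = 1" "Im z > 0"
  shows "mob a b c d (mob a' b' c' d' z)
     = mob (a*a' + b*c') (a*b' + b*d') (c*a' + d*c') (c*b' + d*d') z"
proof -
  have "of_int c' * z + of_int d' \<noteq> 0"
    using uhp_denom_nonzero_int[OF assms(2) coprime_det[OF assms(1)]] .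
  then have *: "mob a' b' c' d' z * (of_int c' * z + of_int d') = of_int a' * z + of_int b'"
     "of_int c' * z + of_int d' \<noteq> 0"
    by (auto simp: mob_def)
  define w where "w = mob a' b' c' d' z"
  have "mob a b c d w = ((of_int a * w + of_int b) * (of_int c' * z + of_int d'))
       / ((of_int c * w + of_int d) * (of_int c' * z + of_int d'))"
    using * by (simp add: mob_def)
  also have "(of_int a * w + of_int b) * (of_int c' * z + of_int d') =
    of_int a * (w * (of_int c' * z + of_int d')) + of_int b * (of_int c' * z + of_int d')"
    by (simp add: algebra_simps)
  also have "\<dots> = of_int (a*a' + b*c') * z + of_int (a*b' + b*d')"
    unfolding w_def *(1) by (simp add: algebra_simps)
  also have "(of_int c * w + of_int d) * (of_int c' * z + of_int d') =
    of_int c * (w * (of_int c' * z + of_int d')) + of_int d * (of_int c' * z + of_int d')"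
    by (simp add: algebra_simps)
  also have "\<dots> = of_int (c*a' + d*c') * z + of_int (c*b' + d*d')"
    unfolding w_def *(1) by (simp add: algebra_simps)
  finally show ?thesis by (simp add: w_def mob_def)
qed

lemma theta_eps_cong: "d mod 4 = d' mod 4 \<Longrightarrow> theta_eps d = theta_eps d'"
  by (simp add: theta_eps_def)

lemma odd_of_coprime4: "4 dvd c \<Longrightarrow> coprime c (d::int) \<Longrightarrow> odd d"
  by (meson coprime_common_divisor dvd_trans even_numeral odd_one zdvd1_eq zdvd_not_zless even_mult_iff dvd_def)

lemma theta_factor_T:
  assumes "4 dvd c" "coprime c d"
  shows "theta_factor c (c + d) z = theta_factor c d (z + 1)"
proof -
  have "theta_eps (c + d) = theta_eps d"
    by (rule theta_eps_cong) (use assms in presburger)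
  then show ?thesis
    using shimura_symbol_add[OF odd_of_coprime4[OF assms] assms]
    by (simp add: theta_factor_def algebra_simps)
qed

lemma theta_factor_T':
  assumes "4 dvd c" "coprime c d"
  shows "theta_factor c (d - c) z = theta_factor c d (z - 1)"
proof -
  have "coprime c (d - c)" using assms(2) by (metis add.commute coprime_iff_gcd_eq_1 diff_add_cancel gcd_add1 gcd.commute)
  from theta_factor_T[OF assms(1) this, of "z - 1"] show ?thesis by simp
qed

text \<open>The root of -w is the root of w times i or -i, according to the sign of Im w, hence of
  c. The exchange of 1 and i in \<open>theta_eps\<close>, the factor (-1/|d|) and the sign of the
  symbol compensate for this, in each of four cases for sign and residue of d.\<close>

lemma theta_factor_uminus:
  assumes "4 dvd c" "coprime c d" "Im z > 0"
  shows "theta_factor (-c) (-d) z = theta_factor c d z"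
proof -
  have d: "odd d" using odd_of_coprime4 assms by blast
  then have d4: "d mod 4 = 1 \<and> (- d) mod 4 = 3 \<or> d mod 4 = 3 \<and> (- d) mod 4 = 1" by presburger
  have j: "jacobi (-c) (nat \<bar>d\<bar>) = (if nat \<bar>d\<bar> mod 4 = 1 then 1 else -1) * jacobi c (nat \<bar>d\<bar>)"
    using jacobi_mult_left[of "nat \<bar>d\<bar>" "-1" c] jacobi_minus_one[of "nat \<bar>d\<bar>"] d by (simp add: even_nat_iff)
  have nd: "nat \<bar>d\<bar> mod 4 = 1 \<longleftrightarrow> (d > 0 \<and> d mod 4 = 1 \<or> d < 0 \<and> d mod 4 = 3)"
  proof (cases "d > 0")
    case True
    then obtain n where n: "d = int n" by (metis zero_less_imp_eq_int)
    show ?thesis using True unfolding n by (simp; presburger)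
  next
    case False
    then obtain n where n: "d = - int n" by (metis nonneg_int_cases neg_0_le_iff_le not_less minus_equation_iff)
    show ?thesis using False d unfolding n by (simp; presburger)
  qed
  have d0: "d \<noteq> 0" using d by auto
  define w where "w = of_int c * z + of_int d"
  have w0: "w \<noteq> 0" using uhp_denom_nonzero_int assms by (simp add: w_def)
  have imw: "Im w = of_int c * Im z" "Re w = of_int c * Re z + of_int d" by (simp_all add: w_def)
  have neg: "of_int (- c) * z + of_int (- d) = - w" by (simp add: w_def)
  have c0: "\<bar>d\<bar> = 1" if "c = 0" using that assms by simp
  consider "d < 0" "d mod 4 = 1" "(- d) mod 4 = 3" | "d < 0" "d mod 4 = 3" "(- d) mod 4 = 1"
    | "d > 0" "d mod 4 = 1" "(- d) mod 4 = 3" | "d > 0" "d mod 4 = 3" "(- d) mod 4 = 1"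
    using d4 d0 by linarith
  note four = this
  have jj: "jacobi (-c) (nat \<bar>d\<bar>) = (if d > 0 \<and> d mod 4 = 1 \<or> d < 0 \<and> d mod 4 = 3 then 1 else -1) * jacobi c (nat \<bar>d\<bar>)"
    using j nd by simp
  have main: "inverse (theta_eps (- d)) * of_int (shimura_symbol (-c) (-d)) * csqrt (-w) =
      inverse (theta_eps d) * of_int (shimura_symbol c d) * csqrt w"
  proof (rule linorder_cases[of c 0])
    assume c: "c < 0"
    then have "Im w < 0" using assms by (simp add: imw mult_neg_pos)
    then have cs: "csqrt (- w) = \<i> * csqrt w"
      by (intro csqrt_unique) (use csqrt_lower[of w] in \<open>auto simp: power_mult_distrib\<close>)
    show ?thesis unfolding cs shimura_symbol_jacobi
      using four by cases (use c jj in \<open>simp_all add: theta_eps_def algebra_simps\<close>)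
  next
    assume c: "c = 0"
    then have "d = 1 \<or> d = -1" using c0 by linarith
    then show ?thesis using c
      by (auto simp: w_def theta_eps_def shimura_symbol_jacobi csqrt_minus_Reals)
  next
    assume c: "c > 0"
    then have "Im w > 0" using assms by (simp add: imw)
    then have cs: "csqrt (- w) = - \<i> * csqrt w"
      by (intro csqrt_unique) (use csqrt_upper[of w] in \<open>auto simp: power_mult_distrib\<close>)
    show ?thesis unfolding cs shimura_symbol_jacobi
      using four by cases (use c jj in \<open>simp_all add: theta_eps_def algebra_simps\<close>)
  qed
  show ?thesis using main by (simp only: theta_factor_def neg w_def[symmetric])
qed

text \<open>\<open>theta_eps\<close> and the Jacobi symbol agree on both sides, as c + 4d = c modulo
  d. What remains is a branch of the square root: for c > 0 > c + 4d the principal root changes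
  sign, and so does \<open>shimura_symbol\<close>, since then d < 0.\<close>

lemma theta_factor_V:
  assumes "4 dvd c" "coprime c d" "Im z > 0"
  shows "theta_factor (c + 4 * d) d z = theta_factor c d (z / (4 * z + 1)) * csqrt (4 * z + 1)"
proof -
  define v where "v = z / (4 * z + 1)"
  have nz: "4 * z + 1 \<noteq> 0" using uhp_denom_nonzero[of z 4 1] assms by simp
  have d: "odd d" using odd_of_coprime4 assms by blast
  have v: "v = mob 1 0 4 1 z" by (simp add: v_def mob_def)
  have imv: "Im v > 0" unfolding v using assms by (intro mob_uhp) auto
  have prod: "(of_int c * v + of_int d) * (4 * z + 1) = of_int (c + 4 * d) * z + of_int d"
    using nz by (simp add: v_def field_simps)
  have J: "jacobi (c + 4 * d) (nat \<bar>d\<bar>) = jacobi c (nat \<bar>d\<bar>)"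
    by (rule jacobi_cong) (use d in \<open>auto simp: cong_iff_dvd_diff even_nat_iff\<close>)
  have im1: "Im (4 * z + 1) > 0" using assms by simp
  have *: "of_int (shimura_symbol (c + 4 * d) d) * csqrt (of_int (c + 4 * d) * z + of_int d)
    = of_int (shimura_symbol c d) * (csqrt (of_int c * v + of_int d) * csqrt (4 * z + 1))"
  proof (rule linorder_cases[of c 0])
    assume c: "c > 0"
    then have im2: "Im (of_int c * v + of_int d) > 0" using imv by simp
    show ?thesis
    proof (cases "c + 4 * d \<ge> 0")
      case True
      have "Im (csqrt (of_int (c + 4 * d) * z + of_int d)) \<ge> 0"
      proof (cases "c + 4 * d = 0")
        case True
        then show ?thesis by (simp add: csqrt_of_real'[of "of_int d", simplified])
      next
        case False
        then show ?thesis using True assms by (intro less_imp_le conjunct2[OF csqrt_upper]) simp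
      qed
      then have "csqrt (of_int (c + 4 * d) * z + of_int d) = csqrt (of_int c * v + of_int d) * csqrt (4 * z + 1)"
        using csqrt_mult_upper(1)[OF im2 im1] unfolding prod by simp
      then show ?thesis using c True by (simp add: shimura_symbol_jacobi J)
    next
      case False
      then have "Im (of_int (c + 4 * d) * z + of_int d) < 0"
        using assms by (simp add: mult_neg_pos del: of_int_add)
      then have "csqrt (of_int (c + 4 * d) * z + of_int d) = - (csqrt (of_int c * v + of_int d) * csqrt (4 * z + 1))"
        using csqrt_mult_upper(2)[OF im2 im1] unfolding prod by simp
      moreover have "d < 0" using c False by linarith
      ultimately show ?thesis using c False J by (simp add: shimura_symbol_jacobi)
    qed
  next
    assume c: "c < 0"
    then have im2: "Im (of_int c * v + of_int d) < 0" using imv by (simp add: mult_neg_pos)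
    have "csqrt (of_int (c + 4 * d) * z + of_int d) = csqrt (of_int c * v + of_int d) * csqrt (4 * z + 1)"
      using csqrt_mult_quadrants[OF im1 im2] unfolding prod[symmetric] by (simp add: mult.commute)
    moreover have "c + 4 * d < 0" if "d < 0" using c that by simp
    ultimately show ?thesis using c by (simp add: shimura_symbol_jacobi J)
  next
    assume c: "c = 0"
    then have "d = 1 \<or> d = -1" using assms by auto
    then show ?thesis
    proof
      assume "d = -1"
      moreover have "csqrt (- (4 * z + 1)) = - \<i> * csqrt (4 * z + 1)"
        using csqrt_upper[OF im1] by (intro csqrt_unique) (auto simp: power_mult_distrib)
      moreover have "csqrt (-1) = \<i>" using csqrt_of_real'[of "-1"] by simp
      ultimately show ?thesis using c J by (simp add: shimura_symbol_jacobi algebra_simps)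
    qed (use c J in \<open>simp add: shimura_symbol_jacobi\<close>)
  qed
  show ?thesis using * unfolding theta_factor_def v_def[symmetric] by (simp add: algebra_simps)
qed

text \<open>This is \<open>theta_factor_V\<close> for c - 4d at the point w = z/(1 - 4z). Because 4w
  + 1 is the inverse of 1 - 4z, the two square roots multiply to 1.\<close>

lemma theta_factor_V':
  assumes "4 dvd c" "coprime c d" "Im z > 0"
  shows "theta_factor (c - 4 * d) d z = theta_factor c d (z / (1 - 4 * z)) * csqrt (1 - 4 * z)"
proof -
  define w where "w = z / (1 - 4 * z)"
  have nz: "1 - 4 * z \<noteq> 0" using uhp_denom_nonzero[of z "-4" 1] assms by simp
  have w: "w = mob 1 0 (-4) 1 z" by (simp add: w_def mob_def)
  have "Im w > 0" unfolding w using assms by (intro mob_uhp) auto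
  moreover have "coprime (c - 4 * d) d"
    using assms(2) by (metis coprime_iff_gcd_eq_1 gcd.commute gcd_add_mult diff_add_cancel mult.commute add.commute)
  moreover have "4 dvd c - 4 * d" using assms(1) by simp
  ultimately have "theta_factor c d w = theta_factor (c - 4 * d) d (w / (4 * w + 1)) * csqrt (4 * w + 1)"
    using theta_factor_V[of "c - 4 * d" d w] by simp
  also have e: "4 * w + 1 = inverse (1 - 4 * z)" using nz by (simp add: w_def field_simps)
  also have "w / inverse (1 - 4 * z) = z" using nz by (simp add: w_def)
  finally have "theta_factor c d w * csqrt (1 - 4 * z)
      = theta_factor (c - 4 * d) d z * (csqrt (inverse (1 - 4 * z)) * csqrt (1 - 4 * z))"
    by simp
  also have "csqrt (inverse (1 - 4 * z)) * csqrt (1 - 4 * z) = 1"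
  proof -
    have "Im (1 - 4 * z) < 0" "Im (inverse (1 - 4 * z)) > 0"
      using assms e[symmetric] \<open>Im w > 0\<close> by auto
    from csqrt_mult_quadrants[OF this(2,1)]
    have "csqrt (inverse (1 - 4 * z)) * csqrt (1 - 4 * z) = csqrt (inverse (1 - 4 * z) * (1 - 4 * z))" ..
    also have "inverse (1 - 4 * z) * (1 - 4 * z) = 1" using nz by (rule left_inverse)
    finally show ?thesis by simp
  qed
  finally show ?thesis by (simp add: w_def)
qed

text \<open>Euclid's algorithm with centred remainders: \<open>\<Gamma>\<^sub>0(4)\<close> is generated by $-1$,
  $z \mapsto z + 1$ and $z \mapsto z / (4 z + 1)$.\<close>

lemma Gamma0_4_induct [consumes 2, case_names one T T' V V' uminus]:
  assumes det: "a * d - b * c = (1::int)" and c: "4 dvd c"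
    and one: "P 1 0 0 1"
    and T: "\<And>a b c d. a * d - b * c = 1 \<Longrightarrow> 4 dvd c \<Longrightarrow> P a b c d \<Longrightarrow> P a (a + b) c (c + d)"
    and T': "\<And>a b c d. a * d - b * c = 1 \<Longrightarrow> 4 dvd c \<Longrightarrow> P a b c d \<Longrightarrow> P a (b - a) c (d - c)"
    and V: "\<And>a b c d. a * d - b * c = 1 \<Longrightarrow> 4 dvd c \<Longrightarrow> P a b c d \<Longrightarrow> P (a + 4 * b) b (c + 4 * d) d"
    and V': "\<And>a b c d. a * d - b * c = 1 \<Longrightarrow> 4 dvd c \<Longrightarrow> P a b c d \<Longrightarrow> P (a - 4 * b) b (c - 4 * d) d"
    and U: "\<And>a b c d. a * d - b * c = 1 \<Longrightarrow> 4 dvd c \<Longrightarrow> P a b c d \<Longrightarrow> P (-a) (-b) (-c) (-d)"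
  shows "P a b c d"
  using det c
proof (induction "nat (\<bar>c\<bar> + \<bar>d\<bar>)" arbitrary: a b c d rule: less_induct)
  case less
  note det = less.prems(1) and c = less.prems(2)
  have odd: "odd d" using odd_of_coprime4[OF c coprime_det[OF det]] .
  have T_inv: "P a b c d" if "P a (a + b) c (c + d)"
    using T'[OF _ c that] det by (simp add: algebra_simps)
  have T'_inv: "P a b c d" if "P a (b - a) c (d - c)"
    using T[OF _ c that] det by (simp add: algebra_simps)
  have V_inv: "P a b c d" if "P (a + 4 * b) b (c + 4 * d) d"
    using V'[OF _ _ that] det c by (simp add: algebra_simps)
  have V'_inv: "P a b c d" if "P (a - 4 * b) b (c - 4 * d) d"
    using V[OF _ _ that] det c by (simp add: algebra_simps)
  show ?case
  proof (cases "c = 0")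
    case True
    have base: "P 1 b 0 1" for b
    proof (induction "nat \<bar>b\<bar>" arbitrary: b rule: less_induct)
      case less
      consider "b = 0" | "b > 0" | "b < 0" by linarith
      then show ?case
      proof cases
        case 2
        then have "P 1 (b - 1) 0 1" using less by simp
        from T[OF _ _ this] show ?thesis by simp
      next
        case 3
        then have "P 1 (b + 1) 0 1" using less by simp
        from T'[OF _ _ this] show ?thesis by simp
      qed (use one in simp)
    qed
    have "a = 1 \<and> d = 1 \<or> a = -1 \<and> d = -1"
      using det True by (simp add: zmult_eq_1_iff)
    then show ?thesis
      using base[of b] U[OF _ _ base[of "-b"]] True by auto
  next
    case False
    \<comment> \<open>d is odd and c is divisible by 4, so 2|d| and |c| differ modulo 4. Equality,
      the only case without strict descent, cannot occur.\<close>
    have ne: "2 * \<bar>d\<bar> \<noteq> \<bar>c\<bar>" using odd c by (auto simp: abs_if elim!: dvdE split: if_splits) presburger+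
    show ?thesis
    proof (cases "2 * \<bar>d\<bar> > \<bar>c\<bar>")
      case True
      then consider "\<bar>c + d\<bar> < \<bar>d\<bar>" | "\<bar>d - c\<bar> < \<bar>d\<bar>" using False by linarith
      then show ?thesis
      proof cases
        case 1
        then show ?thesis using det c by (intro T_inv less.hyps) (auto simp: algebra_simps)
      next
        case 2
        then show ?thesis using det c by (intro T'_inv less.hyps) (auto simp: algebra_simps)
      qed
    next
      case l: False
      have "d \<noteq> 0" using odd by auto
      then consider "\<bar>c + 4 * d\<bar> < \<bar>c\<bar>" | "\<bar>c - 4 * d\<bar> < \<bar>c\<bar>" using l ne by linarith
      then show ?thesis
      proof cases
        case 1
        then show ?thesis using det c by (intro V_inv less.hyps) (auto simp: algebra_simps)
      next
        case 2
        then show ?thesis using det c by (intro V'_inv less.hyps) (auto simp: algebra_simps)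
      qed
    qed
  qed
qed


lemma mob_T: "mob a (a + b) c (c + d) z = mob a b c d (z + 1)"
  and mob_T': "mob a (b - a) c (d - c) z = mob a b c d (z - 1)"
  and mob_uminus: "mob (-a) (-b) (-c) (-d) z = mob a b c d z"
proof -
  show "mob a (a + b) c (c + d) z = mob a b c d (z + 1)"
    and "mob a (b - a) c (d - c) z = mob a b c d (z - 1)"
    by (simp_all add: mob_def algebra_simps)
  have "mob (-a) (-b) (-c) (-d) z = - (of_int a * z + of_int b) / - (of_int c * z + of_int d)"
    by (simp add: mob_def)
  then show "mob (-a) (-b) (-c) (-d) z = mob a b c d z"
    by (simp only: minus_divide_divide mob_def)
qed

lemma mob_V: "Im z > 0 \<Longrightarrow> mob (a + 4 * b) b (c + 4 * d) d z = mob a b c d (z / (4 * z + 1))"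
  using mob_mult[of 1 1 0 4 z a b c d] by (simp add: mob_def[of 1 0 4 1] mult.commute)

lemma mob_V': "Im z > 0 \<Longrightarrow> mob (a - 4 * b) b (c - 4 * d) d z = mob a b c d (z / (1 - 4 * z))"
  using mob_mult[of 1 1 0 "-4" z a b c d] by (simp add: mob_def[of 1 0 "-4" 1] mult.commute)

lemma Im_V: "Im z > 0 \<Longrightarrow> Im (z / (4 * z + 1)) > 0"
  and Im_V': "Im z > 0 \<Longrightarrow> Im (z / (1 - 4 * z)) > 0"
  using mob_uhp[of 1 1 0 4 z] mob_uhp[of 1 1 0 "-4" z]
  by (simp_all add: mob_def)

lemma theta_factor_one [simp]: "theta_factor 0 1 z = 1"
  by (simp add: theta_factor_def theta_eps_def shimura_symbol_jacobi)

lemma Gamma0_step: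
  fixes a b c d :: int
  assumes "a * d - b * c = 1" "a' * d' - b' * c' = 1" "4 dvd c" "4 dvd c'"
  shows "(a*a' + b*c') * (c*b' + d*d') - (a*b' + b*d') * (c*a' + d*c') = 1" "4 dvd c*a' + d*c'"
proof -
  have "(a*a' + b*c') * (c*b' + d*d') - (a*b' + b*d') * (c*a' + d*c') = (a*d - b*c) * (a'*d' - b'*c')"
    by (simp add: algebra_simps)
  then show "(a*a' + b*c') * (c*b' + d*d') - (a*b' + b*d') * (c*a' + d*c') = 1"
    using assms by simp
qed (use assms in simp)

text \<open>This is the identity usually read off from the theta series. Generators are multiplied
  on the right of the second matrix: this moves z by the generator and changes both sides by one and
  the same rule.\<close>

theorem theta_factor_cocycle:
  assumes "a * d - b * c = 1" "4 dvd c" "a' * d' - b' * c' = 1" "4 dvd c'" "Im z > 0"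
  shows "theta_factor (c*a' + d*c') (c*b' + d*d') z
     = theta_factor c d (mob a' b' c' d' z) * theta_factor c' d' z"
  using assms(3-5)
proof (induction a' b' c' d' arbitrary: z rule: Gamma0_4_induct)
  case one
  then show ?case by (simp add: mob_def)
next
  case (T a' b' c' d' z)
  note s = Gamma0_step[OF assms(1) T(1) assms(2) T(2)]
  note cp = coprime_det[OF s(1)]
  have "theta_factor (c*a' + d*c') (c*(a'+b') + d*(c'+d')) z
    = theta_factor (c*a' + d*c') ((c*a' + d*c') + (c*b' + d*d')) z"
    by (simp add: algebra_simps)
  also have "\<dots> = theta_factor (c*a' + d*c') (c*b' + d*d') (z + 1)"
    by (rule theta_factor_T[OF s(2) cp])
  also have "\<dots> = theta_factor c d (mob a' b' c' d' (z + 1)) * theta_factor c' d' (z + 1)"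
    using T.prems by (intro T.IH) auto
  also have "theta_factor c' d' (z + 1) = theta_factor c' (c' + d') z"
    using theta_factor_T[OF T(2) coprime_det[OF T(1)]] by simp
  finally show ?case by (simp only: mob_T)
next
  case (T' a' b' c' d' z)
  note s = Gamma0_step[OF assms(1) T'(1) assms(2) T'(2)]
  note cp = coprime_det[OF s(1)]
  have "theta_factor (c*a' + d*c') (c*(b'-a') + d*(d'-c')) z
    = theta_factor (c*a' + d*c') ((c*b' + d*d') - (c*a' + d*c')) z"
    by (simp add: algebra_simps)
  also have "\<dots> = theta_factor (c*a' + d*c') (c*b' + d*d') (z - 1)"
    by (rule theta_factor_T'[OF s(2) cp])
  also have "\<dots> = theta_factor c d (mob a' b' c' d' (z - 1)) * theta_factor c' d' (z - 1)"
    using T'.prems by (intro T'.IH) auto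
  also have "theta_factor c' d' (z - 1) = theta_factor c' (d' - c') z"
    using theta_factor_T'[OF T'(2) coprime_det[OF T'(1)]] by simp
  finally show ?case by (simp only: mob_T')
next
  case (V a' b' c' d' z)
  note s = Gamma0_step[OF assms(1) V(1) assms(2) V(2)]
  note cp = coprime_det[OF s(1)]
  define w where "w = z / (4 * z + 1)"
  have "theta_factor (c*(a' + 4*b') + d*(c' + 4*d')) (c*b' + d*d') z
    = theta_factor ((c*a' + d*c') + 4 * (c*b' + d*d')) (c*b' + d*d') z"
    by (simp add: algebra_simps)
  also have "\<dots> = theta_factor (c*a' + d*c') (c*b' + d*d') w * csqrt (4 * z + 1)"
    unfolding w_def by (rule theta_factor_V[OF s(2) cp V.prems])
  also have "theta_factor (c*a' + d*c') (c*b' + d*d') w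
     = theta_factor c d (mob a' b' c' d' w) * theta_factor c' d' w"
    unfolding w_def by (intro V.IH Im_V V.prems)
  also have "\<dots> * csqrt (4 * z + 1) = theta_factor c d (mob a' b' c' d' w) * theta_factor (c' + 4 * d') d' z"
    using theta_factor_V[OF V(2) coprime_det[OF V(1)] V.prems] by (simp add: w_def)
  finally show ?case using mob_V[OF V.prems] by (simp only: w_def)
next
  case (V' a' b' c' d' z)
  note s = Gamma0_step[OF assms(1) V'(1) assms(2) V'(2)]
  note cp = coprime_det[OF s(1)]
  define w where "w = z / (1 - 4 * z)"
  have "theta_factor (c*(a' - 4*b') + d*(c' - 4*d')) (c*b' + d*d') z
    = theta_factor ((c*a' + d*c') - 4 * (c*b' + d*d')) (c*b' + d*d') z"
    by (simp add: algebra_simps)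
  also have "\<dots> = theta_factor (c*a' + d*c') (c*b' + d*d') w * csqrt (1 - 4 * z)"
    unfolding w_def by (rule theta_factor_V'[OF s(2) cp V'.prems])
  also have "theta_factor (c*a' + d*c') (c*b' + d*d') w
     = theta_factor c d (mob a' b' c' d' w) * theta_factor c' d' w"
    unfolding w_def by (intro V'.IH Im_V' V'.prems)
  also have "\<dots> * csqrt (1 - 4 * z) = theta_factor c d (mob a' b' c' d' w) * theta_factor (c' - 4 * d') d' z"
    using theta_factor_V'[OF V'(2) coprime_det[OF V'(1)] V'.prems] by (simp add: w_def)
  finally show ?case using mob_V'[OF V'.prems] by (simp only: w_def)
next
  case (uminus a' b' c' d' z)
  note s = Gamma0_step[OF assms(1) uminus(1) assms(2) uminus(2)]
  note cp = coprime_det[OF s(1)]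
  have "theta_factor (c*(-a') + d*(-c')) (c*(-b') + d*(-d')) z
    = theta_factor (-(c*a' + d*c')) (-(c*b' + d*d')) z"
    by (simp add: algebra_simps)
  also have "\<dots> = theta_factor (c*a' + d*c') (c*b' + d*d') z"
    by (rule theta_factor_uminus[OF s(2) cp uminus.prems])
  also have "\<dots> = theta_factor c d (mob a' b' c' d' z) * theta_factor c' d' z"
    by (rule uminus.IH[OF uminus.prems])
  also have "theta_factor c' d' z = theta_factor (-c') (-d') z"
    by (rule theta_factor_uminus[OF uminus(2) coprime_det[OF uminus(1)] uminus.prems, symmetric])
  finally show ?case by (simp only: mob_uminus)
qed

section \<open>The theta multiplier and the Fricke involution\<close>

lemma Im_neg_inverse: "Im z > 0 \<Longrightarrow> Im (- 1 / (4 * z)) > 0"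
  by (auto simp: Im_divide intro!: divide_pos_pos add_nonneg_pos)

lemma coprime_fricke:
  assumes "a * d - b * c = (1::int)" "4 dvd c"
  shows "coprime (- 4 * b) a"
proof -
  have "odd a"
  proof
    assume "even a"
    then have "even (a * d - b * c)" using assms(2) by auto
    then show False using assms(1) by simp
  qed
  then have "coprime a (2 ^ 2)" by (simp only: coprime_power_right_iff coprime_right_2_iff_odd) simp
  then show ?thesis using coprime_det'[OF assms(1)] by (simp add: coprime_commute)
qed

text \<open>How the theta multiplier behaves under conjugation by the Fricke involution
  \<open>z \<mapsto> - 1 / (4 z)\<close>.\<close>

theorem theta_factor_fricke:
  assumes "a * d - b * c = 1" "4 dvd c" "Im z > 0"
  shows "theta_factor (- 4 * b) a (- 1 / (4 * z)) * csqrt z = csqrt (mob a b c d z) * theta_factor c d z"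
  using assms
proof (induction a b c d arbitrary: z rule: Gamma0_4_induct)
  case one
  then show ?case by (simp add: mob_def)
next
  case (T a b c d z)
  define w where "w = - 1 / (4 * z)"
  have z0: "z \<noteq> 0" "z + 1 \<noteq> 0" using T.prems by (auto simp: complex_eq_iff)
  have imw: "Im w > 0" unfolding w_def by (rule Im_neg_inverse[OF T.prems])
  note cp = coprime_fricke[OF T(1,2)]
  \<comment> \<open>The Fricke map turns the translation z + 1 into the lower triangular move
    \<open>V'\<close> of the pair (-4b, a); the square root this produces combines with the root of
    z to the root of z + 1.\<close>
  have "- 4 * (a + b) = - 4 * b - 4 * a" by (simp add: distrib_left)
  then have "theta_factor (- 4 * (a + b)) a w = theta_factor (- 4 * b - 4 * a) a w" by (simp only:)
  also have "\<dots> = theta_factor (- 4 * b) a (w / (1 - 4 * w)) * csqrt (1 - 4 * w)"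
    by (rule theta_factor_V') (use cp imw in simp_all)
  also have "w / (1 - 4 * w) = - 1 / (4 * (z + 1))" using z0 by (simp add: w_def field_simps)
  finally have 1: "theta_factor (- 4 * (a + b)) a w * csqrt z =
      theta_factor (- 4 * b) a (- 1 / (4 * (z + 1))) * (csqrt (1 - 4 * w) * csqrt z)" by simp
  have "csqrt (z * (1 - 4 * w)) = csqrt z * csqrt (1 - 4 * w)"
    by (rule csqrt_mult_quadrants) (use T.prems imw in simp_all)
  then have "csqrt (1 - 4 * w) * csqrt z = csqrt (z * (1 - 4 * w))" by (simp only: mult.commute)
  also have "z * (1 - 4 * w) = z + 1" using z0 by (simp add: w_def field_simps)
  finally have 2: "csqrt (1 - 4 * w) * csqrt z = csqrt (z + 1)" .
  have "theta_factor (- 4 * (a + b)) a w * csqrt z = csqrt (mob a b c d (z + 1)) * theta_factor c d (z + 1)"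
    unfolding 1 2 using T.prems by (intro T.IH) simp
  then show ?case using theta_factor_T[OF T(2) coprime_det[OF T(1)]] by (simp only: mob_T w_def)
next
  case (T' a b c d z)
  define w where "w = - 1 / (4 * z)"
  have z0: "z \<noteq> 0" "z - 1 \<noteq> 0" using T'.prems by (auto simp: complex_eq_iff)
  have imw: "Im w > 0" unfolding w_def by (rule Im_neg_inverse[OF T'.prems])
  note cp = coprime_fricke[OF T'(1,2)]
  have "- 4 * (b - a) = - 4 * b + 4 * a" by (simp add: right_diff_distrib)
  then have "theta_factor (- 4 * (b - a)) a w = theta_factor (- 4 * b + 4 * a) a w" by (simp only:)
  also have "\<dots> = theta_factor (- 4 * b) a (w / (4 * w + 1)) * csqrt (4 * w + 1)"
    by (rule theta_factor_V) (use cp imw in simp_all)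
  also have "w / (4 * w + 1) = - 1 / (4 * (z - 1))" using z0 by (simp add: w_def field_simps)
  finally have 1: "theta_factor (- 4 * (b - a)) a w * csqrt z =
      theta_factor (- 4 * b) a (- 1 / (4 * (z - 1))) * (csqrt (4 * w + 1) * csqrt z)" by simp
  have e: "(4 * w + 1) * z = z - 1" using z0 by (simp add: w_def field_simps)
  have "csqrt ((4 * w + 1) * z) = csqrt (4 * w + 1) * csqrt z"
    by (rule csqrt_mult_upper(1))
       (use T'.prems imw csqrt_upper[of "z - 1"] in \<open>simp_all add: e\<close>)
  then have 2: "csqrt (4 * w + 1) * csqrt z = csqrt (z - 1)" by (simp add: e)
  have "theta_factor (- 4 * (b - a)) a w * csqrt z = csqrt (mob a b c d (z - 1)) * theta_factor c d (z - 1)"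
    unfolding 1 2 using T'.prems by (intro T'.IH) simp
  then show ?case using theta_factor_T'[OF T'(2) coprime_det[OF T'(1)]] by (simp only: mob_T' w_def)
next
  case (V a b c d z)
  define w where "w = - 1 / (4 * z)"
  define v where "v = z / (4 * z + 1)"
  have z0: "z \<noteq> 0" "4 * z + 1 \<noteq> 0" using V.prems by (auto simp: complex_eq_iff)
  note cp = coprime_fricke[OF V(1,2)]
  \<comment> \<open>In the opposite direction a lower triangular generator becomes a translation of
    w, and the square root comes from z = v (4z + 1).\<close>
  have "theta_factor (- 4 * b) (a + 4 * b) w = theta_factor (- 4 * b) (a - (- 4 * b)) w" by simp
  also have "\<dots> = theta_factor (- 4 * b) a (w - 1)"
    by (rule theta_factor_T'[OF _ cp]) simp
  also have "w - 1 = - 1 / (4 * v)" using z0 by (simp add: w_def v_def field_simps)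
  finally have 1: "theta_factor (- 4 * b) (a + 4 * b) w = theta_factor (- 4 * b) a (- 1 / (4 * v))" .
  have imv: "Im v > 0" using Im_V[OF V.prems] by (simp add: v_def)
  have e: "v * (4 * z + 1) = z" using z0 by (simp add: v_def)
  have "csqrt (v * (4 * z + 1)) = csqrt v * csqrt (4 * z + 1)"
    by (rule csqrt_mult_upper(1)) (use V.prems imv csqrt_upper[of z] in \<open>simp_all add: e\<close>)
  then have 2: "csqrt z = csqrt v * csqrt (4 * z + 1)" by (simp add: e)
  have "theta_factor (- 4 * b) (a + 4 * b) w * csqrt z
      = (theta_factor (- 4 * b) a (- 1 / (4 * v)) * csqrt v) * csqrt (4 * z + 1)"
    unfolding 1 2 by simp
  also have "\<dots> = csqrt (mob a b c d v) * (theta_factor c d v * csqrt (4 * z + 1))"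
    unfolding V.IH[OF imv] by simp
  also have "theta_factor c d v * csqrt (4 * z + 1) = theta_factor (c + 4 * d) d z"
    using theta_factor_V[OF V(2) coprime_det[OF V(1)] V.prems] by (simp add: v_def)
  finally show ?case using mob_V[OF V.prems] by (simp only: v_def w_def)
next
  case (V' a b c d z)
  define w where "w = - 1 / (4 * z)"
  define v where "v = z / (1 - 4 * z)"
  have z0: "z \<noteq> 0" "1 - 4 * z \<noteq> 0" using V'.prems by (auto simp: complex_eq_iff)
  note cp = coprime_fricke[OF V'(1,2)]
  have "theta_factor (- 4 * b) (a - 4 * b) w = theta_factor (- 4 * b) (- 4 * b + a) w" by simp
  also have "\<dots> = theta_factor (- 4 * b) a (w + 1)"
    by (rule theta_factor_T[OF _ cp]) simp
  also have "w + 1 = - 1 / (4 * v)" using z0 by (simp add: w_def v_def field_simps)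
  finally have 1: "theta_factor (- 4 * b) (a - 4 * b) w = theta_factor (- 4 * b) a (- 1 / (4 * v))" .
  have imv: "Im v > 0" using Im_V'[OF V'.prems] by (simp add: v_def)
  have e: "v * (1 - 4 * z) = z" using z0 by (simp add: v_def)
  have "csqrt (v * (1 - 4 * z)) = csqrt v * csqrt (1 - 4 * z)"
    by (rule csqrt_mult_quadrants) (use V'.prems imv in simp_all)
  then have 2: "csqrt z = csqrt v * csqrt (1 - 4 * z)" by (simp add: e)
  have "theta_factor (- 4 * b) (a - 4 * b) w * csqrt z
      = (theta_factor (- 4 * b) a (- 1 / (4 * v)) * csqrt v) * csqrt (1 - 4 * z)"
    unfolding 1 2 by simp
  also have "\<dots> = csqrt (mob a b c d v) * (theta_factor c d v * csqrt (1 - 4 * z))"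
    unfolding V'.IH[OF imv] by simp
  also have "theta_factor c d v * csqrt (1 - 4 * z) = theta_factor (c - 4 * d) d z"
    using theta_factor_V'[OF V'(2) coprime_det[OF V'(1)] V'.prems] by (simp add: v_def)
  finally show ?case using mob_V'[OF V'.prems] by (simp only: v_def w_def)
next
  case (uminus a b c d z)
  note cp = coprime_fricke[OF uminus(1,2)]
  have "theta_factor (- (- 4 * b)) (- a) (- 1 / (4 * z)) = theta_factor (- 4 * b) a (- 1 / (4 * z))"
    by (rule theta_factor_uminus[OF _ cp Im_neg_inverse[OF uminus.prems]]) simp
  moreover have "theta_factor (-c) (-d) z = theta_factor c d z"
    by (rule theta_factor_uminus[OF uminus(2) coprime_det[OF uminus(1)] uminus.prems])
  ultimately show ?case using uminus.IH[OF uminus.prems] by (simp add: mob_uminus)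
qed

text \<open>The fourth power removes \<open>theta_eps\<close> and the symbol, and so does the
  absolute value. The first fact controls the multipliers at the cusps, the second one gives the
  invariance of \<open>hnorm\<close>.\<close>

lemma theta_factor_square:
  assumes "4 dvd c" "coprime c d"
  shows "theta_factor c d z ^ 4 = (of_int c * z + of_int d)\<^sup>2"
    and "(cmod (theta_factor c d z))\<^sup>2 = cmod (of_int c * z + of_int d)"
proof -
  have s: "shimura_symbol c d = 1 \<or> shimura_symbol c d = - 1"
    using shimura_symbol_values[OF odd_of_coprime4[OF assms] assms(2)] by auto
  have "csqrt w ^ 4 = w\<^sup>2" for w :: complex
    by (metis power2_csqrt power_mult mult_2 numeral_Bit0 power2_eq_square power_add)
  moreover have "inverse (theta_eps d) ^ 4 = 1" by (simp add: theta_eps_def power_inverse)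
  moreover have "complex_of_int (shimura_symbol c d) ^ 4 = 1" using s by auto
  ultimately show "theta_factor c d z ^ 4 = (of_int c * z + of_int d)\<^sup>2"
    by (simp add: theta_factor_def power_mult_distrib)
  have "cmod (inverse (theta_eps d)) = 1" by (simp add: theta_eps_def norm_inverse)
  moreover have "cmod (complex_of_int (shimura_symbol c d)) = 1" using s by auto
  ultimately show "(cmod (theta_factor c d z))\<^sup>2 = cmod (of_int c * z + of_int d)"
    by (simp add: theta_factor_def norm_mult)
qed

section \<open>The hyperbolic measure and unfolding\<close>

text \<open>Real coordinates, in which the derivative of a holomorphic map is a 2 by 2 matrix and
  the change of variables formula speaks of its determinant.\<close>

definition to_vec2 :: "complex \<Rightarrow> real^2" where "to_vec2 z = vector [Re z, Im z]"
definition of_vec2 :: "real^2 \<Rightarrow> complex" where "of_vec2 v = Complex (v $ 1) (v $ 2)"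

lemma of_to_vec2 [simp]: "of_vec2 (to_vec2 z) = z"
  by (simp add: to_vec2_def of_vec2_def)

lemma to_of_vec2 [simp]: "to_vec2 (of_vec2 v) = v"
  by (simp add: to_vec2_def of_vec2_def vec_eq_iff forall_2)

lemma linear_to_vec2: "linear to_vec2"
  by (rule linearI) (simp_all add: to_vec2_def vec_eq_iff forall_2)

lemma linear_of_vec2: "linear of_vec2"
  by (rule linearI) (simp_all add: of_vec2_def complex_eq_iff)

lemma measurable_of_vec2 [measurable]: "of_vec2 \<in> borel_measurable borel"
  by (intro borel_measurable_continuous_onI linear_continuous_on linear_linear[THEN iffD2] linear_of_vec2)

lemma lborel_complex: "(lborel :: complex measure) = distr lborel borel of_vec2"
proof (rule lborel_eqI)
  fix l u :: complex
  assume le: "\<And>b. b \<in> Basis \<Longrightarrow> l \<bullet> b \<le> u \<bullet> b"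
  have B: "(Basis :: (real^2) set) = {axis 1 1, axis 2 1}"
    by (auto simp: Basis_vec_def UNIV_2)
  have "of_vec2 -` box l u = box (to_vec2 l) (to_vec2 u)"
    by (auto simp: of_vec2_def to_vec2_def box_def B inner_axis Basis_complex_def)
  then have "emeasure (distr lborel borel of_vec2) (box l u) = emeasure lborel (box (to_vec2 l) (to_vec2 u))"
    by (subst emeasure_distr) auto
  also have "\<dots> = (\<Prod>b\<in>Basis. (to_vec2 u - to_vec2 l) \<bullet> b)"
    by (rule emeasure_lborel_box) (use le[of 1] le[of \<i>] in \<open>auto simp: B to_vec2_def inner_axis Basis_complex_def\<close>)
  also have "(\<Prod>b\<in>Basis. (to_vec2 u - to_vec2 l) \<bullet> b) = (\<Prod>b\<in>Basis. (u - l) \<bullet> b)"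
    by (simp add: B Basis_complex_def to_vec2_def inner_axis axis_eq_axis)
  finally show "emeasure (distr lborel borel of_vec2) (box l u) = (\<Prod>b\<in>Basis. (u - l) \<bullet> b)" .
qed simp

lemma det_mult_complex: "det (matrix (\<lambda>h. to_vec2 (w * of_vec2 h))) = (cmod w)\<^sup>2"
  by (simp add: det_2 matrix_def to_vec2_def of_vec2_def axis_def cmod_def power2_eq_square)

lemma emeasure_lborel_of_vec2:
  "A \<in> sets borel \<Longrightarrow> emeasure lborel A = emeasure lborel (to_vec2 ` A)"
proof -
  assume "A \<in> sets borel"
  moreover have "to_vec2 ` A = of_vec2 -` A"
    by (auto simp: image_iff) (metis to_of_vec2)
  ultimately show ?thesis
    by (subst (1) lborel_complex) (simp add: emeasure_distr)
qed

text \<open>Multiplication by f' has the real determinant |f'|^2, so this is the real change of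
  variables in the coordinates \<open>to_vec2\<close>.\<close>

lemma emeasure_lborel_holomorphic_image:
  assumes S: "S \<in> sets borel" and fS: "f ` S \<in> sets borel"
    and deriv: "\<And>z. z \<in> S \<Longrightarrow> (f has_field_derivative f' z) (at z)"
    and inj: "inj_on f S" and [measurable]: "f' \<in> borel_measurable borel"
  shows "emeasure lborel (f ` S) = (\<integral>\<^sup>+z\<in>S. ennreal ((cmod (f' z))\<^sup>2) \<partial>lborel)"
proof -
  define T where "T = to_vec2 ` S"
  have T_eq: "T = of_vec2 -` S" unfolding T_def by (auto simp: image_iff) (metis to_of_vec2)
  define g where "g = (\<lambda>v. to_vec2 (f (of_vec2 v)))"
  define g' where "g' = (\<lambda>v h. to_vec2 (f' (of_vec2 v) * of_vec2 h))"
  have T: "T \<in> sets borel" unfolding T_eq using S measurable_sets_borel[OF measurable_of_vec2] by simp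
  have gT: "g ` T = to_vec2 ` (f ` S)"
    unfolding T_def g_def by (simp add: image_image)
  have gTb: "g ` T \<in> sets borel"
  proof -
    have "g ` T = of_vec2 -` (f ` S)" unfolding gT by (auto simp: image_iff) (metis to_of_vec2)
    then show ?thesis using fS measurable_sets_borel[OF measurable_of_vec2] by simp
  qed
  have bl: "bounded_linear to_vec2" "bounded_linear of_vec2"
    using linear_to_vec2 linear_of_vec2 by (simp_all add: linear_conv_bounded_linear)
  have der: "(g has_derivative g' v) (at v within T)" if "v \<in> T" for v
  proof -
    have "(f has_derivative (*) (f' (of_vec2 v))) (at (of_vec2 v))"
      using deriv[of "of_vec2 v"] that by (simp add: T_eq has_field_derivative_def)
    then have "(f \<circ> of_vec2 has_derivative (*) (f' (of_vec2 v)) \<circ> of_vec2) (at v)"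
      by (rule diff_chain_at[OF bounded_linear_imp_has_derivative[OF bl(2)]])
    then have "(to_vec2 \<circ> (f \<circ> of_vec2) has_derivative to_vec2 \<circ> ((*) (f' (of_vec2 v)) \<circ> of_vec2)) (at v)"
      by (rule diff_chain_at[OF _ bounded_linear_imp_has_derivative[OF bl(1)]])
    then show ?thesis
      by (simp add: g_def g'_def o_def has_derivative_at_withinI)
  qed
  have injg: "inj_on g T"
    using inj by (auto simp: inj_on_def g_def T_def) (metis of_to_vec2)
  define D where "D = (\<lambda>v. (cmod (f' (of_vec2 v)))\<^sup>2)"
  have Dm [measurable]: "D \<in> borel_measurable borel" unfolding D_def by measurable
  have D: "\<bar>det (matrix (g' v))\<bar> = D v" for v
    by (simp add: g'_def det_mult_complex D_def)
  have Tl: "T \<in> sets lebesgue" using T by auto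
  have key: "g ` T \<in> lmeasurable \<and> measure lebesgue (g ` T) = m \<longleftrightarrow> (D has_integral m) T" for m
    using has_measure_differentiable_image[OF Tl der injg] by (simp add: D)
  have "emeasure lborel (f ` S) = emeasure lborel (g ` T)"
    using emeasure_lborel_of_vec2[OF fS] gT by simp
  also have "\<dots> = (\<integral>\<^sup>+v. ennreal (indicator T v * D v) \<partial>lborel)"
  proof (cases "emeasure lborel (g ` T) = \<infinity>")
    case False
    then have "g ` T \<in> lmeasurable"
      using gTb by (auto simp: fmeasurable_def less_top)
    then have "(D has_integral measure lebesgue (g ` T)) T" using key by blast
    from nn_integral_has_integral_lebesgue[OF _ this]
    have "(\<integral>\<^sup>+v. ennreal (indicator T v * D v) \<partial>lborel) = measure lebesgue (g ` T)"
      by (simp add: D_def)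
    also have "\<dots> = emeasure lebesgue (g ` T)"
      using \<open>g ` T \<in> lmeasurable\<close> by (simp add: emeasure_eq_measure2)
    finally show ?thesis using gTb by simp
  next
    case True
    \<comment> \<open>\<open>key\<close> speaks of finite measures only. A finite integral would
      force the image to have finite measure, so both sides are infinite together.\<close>
    show ?thesis
    proof (rule ccontr)
      assume "\<not> ?thesis"
      then have "(\<integral>\<^sup>+v. ennreal (indicator T v * D v) \<partial>lborel) \<noteq> \<infinity>" using True by simp
      then obtain r where r: "r \<ge> 0" "(\<integral>\<^sup>+v. ennreal (indicator T v * D v) \<partial>lborel) = ennreal r"
        by (metis ennreal_cases infinity_ennreal_def)
      have "((\<lambda>v. indicator T v * D v) has_integral r) UNIV"
        by (rule nn_integral_has_integral) (use r T in \<open>auto simp: D_def indicator_def\<close>)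
      then have "(D has_integral r) T"
        using has_integral_restrict_UNIV[of T D r] by (simp add: indicator_times_eq_if)
      then have "g ` T \<in> lmeasurable" using key by blast
      then have "emeasure lebesgue (g ` T) \<noteq> \<infinity>" unfolding infinity_ennreal_def by (rule fmeasurableD2)
      then show False using True gTb by simp
    qed
  qed
  also have "\<dots> = (\<integral>\<^sup>+v. ennreal ((cmod (f' (of_vec2 v)))\<^sup>2) * indicator S (of_vec2 v) \<partial>lborel)"
    by (intro nn_integral_cong) (auto simp: T_eq D_def indicator_def)
  also have "\<dots> = (\<integral>\<^sup>+z\<in>S. ennreal ((cmod (f' z))\<^sup>2) \<partial>distr lborel borel of_vec2)"
    by (subst nn_integral_distr) (use S in auto)
  also have "\<dots> = (\<integral>\<^sup>+z\<in>S. ennreal ((cmod (f' z))\<^sup>2) \<partial>lborel)"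
    by (simp only: lborel_complex)
  finally show ?thesis .
qed

section \<open>The invariant measure on the upper half-plane\<close>

definition hyperbolic_measure :: "complex measure" where
  "hyperbolic_measure = density lborel (\<lambda>z. indicator uhp z * ennreal (1 / (Im z)\<^sup>2))"

lemma uhp_iff [simp]: "z \<in> uhp \<longleftrightarrow> Im z > 0"
  by (simp add: uhp_def)

lemma open_uhp: "open uhp"
  by (simp add: uhp_def open_halfspace_Im_gt)

lemma sets_uhp [measurable]: "uhp \<in> sets borel"
  using open_uhp by simp

lemma sets_hyperbolic [measurable_cong, simp]: "sets hyperbolic_measure = sets borel"
  by (simp add: hyperbolic_measure_def)

lemma space_hyperbolic [simp]: "space hyperbolic_measure = UNIV"
  by (simp add: hyperbolic_measure_def)

definition rmob :: "real \<Rightarrow> real \<Rightarrow> real \<Rightarrow> real \<Rightarrow> complex \<Rightarrow> complex" where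
  "rmob a b c d z = (of_real a * z + of_real b) / (of_real c * z + of_real d)"

lemma measurable_rmob [measurable]: "rmob a b c d \<in> borel_measurable borel"
  unfolding rmob_def by measurable

lemma rmob_denom:
  assumes "a * d - b * c > 0" "Im z > 0"
  shows "of_real c * z + of_real d \<noteq> 0"
  using assms by (intro uhp_denom_nonzero) auto

lemma Im_rmob: "Im (rmob a b c d z) = (a * d - b * c) * Im z / (cmod (of_real c * z + of_real d))\<^sup>2"
proof -
  have "Im ((of_real a * z + of_real b) * cnj (of_real c * z + of_real d)) = (a * d - b * c) * Im z"
    by (simp add: algebra_simps)
  then show ?thesis
    unfolding rmob_def complex_div_cnj[of "of_real a * z + of_real b"] by (simp flip: of_real_power)
qed

lemma rmob_uhp:
  assumes "a * d - b * c > 0" "Im z > 0"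
  shows "Im (rmob a b c d z) > 0"
  using rmob_denom[OF assms] assms by (simp add: Im_rmob)

lemma rmob_inverse:
  assumes "a * d - b * c > 0" "Im z > 0"
  shows "rmob d (-b) (-c) a (rmob a b c d z) = z"
proof -
  define D where "D = complex_of_real c * z + of_real d"
  have D: "D \<noteq> 0" using rmob_denom[OF assms] by (simp add: D_def)
  define w where "w = rmob a b c d z"
  have w: "w * D = of_real a * z + of_real b" using D by (simp add: w_def rmob_def D_def)
  have "(of_real d * w - of_real b) * D = of_real d * (w * D) - of_real b * D" by (simp add: algebra_simps)
  also have "\<dots> = of_real (a * d - b * c) * z" unfolding w by (simp add: D_def algebra_simps)
  finally have 1: "(of_real d * w - of_real b) * D = of_real (a * d - b * c) * z" .
  have "(- of_real c * w + of_real a) * D = - of_real c * (w * D) + of_real a * D" by (simp add: algebra_simps)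
  also have "\<dots> = of_real (a * d - b * c)" unfolding w by (simp add: D_def algebra_simps)
  finally have 2: "(- of_real c * w + of_real a) * D = of_real (a * d - b * c)" .
  have "rmob d (-b) (-c) a w = ((of_real d * w - of_real b) * D) / ((- of_real c * w + of_real a) * D)"
    using D by (simp add: rmob_def)
  also have "\<dots> = z"
    unfolding 1 2 using assms by (subst nonzero_mult_div_cancel_left) (auto simp flip: of_real_mult)
  finally show ?thesis by (simp add: w_def)
qed

lemma rmob_deriv:
  assumes "a * d - b * c > 0" "Im z > 0"
  shows "(rmob a b c d has_field_derivative of_real (a * d - b * c) / (of_real c * z + of_real d)\<^sup>2) (at z)"
proof -
  define D where "D = complex_of_real c * z + of_real d"
  have D: "D \<noteq> 0" using rmob_denom[OF assms] by (simp add: D_def)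
  have "((\<lambda>w. (of_real a * w + of_real b) / (of_real c * w + of_real d)) has_field_derivative
      (of_real a * D - (of_real a * z + of_real b) * of_real c) / (D * D)) (at z)"
    unfolding D_def by (rule DERIV_divide) (use D in \<open>auto intro!: derivative_eq_intros simp: D_def\<close>)
  moreover have "of_real a * D - (of_real a * z + of_real b) * of_real c = of_real (a * d - b * c)"
    by (simp add: D_def algebra_simps)
  ultimately show ?thesis by (simp add: rmob_def[abs_def] D_def power2_eq_square)
qed

text \<open>The map multiplies the imaginary part by det/|cz + d|^2 and area by the square of the
  same number, so the density 1/y^2 is preserved.\<close>

theorem nn_integral_hyperbolic_rmob:
  assumes det: "a * d - b * c > 0" and [measurable]: "g \<in> borel_measurable borel"
  shows "(\<integral>\<^sup>+z. g (rmob a b c d z) \<partial>hyperbolic_measure) = (\<integral>\<^sup>+z. g z \<partial>hyperbolic_measure)"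
proof -
  define \<alpha> where "\<alpha> = rmob a b c d"
  have [measurable]: "\<alpha> \<in> borel_measurable borel" by (simp add: \<alpha>_def)
  define D where "D z = ennreal ((cmod (of_real (a * d - b * c) / (of_real c * z + of_real d)\<^sup>2))\<^sup>2)" for z
  have [measurable]: "D \<in> borel_measurable borel" unfolding D_def by measurable
  \<comment> \<open>The measure with density |alpha'|^2 on the half-plane is pushed forward by alpha
    to Lebesgue measure; the claim then becomes an integral against an image measure.\<close>
  have push: "distr (density lborel (\<lambda>z. indicator uhp z * D z)) borel \<alpha> = density lborel (indicator uhp)"
  proof (rule measure_eqI)
    fix B assume "B \<in> sets (distr (density lborel (\<lambda>z. indicator uhp z * D z)) borel \<alpha>)"
    then have [measurable]: "B \<in> sets borel" by simp
    define S where "S = \<alpha> -` B \<inter> uhp"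
    have [measurable]: "S \<in> sets borel" unfolding S_def
      using measurable_sets_borel[of \<alpha> borel B] by auto
    have img: "\<alpha> ` S = B \<inter> uhp"
    proof -
      have inv: "Im z > 0 \<Longrightarrow> rmob a b c d (rmob d (-b) (-c) a z) = z" for z
        using rmob_inverse[of d a "-b" "-c" z] det by (simp add: mult.commute)
      have "Im z > 0 \<Longrightarrow> Im (rmob d (-b) (-c) a z) > 0" for z
        using rmob_uhp[of d a "-b" "-c" z] det by (simp add: mult.commute)
      then have "w \<in> \<alpha> ` S" if "w \<in> B \<inter> uhp" for w
        using that inv[of w] by (intro image_eqI[of _ _ "rmob d (-b) (-c) a w"]) (auto simp: S_def \<alpha>_def)
      then show ?thesis using rmob_uhp[OF det] by (auto simp: S_def \<alpha>_def)
    qed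
    have "emeasure (distr (density lborel (\<lambda>z. indicator uhp z * D z)) borel \<alpha>) B
        = (\<integral>\<^sup>+z\<in>\<alpha> -` B. indicator uhp z * D z \<partial>lborel)"
      using measurable_sets_borel[of \<alpha> borel B] by (subst emeasure_distr) (auto simp: emeasure_density)
    also have "\<dots> = (\<integral>\<^sup>+z\<in>S. D z \<partial>lborel)"
      by (intro nn_integral_cong) (auto simp: S_def indicator_def)
    also have "\<dots> = emeasure lborel (\<alpha> ` S)"
      unfolding D_def
    proof (rule emeasure_lborel_holomorphic_image[symmetric])
      show "inj_on \<alpha> S"
        by (rule inj_on_inverseI[of _ "rmob d (-b) (-c) a"])
           (auto simp: S_def \<alpha>_def intro: rmob_inverse[OF det])
      show "(\<alpha> has_field_derivative of_real (a * d - b * c) / (of_real c * z + of_real d)\<^sup>2) (at z)"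
        if "z \<in> S" for z
        using that rmob_deriv[OF det] by (auto simp: S_def \<alpha>_def)
    qed (auto simp: img)
    also have "\<dots> = (\<integral>\<^sup>+z. indicator (B \<inter> uhp) z \<partial>lborel)"
      unfolding img by simp
    also have "\<dots> = (\<integral>\<^sup>+z. indicator uhp z * indicator B z \<partial>lborel)"
      by (intro nn_integral_cong) (auto simp: indicator_def)
    also have "\<dots> = emeasure (density lborel (indicator uhp)) B"
      by (rule emeasure_density[symmetric]) auto
    finally show "emeasure (distr (density lborel (\<lambda>z. indicator uhp z * D z)) borel \<alpha>) B
        = emeasure (density lborel (indicator uhp)) B" .
  qed simp
  have "(\<integral>\<^sup>+z. g z \<partial>hyperbolic_measure) = (\<integral>\<^sup>+z. ennreal (1 / (Im z)\<^sup>2) * g z \<partial>density lborel (indicator uhp))"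
    by (simp add: hyperbolic_measure_def nn_integral_density mult.assoc)
  also have "\<dots> = (\<integral>\<^sup>+z. ennreal (1 / (Im (\<alpha> z))\<^sup>2) * g (\<alpha> z) \<partial>density lborel (\<lambda>z. indicator uhp z * D z))"
    unfolding push[symmetric] by (subst nn_integral_distr) auto
  also have "\<dots> = (\<integral>\<^sup>+z. indicator uhp z * D z * (ennreal (1 / (Im (\<alpha> z))\<^sup>2) * g (\<alpha> z)) \<partial>lborel)"
    by (subst nn_integral_density) auto
  also have "\<dots> = (\<integral>\<^sup>+z. indicator uhp z * ennreal (1 / (Im z)\<^sup>2) * g (\<alpha> z) \<partial>lborel)"
  proof (intro nn_integral_cong)
    fix z
    have "D z * ennreal (1 / (Im (\<alpha> z))\<^sup>2) = ennreal (1 / (Im z)\<^sup>2)" if "Im z > 0"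
    proof -
      define N where "N = cmod (of_real c * z + of_real d)"
      have "N > 0" using rmob_denom[OF det that] by (simp add: N_def)
      have "D z = ennreal (((a * d - b * c) / N\<^sup>2)\<^sup>2)"
        unfolding D_def norm_divide norm_power N_def norm_of_real using det by simp
      then show ?thesis
        using \<open>N > 0\<close> det that unfolding \<alpha>_def Im_rmob N_def[symmetric]
        by (simp add: ennreal_mult'[symmetric] power_divide power_mult_distrib field_simps)
             (simp add: power2_eq_square algebra_simps)
    qed
    then show "indicator uhp z * D z * (ennreal (1 / (Im (\<alpha> z))\<^sup>2) * g (\<alpha> z)) = indicator uhp z * ennreal (1 / (Im z)\<^sup>2) * g (\<alpha> z)"
      by (cases "z \<in> uhp") (simp_all add: mult.assoc[symmetric])
  qed
  also have "\<dots> = (\<integral>\<^sup>+z. g (\<alpha> z) \<partial>hyperbolic_measure)"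
    by (simp add: hyperbolic_measure_def nn_integral_density)
  finally show ?thesis by (simp add: \<alpha>_def)
qed

section \<open>Matrices acting on the half-plane and the groups Gamma0(N)\<close>

lemma mat2_nth [simp]:
  "mat2 a b c d $ 1 $ 1 = a" "mat2 a b c d $ 1 $ 2 = b"
  "mat2 a b c d $ 2 $ 1 = c" "mat2 a b c d $ 2 $ 2 = d"
  by (simp_all add: mat2_def)

lemma mat2_eq_iff: "mat2 a b c d = mat2 a' b' c' d' \<longleftrightarrow> a = a' \<and> b = b' \<and> c = c' \<and> d = d'"
  by (auto simp: vec_eq_iff forall_2)

lemma mat2_mult: "mat2 a b c d ** mat2 a' b' c' d' =
    mat2 (a*a' + b*c') (a*b' + b*d') (c*a' + d*c') (c*b' + d*(d' :: 'a :: semiring_1))"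
  by (simp add: vec_eq_iff forall_2 matrix_matrix_mult_def sum_2)

lemma mat2_cases: obtains a b c d where "(A :: 'a::zero^2^2) = mat2 a b c d"
  by (rule that[of "A$1$1" "A$1$2" "A$2$1" "A$2$2"]) (simp add: vec_eq_iff forall_2)

lemma mat2_one: "mat2 1 0 0 1 = (mat 1 :: 'a :: semiring_1^2^2)"
  by (simp add: vec_eq_iff forall_2 mat_def)

lemma det_mat2 [simp]: "det (mat2 a b c d) = a * d - b * c"
  by (simp add: det_2)

lemma moebius_mat2: "moebius (mat2 a b c d) = rmob a b c d"
  by (simp add: moebius_def rmob_def fun_eq_iff)

lemma moebius_int: "moebius (mat2 (of_int a) (of_int b) (of_int c) (of_int d)) = mob a b c d"
  by (simp add: moebius_def mob_def fun_eq_iff)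

lemma measurable_moebius [measurable]: "moebius A \<in> borel_measurable borel"
  by (rule mat2_cases[of A]) (simp add: moebius_mat2)

lemma moebius_uhp: "det A > 0 \<Longrightarrow> Im z > 0 \<Longrightarrow> Im (moebius A z) > 0"
  by (rule mat2_cases[of A]) (simp add: moebius_mat2 rmob_uhp)

lemma moebius_mult:
  assumes "det B > 0" "Im z > 0"
  shows "moebius (A ** B) z = moebius A (moebius B z)"
proof (rule mat2_cases[of A], rule mat2_cases[of B])
  fix a b c d a' b' c' d' assume AB: "A = mat2 a b c d" "B = mat2 a' b' c' d'"
  define D where "D = complex_of_real c' * z + of_real d'"
  have D: "D \<noteq> 0" using rmob_denom[of a' d' b' c' z] assms AB by (simp add: D_def)
  define w where "w = rmob a' b' c' d' z"
  have w: "w * D = of_real a' * z + of_real b'" using D by (simp add: w_def rmob_def D_def)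
  have "rmob a b c d w = ((of_real a * w + of_real b) * D) / ((of_real c * w + of_real d) * D)"
    using D by (simp add: rmob_def)
  also have "(of_real a * w + of_real b) * D = of_real a * (w * D) + of_real b * D" by (simp add: algebra_simps)
  also have "\<dots> = of_real (a*a' + b*c') * z + of_real (a*b' + b*d')"
    unfolding w by (simp add: D_def algebra_simps)
  also have "(of_real c * w + of_real d) * D = of_real c * (w * D) + of_real d * D" by (simp add: algebra_simps)
  also have "\<dots> = of_real (c*a' + d*c') * z + of_real (c*b' + d*d')"
    unfolding w by (simp add: D_def algebra_simps)
  finally show ?thesis by (simp add: AB mat2_mult moebius_mat2 rmob_def w_def)
qed

text \<open>The adjugate: the inverse up to a scalar that \<open>moebius\<close> does not see.
  Integral matrices keep integral entries for every determinant.\<close>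

definition inv2 :: "real^2^2 \<Rightarrow> real^2^2" where
  "inv2 A = mat2 (A$2$2) (- A$1$2) (- A$2$1) (A$1$1)"

lemma inv2_mat2 [simp]: "inv2 (mat2 a b c d) = mat2 d (-b) (-c) a"
  by (simp add: inv2_def)

lemma inv2_inv2 [simp]: "inv2 (inv2 A) = A"
  by (rule mat2_cases[of A]) simp

lemma det_inv2 [simp]: "det (inv2 A) = det A"
  by (rule mat2_cases[of A]) simp

lemma inv2_mult: "det A = 1 \<Longrightarrow> inv2 A ** A = mat 1" "det A = 1 \<Longrightarrow> A ** inv2 A = mat 1"
  by (rule mat2_cases[of A], simp add: mat2_mult mult.commute flip: mat2_one)+

lemma moebius_inv2: "det A > 0 \<Longrightarrow> Im z > 0 \<Longrightarrow> moebius (inv2 A) (moebius A z) = z"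
  by (rule mat2_cases[of A]) (simp add: moebius_mat2 rmob_inverse)

lemma moebius_inv2': "det A > 0 \<Longrightarrow> Im z > 0 \<Longrightarrow> moebius A (moebius (inv2 A) z) = z"
  using moebius_inv2[of "inv2 A"] by simp

lemma nn_integral_moebius:
  "det A > 0 \<Longrightarrow> g \<in> borel_measurable borel \<Longrightarrow>
    (\<integral>\<^sup>+z. g (moebius A z) \<partial>hyperbolic_measure) = (\<integral>\<^sup>+z. g z \<partial>hyperbolic_measure)"
  by (rule mat2_cases[of A]) (simp add: moebius_mat2 nn_integral_hyperbolic_rmob)

lemma AE_hyperbolic_uhp: "AE z in hyperbolic_measure. Im z > 0"
  unfolding hyperbolic_measure_def by (subst AE_density) (auto simp: indicator_def)

text \<open>Invariance of the measure, applied to the indicator of an exceptional set, says that its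
  preimage is null.\<close>

lemma AE_moebius:
  assumes "det A > 0" "AE z in hyperbolic_measure. P z"
  shows "AE z in hyperbolic_measure. P (moebius A z)"
proof -
  obtain N where N: "N \<in> sets borel" "emeasure hyperbolic_measure N = 0" "{z. \<not> P z} \<subseteq> N"
    using assms(2) by (rule AE_E) auto
  have "(\<integral>\<^sup>+z. indicator N (moebius A z) \<partial>hyperbolic_measure) = (\<integral>\<^sup>+z. indicator N z \<partial>hyperbolic_measure)"
    by (rule nn_integral_moebius) (use assms N in auto)
  also have "\<dots> = 0" using N by simp
  finally have "AE z in hyperbolic_measure. indicator N (moebius A z) = (0 :: ennreal)"
    by (subst (asm) nn_integral_0_iff_AE) (use N in auto)
  then show ?thesis
    by eventually_elim (use N in \<open>auto simp: indicator_def split: if_splits\<close>)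
qed

lemma Gamma0_mat2: "mat2 (of_int a) (of_int b) (of_int c) (of_int d) \<in> Gamma0 N \<longleftrightarrow> a * d - b * c = 1 \<and> int N dvd c"
  unfolding Gamma0_def by (auto simp: mat2_eq_iff)

lemma Gamma0_E:
  assumes "A \<in> Gamma0 N"
  obtains a b c d where "A = mat2 (of_int a) (of_int b) (of_int c) (of_int d)" "a * d - b * c = 1" "int N dvd c"
  using assms unfolding Gamma0_def by auto

lemma Gamma0_mono: "M dvd N \<Longrightarrow> Gamma0 N \<subseteq> Gamma0 M"
  by (rule subsetI, erule Gamma0_E) (auto simp: Gamma0_mat2 intro: dvd_trans[of "int M" "int N"])

lemma Gamma0_sub1: "A \<in> Gamma0 N \<Longrightarrow> A \<in> Gamma0 1"
  using Gamma0_mono[of 1 N] by auto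

lemma det_Gamma0 [simp]: "A \<in> Gamma0 N \<Longrightarrow> det A = 1"
  by (erule Gamma0_E) (simp, metis of_int_1 of_int_diff of_int_mult)

lemma Gamma0_one [simp]: "mat 1 \<in> Gamma0 N"
  using Gamma0_mat2[of 1 0 0 1 N] by (simp add: mat2_one)

lemma Gamma0_mult: "A \<in> Gamma0 N \<Longrightarrow> B \<in> Gamma0 N \<Longrightarrow> A ** B \<in> Gamma0 N"
proof (elim Gamma0_E)
  fix a b c d a' b' c' d' :: int
  assume *: "a * d - b * c = 1" "int N dvd c" "a' * d' - b' * c' = 1" "int N dvd c'"
    "A = mat2 (of_int a) (of_int b) (of_int c) (of_int d)" "B = mat2 (of_int a') (of_int b') (of_int c') (of_int d')"
  have "(a*a' + b*c') * (c*b' + d*d') - (a*b' + b*d') * (c*a' + d*c') = (a*d - b*c) * (a'*d' - b'*c')"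
    by (simp add: algebra_simps)
  with * Gamma0_mat2[of "a*a' + b*c'" "a*b' + b*d'" "c*a' + d*c'" "c*b' + d*d'" N]
  show "A ** B \<in> Gamma0 N" by (simp add: mat2_mult)
qed

lemma Gamma0_inv: "A \<in> Gamma0 N \<Longrightarrow> inv2 A \<in> Gamma0 N"
proof (elim Gamma0_E)
  fix a b c d :: int
  assume *: "a * d - b * c = 1" "int N dvd c"
    "A = mat2 (of_int a) (of_int b) (of_int c) (of_int d)"
  with Gamma0_mat2[of d "-b" "-c" a N] show "inv2 A \<in> Gamma0 N" by (simp add: mult.commute)
qed

lemma countable_Gamma0: "countable (Gamma0 N)"
proof -
  have "Gamma0 N \<subseteq> (\<lambda>(a, b, c, d). mat2 (of_int a) (of_int b) (of_int c) (of_int d)) ` (UNIV :: (int \<times> int \<times> int \<times> int) set)"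
  proof
    fix A assume "A \<in> Gamma0 N"
    then obtain a b c d where "A = mat2 (of_int a) (of_int b) (of_int c) (of_int d)" by (elim Gamma0_E)
    then show "A \<in> range (\<lambda>(a, b, c, d). mat2 (real_of_int a) (of_int b) (of_int c) (of_int d))"
      by (intro image_eqI[of _ _ "(a, b, c, d)"]) auto
  qed
  then show ?thesis by (rule countable_subset) auto
qed

section \<open>The standard fundamental domain\<close>

lemma finite_bounded_pairs:
  assumes "Im z > 0"
  shows "finite {(c :: int, d :: int). cmod (of_int c * z + of_int d) \<le> r}"
proof -
  define B where "B = \<lceil>\<bar>r\<bar> / Im z\<rceil>"
  define B' where "B' = \<lceil>\<bar>r\<bar> + of_int B * cmod z\<rceil>"
  have "{(c :: int, d :: int). cmod (of_int c * z + of_int d) \<le> r} \<subseteq> {-B..B} \<times> {-B'..B'}"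
  proof safe
    fix c d :: int assume r: "cmod (of_int c * z + of_int d) \<le> r"
    have "\<bar>Im (of_int c * z + of_int d)\<bar> \<le> r" using abs_Im_le_cmod r order_trans by blast
    then have "\<bar>of_int c\<bar> * Im z \<le> \<bar>r\<bar>" using assms by (simp add: abs_mult)
    then have "\<bar>real_of_int c\<bar> \<le> \<bar>r\<bar> / Im z" using assms by (simp add: field_simps)
    then have c: "\<bar>c\<bar> \<le> B" unfolding B_def by linarith
    have "cmod (of_int d) \<le> cmod (of_int c * z + of_int d) + cmod (of_int c * z)"
      by (metis add_diff_cancel_left' norm_triangle_ineq4)
    also have "\<dots> \<le> \<bar>r\<bar> + of_int B * cmod z"
      using r c by (intro add_mono) (auto simp: norm_mult intro!: mult_right_mono)
    finally have "\<bar>real_of_int d\<bar> \<le> \<bar>r\<bar> + of_int B * cmod z" by simp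
    then have "\<bar>d\<bar> \<le> B'" unfolding B'_def by linarith
    then show "c \<in> {-B..B}" "d \<in> {-B'..B'}" using c by auto
  qed
  then show ?thesis by (rule finite_subset) auto
qed

text \<open>Minimising |cz + d| over coprime pairs maximises the imaginary part on the orbit; a
  translation then brings the real part into the strip.\<close>

lemma fund_domain_reachable:
  assumes z: "Im z > 0"
  shows "\<exists>A\<in>Gamma0 1. moebius A z \<in> std_fund_domain"
proof -
  define P where "P = {(c :: int, d :: int). coprime c d \<and> cmod (of_int c * z + of_int d) \<le> 1}"
  have "finite P" by (rule finite_subset[OF _ finite_bounded_pairs[OF z, of 1]]) (auto simp: P_def)
  moreover have "(0, 1) \<in> P" by (simp add: P_def)
  ultimately have P: "finite P" "P \<noteq> {}" by auto
  let ?f = "\<lambda>q. cmod (of_int (fst q) * z + of_int (snd q))"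
  obtain p where p: "p \<in> P" "\<And>q. q \<in> P \<Longrightarrow> ?f p \<le> ?f q"
    using arg_min_if_finite[OF P, of ?f] by (auto simp: not_less)
  obtain c d where pcd: "p = (c, d)" by (cases p)
  have cd: "coprime c d" "cmod (of_int c * z + of_int d) \<le> 1" using p(1) by (auto simp: P_def pcd)
  have min: "cmod (of_int c * z + of_int d) \<le> cmod (of_int c' * z + of_int d')" if "coprime c' d'" for c' d'
    using p(2)[of "(c', d')"] that cd by (cases "cmod (of_int c' * z + of_int d') \<le> 1") (auto simp: P_def pcd)
  obtain a b where ab: "a * d - b * c = 1"
  proof -
    obtain x y where "x * c + y * d = 1" using bezout_int[of c d] cd by auto
    then show ?thesis using that[of y "-x"] by (simp add: algebra_simps)
  qed
  define n where "n = round (Re (mob a b c d z))"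
  define a' b' where "a' = a - n * c" and "b' = b - n * d"
  have det: "a' * d - b' * c = 1" using ab by (simp add: a'_def b'_def algebra_simps)
  define w where "w = mob a' b' c d z"
  have nz: "of_int c * z + of_int d \<noteq> 0" using uhp_denom_nonzero_int z cd by blast
  have "w = mob a b c d z - of_int n"
    using nz by (simp add: w_def mob_def a'_def b'_def field_simps)
  then have "\<bar>Re w\<bar> \<le> 1 / 2"
    using of_int_round_abs_le[of "Re (mob a b c d z)"] by (simp add: n_def abs_minus_commute)
  moreover have imw: "Im w > 0" using mob_uhp[OF det z] by (simp add: w_def)
  moreover have "cmod w \<ge> 1"
  proof -
    \<comment> \<open>The top row (a', b') becomes the bottom row after a further inversion w ->
      -1/w. Minimality of |cz + d| against this pair is the inequality |w| \<ge> 1.\<close>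
    have "coprime a' b'" using coprime_det'[OF det] .
    from min[OF this] have "cmod (of_int c * z + of_int d) \<le> cmod (of_int a' * z + of_int b')" .
    then show ?thesis using nz by (simp add: w_def mob_def norm_divide)
  qed
  ultimately have "w \<in> std_fund_domain" by (simp add: std_fund_domain_def)
  moreover have "mat2 (of_int a') (of_int b') (of_int c) (of_int d) \<in> Gamma0 1"
    using det by (simp add: Gamma0_mat2)
  ultimately show ?thesis unfolding w_def moebius_int[symmetric] by blast
qed

text \<open>With |Re w| \<le> 1/2 and |w| \<ge> 1 the square of |cw + d| is at least c^2 - |cd| +
  d^2, a positive definite integral form and therefore at least 1.\<close>

lemma fund_domain_cmod_ge:
  assumes "w \<in> std_fund_domain" "c \<noteq> 0"
  shows "cmod (of_int c * w + of_int (d :: int)) \<ge> 1"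
    and "\<bar>Re w\<bar> < 1 / 2 \<Longrightarrow> cmod w > 1 \<Longrightarrow> cmod (of_int c * w + of_int d) > 1"
proof -
  have e: "(cmod (of_int c * w + of_int d))\<^sup>2 = of_int (c\<^sup>2) * (cmod w)\<^sup>2 + 2 * of_int (c * d) * Re w + of_int (d\<^sup>2)"
    by (simp only: cmod_power2) (simp add: power2_eq_square algebra_simps)
  have i: "c\<^sup>2 - \<bar>c * d\<bar> + d\<^sup>2 \<ge> 1"
  proof -
    have "c\<^sup>2 - \<bar>c * d\<bar> + d\<^sup>2 = (\<bar>c\<bar> - \<bar>d\<bar>)\<^sup>2 + \<bar>c\<bar> * \<bar>d\<bar>"
      by (simp add: power2_diff abs_mult)
    moreover have "\<bar>c\<bar> * \<bar>d\<bar> \<ge> 0" by simp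
    moreover have "(\<bar>c\<bar> - \<bar>d\<bar>)\<^sup>2 \<ge> 0" by simp
    moreover have "(\<bar>c\<bar> - \<bar>d\<bar>)\<^sup>2 \<noteq> 0 \<or> \<bar>c\<bar> * \<bar>d\<bar> \<noteq> 0" using assms(2) by auto
    ultimately show ?thesis by linarith
  qed
  then have i': "real_of_int (c\<^sup>2) - \<bar>of_int (c * d)\<bar> + of_int (d\<^sup>2) \<ge> 1"
    by (metis of_int_1 of_int_abs of_int_add of_int_diff of_int_le_iff)
  have re: "\<bar>2 * of_int (c * d) * Re w\<bar> \<le> \<bar>of_int (c * d)\<bar>"
  proof -
    have "\<bar>2 * of_int (c * d) * Re w\<bar> = \<bar>of_int (c * d)\<bar> * (2 * \<bar>Re w\<bar>)" by (simp add: abs_mult)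
    also have "\<dots> \<le> \<bar>of_int (c * d)\<bar> * 1"
      using assms by (intro mult_left_mono) (auto simp: std_fund_domain_def)
    finally show ?thesis by simp
  qed
  define X Y Z C D where "X = real_of_int (c\<^sup>2) * (cmod w)\<^sup>2" and "Y = 2 * real_of_int (c * d) * Re w"
    and "Z = \<bar>real_of_int (c * d)\<bar>" and "C = real_of_int (c\<^sup>2)" and "D = real_of_int (d\<^sup>2)"
  note defs = X_def[symmetric] Y_def[symmetric] Z_def[symmetric] C_def[symmetric] D_def[symmetric]
  note e = e[unfolded X_def[symmetric] Y_def[symmetric] D_def[symmetric]] and i' = i'[unfolded defs] and re = re[unfolded defs]
  have w1: "(cmod w)\<^sup>2 \<ge> 1" using assms by (simp add: std_fund_domain_def)
  have "of_int (c\<^sup>2) * (cmod w)\<^sup>2 \<ge> of_int (c\<^sup>2) * 1" by (intro mult_left_mono w1) simp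
  then have "X \<ge> C" by (simp add: X_def C_def)
  then have "(cmod (of_int c * w + of_int d))\<^sup>2 \<ge> 1\<^sup>2" using e i' re unfolding one_power2 by linarith
  then show "cmod (of_int c * w + of_int d) \<ge> 1" by (rule power2_le_imp_le) simp
  show "cmod (of_int c * w + of_int d) > 1" if "\<bar>Re w\<bar> < 1 / 2" "cmod w > 1"
  proof -
    have "(cmod w)\<^sup>2 > 1" using that by simp
    then have "of_int (c\<^sup>2) * (cmod w)\<^sup>2 > of_int (c\<^sup>2) * 1" using assms by (intro mult_strict_left_mono) auto
    then have "X > C" by (simp add: X_def C_def)
    then have "(cmod (of_int c * w + of_int d))\<^sup>2 > 1\<^sup>2" using e i' re unfolding one_power2 by linarith
    then show ?thesis by (rule power2_less_imp_less) simp
  qed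
qed

text \<open>If c were nonzero, the interior point w would strictly lose height under A, while the
  way back from the closed domain cannot gain height. So c = 0, and a translation that keeps an
  interior point in the strip is trivial.\<close>

lemma fund_domain_unique:
  assumes w: "\<bar>Re w\<bar> < 1 / 2" "cmod w > 1" "Im w > 0"
    and A: "A \<in> Gamma0 1" "moebius A w \<in> std_fund_domain"
  shows "A = mat 1 \<or> A = - mat 1"
proof -
  obtain a b c d where A_eq: "A = mat2 (of_int a) (of_int b) (of_int c) (of_int d)" and det: "a * d - b * c = 1"
    using A(1) by (elim Gamma0_E)
  have wF: "w \<in> std_fund_domain" using w by (simp add: std_fund_domain_def)
  define v where "v = mob a b c d w"
  have v: "v \<in> std_fund_domain" using A(2) by (simp add: A_eq moebius_int v_def)
  have nz: "of_int c * w + of_int d \<noteq> 0" using uhp_denom_nonzero_int w coprime_det[OF det] by blast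
  have c0: "c = 0"
  proof (rule ccontr)
    assume c: "c \<noteq> 0"
    have "cmod (of_int c * w + of_int d) > 1" by (rule fund_domain_cmod_ge(2)[OF wF c w(1,2)])
    then have "Im v < Im w"
      using w(3) unfolding v_def Im_mob[OF det] by (simp add: divide_less_eq one_less_power)
    moreover have "Im w \<le> Im v"
    proof -
      have det': "d * a - (-b) * (-c) = 1" using det by (simp add: mult.commute)
      have "cmod (of_int (-c) * v + of_int a) \<ge> 1" by (rule fund_domain_cmod_ge(1)[OF v]) (use c in simp)
      moreover have "moebius (inv2 A) (moebius A w) = w" by (rule moebius_inv2) (use A w in simp_all)
      then have "mob d (-b) (-c) a v = w"
        by (simp add: A_eq moebius_int v_def flip: of_int_minus)
      ultimately show ?thesis using v Im_mob[OF det', of v] one_le_power[of "cmod (of_int (-c) * v + of_int a)" 2]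
        by (simp add: divide_le_eq std_fund_domain_def mult_left_le)
    qed
    ultimately show False by simp
  qed
  then have ad: "a = 1 \<and> d = 1 \<or> a = -1 \<and> d = -1" using det by (simp add: zmult_eq_1_iff)
  then have "v = w + of_int (a * b)" by (auto simp: v_def mob_def c0)
  then have "\<bar>Re w + of_int (a * b)\<bar> \<le> 1 / 2" using v by (simp add: std_fund_domain_def)
  then have "\<bar>real_of_int (a * b)\<bar> < 1" using w(1) by linarith
  then have "b = 0" using ad by auto
  then show ?thesis using ad c0 by (auto simp: A_eq mat2_one vec_eq_iff forall_2 mat_def)
qed

lemma sets_fund_domain [measurable]: "std_fund_domain \<in> sets borel"
  unfolding std_fund_domain_def by measurable

lemma null_circle_lines:
  "AE z in hyperbolic_measure. z \<in> std_fund_domain \<longrightarrow> \<bar>Re z\<bar> < 1 / 2 \<and> cmod z > 1"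
proof -
  have n1: "negligible {z :: complex. 1 \<bullet> z = r}" for r
    by (rule negligible_hyperplane) simp
  have n2: "negligible (sphere (0 :: complex) 1)"
    by (rule negligible_sphere)
  have "AE z in lebesgue. z \<notin> {z :: complex. 1 \<bullet> z = 1/2} \<union> {z. 1 \<bullet> z = -1/2} \<union> sphere 0 1"
    using n1[of "1/2"] n1[of "-1/2"] n2
    by (intro AE_not_in) (auto simp: negligible_iff_null_sets)
  then have "AE z in lborel. z \<notin> {z :: complex. 1 \<bullet> z = 1/2} \<union> {z. 1 \<bullet> z = -1/2} \<union> sphere 0 1"
    by (simp add: AE_completion_iff)
  then have "AE z in lborel. z \<in> std_fund_domain \<longrightarrow> \<bar>Re z\<bar> < 1 / 2 \<and> cmod z > 1"
    by eventually_elim (auto simp: std_fund_domain_def inner_complex_def)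
  then show ?thesis
    unfolding hyperbolic_measure_def by (subst AE_density) auto
qed

text \<open>Almost every orbit of \<open>SL\<^sub>2(\<int>)\<close> meets the standard fundamental domain in one point, which is
  reached by two matrices $\pm A$.\<close>

lemma AE_orbit_count:
  "AE z in hyperbolic_measure. (\<integral>\<^sup>+A. indicator std_fund_domain (moebius A z) \<partial>count_space (Gamma0 1)) = 2"
proof -
  let ?P = "\<lambda>z. z \<in> std_fund_domain \<longrightarrow> \<bar>Re z\<bar> < 1 / 2 \<and> cmod z > 1"
  have "AE z in hyperbolic_measure. \<forall>A\<in>Gamma0 1. ?P (moebius A z)"
    by (subst AE_ball_countable[OF countable_Gamma0]) (intro ballI AE_moebius null_circle_lines, simp)
  with AE_hyperbolic_uhp show ?thesis
  proof eventually_elim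
    case (elim z)
    obtain A where A: "A \<in> Gamma0 1" "moebius A z \<in> std_fund_domain"
      using fund_domain_reachable elim by blast
    have Aw: "\<bar>Re (moebius A z)\<bar> < 1 / 2" "cmod (moebius A z) > 1" "Im (moebius A z) > 0"
      using elim A moebius_uhp[of A z] by auto
    have S: "{B \<in> Gamma0 1. moebius B z \<in> std_fund_domain} = {A, - A}"
    proof (intro equalityI subsetI)
      fix B assume B: "B \<in> {B \<in> Gamma0 1. moebius B z \<in> std_fund_domain}"
      have "B ** inv2 A \<in> Gamma0 1" using A B by (intro Gamma0_mult Gamma0_inv) auto
      moreover have "moebius (B ** inv2 A) (moebius A z) = moebius B z"
        using A elim Aw by (subst moebius_mult) (auto simp: moebius_inv2)
      ultimately have "B ** inv2 A = mat 1 \<or> B ** inv2 A = - mat 1"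
        using fund_domain_unique[OF Aw] B by auto
      moreover have "B = (B ** inv2 A) ** A"
        using A by (simp add: matrix_mul_assoc[symmetric] inv2_mult)
      ultimately show "B \<in> {A, - A}" 
        by (auto simp: vec_eq_iff forall_2 matrix_matrix_mult_def mat_def sum_2)
    next
      fix B assume B: "B \<in> {A, - A}"
      obtain a b c d where A_eq: "A = mat2 (of_int a) (of_int b) (of_int c) (of_int d)" and det: "a * d - b * c = 1"
        using A(1) by (elim Gamma0_E)
      have "- A = mat2 (of_int (-a)) (of_int (-b)) (of_int (-c)) (of_int (-d))"
        by (simp add: A_eq vec_eq_iff forall_2)
      then have "- A \<in> Gamma0 1" "moebius (- A) z = moebius A z"
        using det by (simp_all only: Gamma0_mat2 moebius_int mob_uminus A_eq) simp_all
      then show "B \<in> {B \<in> Gamma0 1. moebius B z \<in> std_fund_domain}" using A B by auto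
    qed
    have "A \<noteq> - A"
    proof
      assume "A = - A"
      then have "A = 0" by (simp add: vec_eq_iff)
      then have "det A = 0" by (simp add: det_2)
      then show False using A by simp
    qed
    have "(\<integral>\<^sup>+B. indicator std_fund_domain (moebius B z) \<partial>count_space (Gamma0 1))
      = (\<integral>\<^sup>+B. indicator {B \<in> Gamma0 1. moebius B z \<in> std_fund_domain} B \<partial>count_space (Gamma0 1))"
      by (intro nn_integral_cong) (auto simp: indicator_def)
    also have "\<dots> = emeasure (count_space (Gamma0 1)) {A, - A}"
      unfolding S by (rule nn_integral_indicator) (use S in auto)
    also have "\<dots> = 2"
      using S \<open>A \<noteq> - A\<close> by (subst emeasure_count_space) auto
    finally show ?case .
  qed
qed

section \<open>Cosets, orbit weights and unfolding\<close>

definition coset_rep :: "(real^2^2) set \<Rightarrow> real^2^2" where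
  "coset_rep C = (SOME A. A \<in> C)"

lemma coset_eq:
  assumes "A \<in> Gamma0 1" "B \<in> Gamma0 1" "B ** inv2 A \<in> Gamma0 N"
  shows "(\<lambda>X. X ** B) ` Gamma0 N = (\<lambda>X. X ** A) ` Gamma0 N"
proof -
  have sub: "(\<lambda>X. X ** B) ` Gamma0 N \<subseteq> (\<lambda>X. X ** A) ` Gamma0 N"
    if "A \<in> Gamma0 1" "B ** inv2 A \<in> Gamma0 N" for A B :: "real^2^2"
  proof
    fix Y assume "Y \<in> (\<lambda>X. X ** B) ` Gamma0 N"
    then obtain X where X: "X \<in> Gamma0 N" "Y = X ** B" by auto
    have "Y = (X ** (B ** inv2 A)) ** A"
      by (simp only: X(2) matrix_mul_assoc[symmetric] inv2_mult[OF det_Gamma0[OF that(1)]] matrix_mul_rid)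
    then show "Y \<in> (\<lambda>X. X ** A) ` Gamma0 N" using X that Gamma0_mult by blast
  qed
  have "inv2 (B ** inv2 A) = A ** inv2 B"
    by (rule mat2_cases[of A], rule mat2_cases[of B]) (simp add: mat2_mult mat2_eq_iff)
  then have "A ** inv2 B \<in> Gamma0 N" using Gamma0_inv[OF assms(3)] by simp
  then show ?thesis using sub[of A B] sub[of B A] assms by blast
qed

lemma coset_rep:
  assumes "C \<in> Gamma0_cosets N"
  shows "coset_rep C \<in> C" "coset_rep C \<in> Gamma0 1" "C = (\<lambda>X. X ** coset_rep C) ` Gamma0 N"
proof -
  obtain A where A: "A \<in> Gamma0 1" "C = (\<lambda>X. X ** A) ` Gamma0 N"
    using assms by (auto simp: Gamma0_cosets_def)
  have "mat 1 ** A \<in> C" using A(2) Gamma0_one by blast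
  then show in1: "coset_rep C \<in> C" unfolding coset_rep_def by (rule someI)
  then obtain X where X: "X \<in> Gamma0 N" "coset_rep C = X ** A" using A(2) by auto
  then show in2: "coset_rep C \<in> Gamma0 1" using A Gamma0_mult Gamma0_sub1 by auto
  have "coset_rep C ** inv2 A = X"
    by (simp only: X(2) matrix_mul_assoc[symmetric] inv2_mult[OF det_Gamma0[OF A(1)]] matrix_mul_rid)
  then show "C = (\<lambda>X. X ** coset_rep C) ` Gamma0 N"
    using coset_eq[OF A(1) in2, of N] X(1) A(2) by simp
qed

text \<open>The bottom row modulo N determines the coset: if two bottom rows agree modulo N, then N
  divides c'd - d'c, the lower left entry of the quotient of the two representatives.\<close>

lemma finite_Gamma0_cosets:
  assumes "N > 0"
  shows "finite (Gamma0_cosets N)"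
proof (rule inj_on_finite)
  let ?key = "\<lambda>C. (\<lfloor>coset_rep C $ 2 $ 1\<rfloor> mod int N, \<lfloor>coset_rep C $ 2 $ 2\<rfloor> mod int N)"
  show "?key ` Gamma0_cosets N \<subseteq> {0..<int N} \<times> {0..<int N}" using assms by auto
  show "inj_on ?key (Gamma0_cosets N)"
  proof (rule inj_onI)
    fix C C' assume C: "C \<in> Gamma0_cosets N" "C' \<in> Gamma0_cosets N" and key: "?key C = ?key C'"
    obtain a b c d where A: "coset_rep C = mat2 (of_int a) (of_int b) (of_int c) (of_int d)" "a * d - b * c = 1"
      using coset_rep(2)[OF C(1)] by (elim Gamma0_E)
    obtain a' b' c' d' where B: "coset_rep C' = mat2 (of_int a') (of_int b') (of_int c') (of_int d')" "a' * d' - b' * c' = 1"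
      using coset_rep(2)[OF C(2)] by (elim Gamma0_E)
    have fl: "\<lfloor>coset_rep C $ 2 $ 1\<rfloor> = c" "\<lfloor>coset_rep C $ 2 $ 2\<rfloor> = d"
      "\<lfloor>coset_rep C' $ 2 $ 1\<rfloor> = c'" "\<lfloor>coset_rep C' $ 2 $ 2\<rfloor> = d'"
      by (simp_all only: A(1) B(1) mat2_nth floor_of_int)
    have "c mod int N = c' mod int N" "d mod int N = d' mod int N"
      using key unfolding fl by (simp_all only: prod.inject)
    then have "int N dvd c' - c" "int N dvd d - d'" by (simp_all add: mod_eq_dvd_iff[symmetric])
    moreover have "c' * d - d' * c = (c' - c) * d + (d - d') * c" by (simp add: algebra_simps)
    ultimately have dvd: "int N dvd c' * d - d' * c" by simp
    have BA: "coset_rep C' ** inv2 (coset_rep C) = mat2 (of_int (a' * d - b' * c)) (of_int (b' * a - a' * b)) (of_int (c' * d - d' * c)) (of_int (d' * a - c' * b))"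
      by (simp add: A B mat2_mult mat2_eq_iff)
    have "coset_rep C' ** inv2 (coset_rep C) \<in> Gamma0 1"
      using coset_rep(2) C by (intro Gamma0_mult Gamma0_inv)
    then have "coset_rep C' ** inv2 (coset_rep C) \<in> Gamma0 N"
      unfolding BA Gamma0_mat2 using dvd by simp
    from coset_eq[OF coset_rep(2)[OF C(1)] coset_rep(2)[OF C(2)] this]
    show "C = C'" using coset_rep(3) C by metis
  qed
qed auto

text \<open>The shape of \<open>petersson\<close> for a nonnegative integrand, with the factor 1/y^2
  moved into \<open>hyperbolic_measure\<close>.\<close>

definition orbit_integral :: "nat \<Rightarrow> (complex \<Rightarrow> ennreal) \<Rightarrow> ennreal" where
  "orbit_integral N H = (\<Sum>C\<in>Gamma0_cosets N.
     \<integral>\<^sup>+z. indicator std_fund_domain z * H (moebius (coset_rep C) z) \<partial>hyperbolic_measure)"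

text \<open>The multiplicity with which z is covered by the translates that assemble a fundamental
  domain of \<open>Gamma0 N\<close>. It depends on the chosen representatives, but its sum over the
  group is almost everywhere the same constant.\<close>

definition orbit_weight :: "nat \<Rightarrow> complex \<Rightarrow> ennreal" where
  "orbit_weight N z = (\<Sum>C\<in>Gamma0_cosets N. indicator std_fund_domain (moebius (inv2 (coset_rep C)) z))"

lemma measurable_orbit_weight [measurable]: "orbit_weight N \<in> borel_measurable borel"
  unfolding orbit_weight_def by measurable

lemma nn_integral_cong_uhp:
  assumes "\<And>z. Im z > 0 \<Longrightarrow> f z = g z"
  shows "(\<integral>\<^sup>+z. f z \<partial>hyperbolic_measure) = (\<integral>\<^sup>+z. g z \<partial>hyperbolic_measure)"
  by (rule nn_integral_cong_AE) (use AE_hyperbolic_uhp in \<open>eventually_elim, simp add: assms\<close>)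

text \<open>Invariance of the measure moves each representative from the integrand to the indicator
  of the domain, so that the sum of integrals becomes one integral over the half-plane.\<close>

lemma orbit_integral_weight:
  assumes [measurable]: "H \<in> borel_measurable borel"
  shows "orbit_integral N H = (\<integral>\<^sup>+z. H z * orbit_weight N z \<partial>hyperbolic_measure)"
proof -
  have "(\<integral>\<^sup>+z. indicator std_fund_domain z * H (moebius (coset_rep C) z) \<partial>hyperbolic_measure)
      = (\<integral>\<^sup>+z. H z * indicator std_fund_domain (moebius (inv2 (coset_rep C)) z) \<partial>hyperbolic_measure)"
    if C: "C \<in> Gamma0_cosets N" for C
  proof -
    define A where "A = coset_rep C"
    have det: "det A > 0" using coset_rep(2)[OF C] by (simp add: A_def)
    have "(\<integral>\<^sup>+z. H z * indicator std_fund_domain (moebius (inv2 A) z) \<partial>hyperbolic_measure)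
        = (\<integral>\<^sup>+z. H (moebius A z) * indicator std_fund_domain (moebius (inv2 A) (moebius A z)) \<partial>hyperbolic_measure)"
      by (rule nn_integral_moebius[OF det, symmetric]) measurable
    also have "\<dots> = (\<integral>\<^sup>+z. indicator std_fund_domain z * H (moebius A z) \<partial>hyperbolic_measure)"
      by (rule nn_integral_cong_uhp) (simp add: moebius_inv2[OF det] mult.commute)
    finally show ?thesis by (simp add: A_def)
  qed
  then have "orbit_integral N H = (\<Sum>C\<in>Gamma0_cosets N.
      \<integral>\<^sup>+z. H z * indicator std_fund_domain (moebius (inv2 (coset_rep C)) z) \<partial>hyperbolic_measure)"
    by (simp add: orbit_integral_def)
  also have "\<dots> = (\<integral>\<^sup>+z. H z * orbit_weight N z \<partial>hyperbolic_measure)"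
    unfolding orbit_weight_def sum_distrib_left by (subst nn_integral_sum) auto
  finally show ?thesis .
qed

lemma nn_integral_count_space_subset:
  assumes "S \<subseteq> T"
  shows "(\<integral>\<^sup>+x. f x \<partial>count_space S) = (\<integral>\<^sup>+x. f x * indicator S x \<partial>count_space T)"
proof -
  have "(\<integral>\<^sup>+x. f x * indicator S x \<partial>count_space T) = (\<integral>\<^sup>+x. f x * indicator S x * indicator T x \<partial>count_space UNIV)"
    by (rule nn_integral_count_space_indicator) simp
  also have "\<dots> = (\<integral>\<^sup>+x. f x * indicator S x \<partial>count_space UNIV)"
    by (intro nn_integral_cong) (use assms in \<open>auto simp: indicator_def\<close>)
  also have "\<dots> = (\<integral>\<^sup>+x. f x \<partial>count_space S)"
    by (rule nn_integral_count_space_indicator[symmetric]) simp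
  finally show ?thesis ..
qed

text \<open>\<open>Gamma0 1\<close> is the disjoint union of the sets \<open>S C\<close>, the
  translates of \<open>Gamma0 N\<close> by inverse representatives. The sum of the weight is
  therefore the orbit count of the full modular group, where A and -A account for the value
  2.\<close>

lemma orbit_weight_sum:
  assumes "N > 0"
  shows "AE z in hyperbolic_measure. (\<integral>\<^sup>+A. orbit_weight N (moebius A z) \<partial>count_space (Gamma0 N)) = 2"
  using AE_orbit_count AE_hyperbolic_uhp
proof eventually_elim
  case (elim z)
  let ?F = "\<lambda>B. indicator std_fund_domain (moebius B z) :: ennreal"
  define S where "S C = (\<lambda>A. inv2 (coset_rep C) ** A) ` Gamma0 N" for C
  have S_sub: "S C \<subseteq> Gamma0 1" if "C \<in> Gamma0_cosets N" for C
    using coset_rep(2)[OF that] Gamma0_sub1 unfolding S_def by (auto intro!: Gamma0_mult Gamma0_inv)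
  have inS: "B \<in> S C \<longleftrightarrow> inv2 B \<in> C" if "C \<in> Gamma0_cosets N" "B \<in> Gamma0 1" for B C
  proof -
    define R where "R = coset_rep C"
    have R: "det R = 1" using coset_rep(2)[OF that(1)] by (simp add: R_def)
    have C: "C = (\<lambda>X. X ** R) ` Gamma0 N" using coset_rep(3)[OF that(1)] by (simp add: R_def)
    have inv_mult: "inv2 (X ** Y) = inv2 Y ** inv2 X" for X Y
      by (rule mat2_cases[of X], rule mat2_cases[of Y]) (simp add: mat2_mult mat2_eq_iff)
    show ?thesis
    proof
      assume "B \<in> S C"
      then obtain A where A: "A \<in> Gamma0 N" "B = inv2 R ** A" by (auto simp: S_def R_def)
      then have "inv2 B = inv2 A ** R" by (simp add: inv_mult)
      then show "inv2 B \<in> C" using A C Gamma0_inv by blast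
    next
      assume "inv2 B \<in> C"
      then obtain A where A: "A \<in> Gamma0 N" "inv2 B = A ** R" using C by auto
      then have "B = inv2 R ** inv2 A" using inv_mult[of A R] by (metis inv2_inv2)
      then show "B \<in> S C" using A Gamma0_inv unfolding S_def R_def by blast
    qed
  qed
  define cos where "cos A = (\<lambda>X. X ** A) ` Gamma0 N" for A :: "real^2^2"
  have cos: "cos A \<in> Gamma0_cosets N" "A \<in> cos A" if "A \<in> Gamma0 1" for A
  proof -
    have "mat 1 ** A \<in> cos A" unfolding cos_def using Gamma0_one by blast
    then show "cos A \<in> Gamma0_cosets N" "A \<in> cos A"
      using that by (auto simp: Gamma0_cosets_def cos_def)
  qed
  have uniq: "C = cos A" if "A \<in> Gamma0 1" "C \<in> Gamma0_cosets N" "A \<in> C" for A C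
  proof -
    have "A \<in> (\<lambda>X. X ** coset_rep C) ` Gamma0 N" using coset_rep(3)[OF that(2)] that(3) by simp
    then obtain X where X: "X \<in> Gamma0 N" "A = X ** coset_rep C" by (elim imageE)
    have "A ** inv2 (coset_rep C) = X"
      by (simp only: X(2) matrix_mul_assoc[symmetric] inv2_mult[OF det_Gamma0[OF coset_rep(2)[OF that(2)]]] matrix_mul_rid)
    with X(1) have "A ** inv2 (coset_rep C) \<in> Gamma0 N" by simp
    from coset_eq[OF coset_rep(2)[OF that(2)] that(1) this]
    show ?thesis using coset_rep(3)[OF that(2)] by (simp add: cos_def)
  qed
  have inj: "inj_on (\<lambda>A. inv2 (coset_rep C) ** A) (Gamma0 N)" if "C \<in> Gamma0_cosets N" for C
  proof (rule inj_on_inverseI[of _ "\<lambda>B. coset_rep C ** B"])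
    show "coset_rep C ** (inv2 (coset_rep C) ** A) = A" for A
      using coset_rep(2)[OF that] by (simp add: matrix_mul_assoc inv2_mult)
  qed
  have "(\<integral>\<^sup>+A. orbit_weight N (moebius A z) \<partial>count_space (Gamma0 N))
      = (\<Sum>C\<in>Gamma0_cosets N. \<integral>\<^sup>+A. indicator std_fund_domain (moebius (inv2 (coset_rep C)) (moebius A z)) \<partial>count_space (Gamma0 N))"
    unfolding orbit_weight_def by (rule nn_integral_sum) simp
  also have "\<dots> = (\<Sum>C\<in>Gamma0_cosets N. \<integral>\<^sup>+A. ?F (inv2 (coset_rep C) ** A) \<partial>count_space (Gamma0 N))"
    by (rule sum.cong[OF refl], rule nn_integral_cong) (use elim in \<open>simp add: moebius_mult\<close>)
  also have "\<dots> = (\<Sum>C\<in>Gamma0_cosets N. \<integral>\<^sup>+B. ?F B \<partial>count_space (S C))"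
  proof (rule sum.cong[OF refl])
    fix C assume "C \<in> Gamma0_cosets N"
    then have "bij_betw (\<lambda>A. inv2 (coset_rep C) ** A) (Gamma0 N) (S C)"
      unfolding S_def by (intro inj_on_imp_bij_betw inj)
    from nn_integral_bij_count_space[OF this, of ?F]
    show "(\<integral>\<^sup>+A. ?F (inv2 (coset_rep C) ** A) \<partial>count_space (Gamma0 N)) = (\<integral>\<^sup>+B. ?F B \<partial>count_space (S C))" .
  qed
  also have "\<dots> = (\<Sum>C\<in>Gamma0_cosets N. \<integral>\<^sup>+B. ?F B * indicator (S C) B \<partial>count_space (Gamma0 1))"
  proof (rule sum.cong[OF refl])
    fix C assume "C \<in> Gamma0_cosets N"
    from nn_integral_count_space_subset[OF S_sub[OF this], of ?F]
    show "(\<integral>\<^sup>+B. ?F B \<partial>count_space (S C)) = (\<integral>\<^sup>+B. ?F B * indicator (S C) B \<partial>count_space (Gamma0 1))" .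
  qed
  also have "\<dots> = (\<integral>\<^sup>+B. (\<Sum>C\<in>Gamma0_cosets N. ?F B * indicator (S C) B) \<partial>count_space (Gamma0 1))"
    by (rule nn_integral_sum[symmetric]) simp
  also have "\<dots> = (\<integral>\<^sup>+B. ?F B \<partial>count_space (Gamma0 1))"
  proof (rule nn_integral_cong)
    fix B assume "B \<in> space (count_space (Gamma0 1))"
    then have B: "B \<in> Gamma0 1" "inv2 B \<in> Gamma0 1" using Gamma0_inv by auto
    define C where "C = cos (inv2 B)"
    have C: "C \<in> Gamma0_cosets N" "inv2 B \<in> C" using cos[OF B(2)] by (simp_all add: C_def)
    have C': "C' = C" if "C' \<in> Gamma0_cosets N" "inv2 B \<in> C'" for C'
      using uniq[OF B(2) that] by (simp add: C_def)
    have "(\<Sum>C'\<in>Gamma0_cosets N. indicator (S C') B :: ennreal) = (\<Sum>C'\<in>Gamma0_cosets N. if C' = C then 1 else 0)"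
    proof (rule sum.cong[OF refl])
      fix C' assume "C' \<in> Gamma0_cosets N"
      then have "B \<in> S C' \<longleftrightarrow> C' = C" using inS[OF _ B(1)] C C' by blast
      then show "(indicator (S C') B :: ennreal) = (if C' = C then 1 else 0)"
        by (cases "C' = C") (auto simp: indicator_def)
    qed
    also have "\<dots> = 1" using C finite_Gamma0_cosets[OF assms] by simp
    finally show "(\<Sum>C\<in>Gamma0_cosets N. ?F B * indicator (S C) B) = ?F B"
      by (simp flip: sum_distrib_left)
  qed
  also have "\<dots> = 2" using elim by simp
  finally show ?case .
qed

text \<open>Two weights with constant orbit sums integrate an invariant function to proportional
  values: multiply one of them by the orbit sum of the other, and unfold.\<close>

lemma orbit_weights_exchange:
  assumes [measurable]: "H \<in> borel_measurable borel" "w \<in> borel_measurable borel" "w' \<in> borel_measurable borel"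
    and inv: "\<And>A z. A \<in> Gamma0 N \<Longrightarrow> Im z > 0 \<Longrightarrow> H (moebius A z) = H z"
    and w: "AE z in hyperbolic_measure. (\<integral>\<^sup>+A. w (moebius A z) \<partial>count_space (Gamma0 N)) = c"
    and w': "AE z in hyperbolic_measure. (\<integral>\<^sup>+A. w' (moebius A z) \<partial>count_space (Gamma0 N)) = c'"
  shows "c' * (\<integral>\<^sup>+z. H z * w z \<partial>hyperbolic_measure) = c * (\<integral>\<^sup>+z. H z * w' z \<partial>hyperbolic_measure)"
proof -
  let ?G = "count_space (Gamma0 N)"
  have bij: "bij_betw inv2 (Gamma0 N) (Gamma0 N)"
    by (rule bij_betw_byWitness[of _ inv2]) (auto intro: Gamma0_inv)
  have "c' * (\<integral>\<^sup>+z. H z * w z \<partial>hyperbolic_measure)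
      = (\<integral>\<^sup>+z. H z * w z * (\<integral>\<^sup>+A. w' (moebius A z) \<partial>?G) \<partial>hyperbolic_measure)"
  proof -
    have "(\<integral>\<^sup>+z. H z * w z * (\<integral>\<^sup>+A. w' (moebius A z) \<partial>?G) \<partial>hyperbolic_measure)
       = (\<integral>\<^sup>+z. H z * w z * c' \<partial>hyperbolic_measure)"
      by (rule nn_integral_cong_AE) (use w' in \<open>eventually_elim, simp\<close>)
    also have "\<dots> = (\<integral>\<^sup>+z. H z * w z \<partial>hyperbolic_measure) * c'"
      by (rule nn_integral_multc) measurable
    finally show ?thesis by (simp only: mult.commute)
  qed
  also have "\<dots> = (\<integral>\<^sup>+z. \<integral>\<^sup>+A. H z * w z * w' (moebius A z) \<partial>?G \<partial>hyperbolic_measure)"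
    by (intro nn_integral_cong nn_integral_cmult[symmetric]) simp
  also have "\<dots> = (\<integral>\<^sup>+A. \<integral>\<^sup>+z. H z * w z * w' (moebius A z) \<partial>hyperbolic_measure \<partial>?G)"
    by (rule nn_integral_count_space_nn_integral[OF countable_Gamma0]) auto
  \<comment> \<open>Substituting in the invariant measure moves A away from w' and puts its inverse
    on w, while H does not change. As the inverse also runs through the group, the two weights have
    changed places.\<close>
  also have "\<dots> = (\<integral>\<^sup>+A. \<integral>\<^sup>+z. H z * w (moebius (inv2 A) z) * w' z \<partial>hyperbolic_measure \<partial>?G)"
  proof (rule nn_integral_cong)
    fix A assume "A \<in> space ?G"
    then have A: "A \<in> Gamma0 N" "inv2 A \<in> Gamma0 N" by (auto intro: Gamma0_inv)
    have "(\<integral>\<^sup>+z. H z * w (moebius (inv2 A) z) * w' z \<partial>hyperbolic_measure)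
       = (\<integral>\<^sup>+z. H (moebius A z) * w (moebius (inv2 A) (moebius A z)) * w' (moebius A z) \<partial>hyperbolic_measure)"
      by (rule nn_integral_moebius[symmetric]) (use A in auto)
    also have "\<dots> = (\<integral>\<^sup>+z. H z * w z * w' (moebius A z) \<partial>hyperbolic_measure)"
      by (rule nn_integral_cong_uhp) (use A in \<open>simp add: inv moebius_inv2\<close>)
    finally show "(\<integral>\<^sup>+z. H z * w z * w' (moebius A z) \<partial>hyperbolic_measure)
       = (\<integral>\<^sup>+z. H z * w (moebius (inv2 A) z) * w' z \<partial>hyperbolic_measure)" ..
  qed
  also have "\<dots> = (\<integral>\<^sup>+z. \<integral>\<^sup>+A. H z * w (moebius (inv2 A) z) * w' z \<partial>?G \<partial>hyperbolic_measure)"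
    by (rule nn_integral_count_space_nn_integral[OF countable_Gamma0, symmetric]) auto
  also have "\<dots> = (\<integral>\<^sup>+z. \<integral>\<^sup>+A. H z * w (moebius A z) * w' z \<partial>?G \<partial>hyperbolic_measure)"
    using nn_integral_bij_count_space[OF bij, of "\<lambda>A. H z * w (moebius A z) * w' z" for z] by simp
  also have "\<dots> = (\<integral>\<^sup>+z. H z * w' z * (\<integral>\<^sup>+A. w (moebius A z) \<partial>?G) \<partial>hyperbolic_measure)"
  proof (rule nn_integral_cong)
    fix z
    have "(\<integral>\<^sup>+A. H z * w (moebius A z) * w' z \<partial>?G) = (\<integral>\<^sup>+A. H z * w' z * w (moebius A z) \<partial>?G)"
      by (simp only: mult_ac)
    also have "\<dots> = H z * w' z * (\<integral>\<^sup>+A. w (moebius A z) \<partial>?G)"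
      by (rule nn_integral_cmult) simp
    finally show "(\<integral>\<^sup>+A. H z * w (moebius A z) * w' z \<partial>?G) = H z * w' z * (\<integral>\<^sup>+A. w (moebius A z) \<partial>?G)" .
  qed
  also have "\<dots> = (\<integral>\<^sup>+z. H z * w' z * c \<partial>hyperbolic_measure)"
    by (rule nn_integral_cong_AE) (use w in \<open>eventually_elim, simp\<close>)
  also have "\<dots> = c * (\<integral>\<^sup>+z. H z * w' z \<partial>hyperbolic_measure)"
  proof -
    have "(\<integral>\<^sup>+z. H z * w' z * c \<partial>hyperbolic_measure) = (\<integral>\<^sup>+z. H z * w' z \<partial>hyperbolic_measure) * c"
      by (rule nn_integral_multc) measurable
    then show ?thesis by (simp only: mult.commute)
  qed
  finally show ?thesis .
qed

text \<open>Transported by B, the orbit weight still has orbit sums 2, since conjugation permutes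
  the group; so it can be exchanged for the original weight. Conjugation enters as a permutation s,
  as B may have any positive determinant.\<close>

lemma orbit_integral_normalizer:
  assumes N: "N > 0" and [measurable]: "H \<in> borel_measurable borel"
    and inv: "\<And>A z. A \<in> Gamma0 N \<Longrightarrow> Im z > 0 \<Longrightarrow> H (moebius A z) = H z"
    and det: "det B > 0" and bij: "bij_betw s (Gamma0 N) (Gamma0 N)"
    and conj: "\<And>A z. A \<in> Gamma0 N \<Longrightarrow> Im z > 0 \<Longrightarrow> moebius (inv2 B) (moebius A z) = moebius (s A) (moebius (inv2 B) z)"
  shows "orbit_integral N (\<lambda>z. H (moebius B z)) = orbit_integral N H"
proof -
  have "orbit_integral N (\<lambda>z. H (moebius B z)) = (\<integral>\<^sup>+z. H (moebius B z) * orbit_weight N z \<partial>hyperbolic_measure)"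
    by (rule orbit_integral_weight) measurable
  also have "\<dots> = (\<integral>\<^sup>+z. H (moebius B z) * orbit_weight N (moebius (inv2 B) (moebius B z)) \<partial>hyperbolic_measure)"
    by (rule nn_integral_cong_uhp) (simp add: moebius_inv2[OF det])
  also have "\<dots> = (\<integral>\<^sup>+z. H z * orbit_weight N (moebius (inv2 B) z) \<partial>hyperbolic_measure)"
    by (rule nn_integral_moebius[OF det]) measurable
  finally have 1: "orbit_integral N (\<lambda>z. H (moebius B z)) = (\<integral>\<^sup>+z. H z * orbit_weight N (moebius (inv2 B) z) \<partial>hyperbolic_measure)" .
  have "AE z in hyperbolic_measure. (\<integral>\<^sup>+A. orbit_weight N (moebius A (moebius (inv2 B) z)) \<partial>count_space (Gamma0 N)) = 2"
    by (rule AE_moebius[OF _ orbit_weight_sum[OF N]]) (use det in simp)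
  with AE_hyperbolic_uhp
  have "AE z in hyperbolic_measure. (\<integral>\<^sup>+A. orbit_weight N (moebius (inv2 B) (moebius A z)) \<partial>count_space (Gamma0 N)) = 2"
  proof eventually_elim
    case (elim z)
    have "(\<integral>\<^sup>+A. orbit_weight N (moebius (inv2 B) (moebius A z)) \<partial>count_space (Gamma0 N))
      = (\<integral>\<^sup>+A. orbit_weight N (moebius (s A) (moebius (inv2 B) z)) \<partial>count_space (Gamma0 N))"
      by (intro nn_integral_cong) (use elim conj in simp)
    also have "\<dots> = (\<integral>\<^sup>+A. orbit_weight N (moebius A (moebius (inv2 B) z)) \<partial>count_space (Gamma0 N))"
      using nn_integral_bij_count_space[OF bij, of "\<lambda>A. orbit_weight N (moebius A (moebius (inv2 B) z))"] .
    finally show ?case using elim by simp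
  qed
  from orbit_weights_exchange[OF assms(2) _ _ inv this orbit_weight_sum[OF N]]
  have "2 * (\<integral>\<^sup>+z. H z * orbit_weight N (moebius (inv2 B) z) \<partial>hyperbolic_measure)
      = 2 * (\<integral>\<^sup>+z. H z * orbit_weight N z \<partial>hyperbolic_measure)" by simp
  then show ?thesis
    unfolding 1 orbit_integral_weight[OF assms(2)] by (subst (asm) ennreal_mult_cancel_left) simp
qed

text \<open>\<open>Gamma0 N\<close> is the union of \<open>Gamma0 M\<close> and its coset by B.
  Summed over this group, the weight of level M gives 2 + 2 = 4 in place of 2, and the exchange of
  weights yields the index.\<close>

lemma orbit_integral_index2:
  assumes N: "N > 0" and [measurable]: "H \<in> borel_measurable borel"
    and inv: "\<And>A z. A \<in> Gamma0 N \<Longrightarrow> Im z > 0 \<Longrightarrow> H (moebius A z) = H z"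
    and B: "B \<in> Gamma0 N" "\<And>A. A \<in> Gamma0 N \<Longrightarrow> A ** inv2 B \<in> Gamma0 M \<longleftrightarrow> A \<notin> Gamma0 M"
    and M: "M > 0" "Gamma0 M \<subseteq> Gamma0 N"
  shows "orbit_integral M H = 2 * orbit_integral N H"
proof -
  have AE2: "AE z in hyperbolic_measure. (\<integral>\<^sup>+A. orbit_weight M (moebius A (moebius B z)) \<partial>count_space (Gamma0 M)) = 2"
    by (rule AE_moebius[OF _ orbit_weight_sum[OF M(1)]]) (use B in simp)
  have "AE z in hyperbolic_measure. (\<integral>\<^sup>+A. orbit_weight M (moebius A z) \<partial>count_space (Gamma0 N)) = 4"
    using AE2 orbit_weight_sum[OF M(1)] AE_hyperbolic_uhp
  proof eventually_elim
    case (elim z)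
    let ?f = "\<lambda>A. orbit_weight M (moebius A z)"
    have b1: "B ** inv2 B = mat 1" "inv2 B ** B = mat 1" using B by (simp_all add: inv2_mult)
    have bij: "bij_betw (\<lambda>A. A ** B) (Gamma0 M) (Gamma0 N - Gamma0 M)"
    proof (rule bij_betw_byWitness[of _ "\<lambda>A. A ** inv2 B"])
      show "\<forall>A\<in>Gamma0 M. A ** B ** inv2 B = A" "\<forall>A\<in>Gamma0 N - Gamma0 M. A ** inv2 B ** B = A"
        by (simp_all add: matrix_mul_assoc[symmetric] b1)
      show "(\<lambda>A. A ** B) ` Gamma0 M \<subseteq> Gamma0 N - Gamma0 M"
      proof safe
        fix A assume A: "A \<in> Gamma0 M"
        then show AB: "A ** B \<in> Gamma0 N" using M B Gamma0_mult by blast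
        assume "A ** B \<in> Gamma0 M"
        then have "A ** B ** inv2 B \<notin> Gamma0 M" using B(2)[OF AB] by simp
        then show False using A by (simp add: matrix_mul_assoc[symmetric] b1)
      qed
      show "(\<lambda>A. A ** inv2 B) ` (Gamma0 N - Gamma0 M) \<subseteq> Gamma0 M" using B(2) by auto
    qed
    have "(\<integral>\<^sup>+A. ?f A \<partial>count_space (Gamma0 N - Gamma0 M)) = (\<integral>\<^sup>+A. ?f (A ** B) \<partial>count_space (Gamma0 M))"
      using nn_integral_bij_count_space[OF bij, of ?f] by simp
    also have "\<dots> = (\<integral>\<^sup>+A. orbit_weight M (moebius A (moebius B z)) \<partial>count_space (Gamma0 M))"
      by (rule nn_integral_cong) (use elim B in \<open>simp add: moebius_mult\<close>)
    finally have 2: "(\<integral>\<^sup>+A. ?f A \<partial>count_space (Gamma0 N - Gamma0 M)) = 2"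
      using elim by simp
    have 3: "?f A = ?f A * indicator (Gamma0 M) A + ?f A * indicator (Gamma0 N - Gamma0 M) A"
      if "A \<in> Gamma0 N" for A using that by (auto simp: indicator_def)
    have 4: "(\<integral>\<^sup>+A. ?f A \<partial>count_space (Gamma0 N)) = (\<integral>\<^sup>+A. ?f A * indicator (Gamma0 M) A + ?f A * indicator (Gamma0 N - Gamma0 M) A \<partial>count_space (Gamma0 N))"
      by (rule nn_integral_cong, rule 3) simp
    have 5: "(\<integral>\<^sup>+A. ?f A * indicator (Gamma0 M) A + ?f A * indicator (Gamma0 N - Gamma0 M) A \<partial>count_space (Gamma0 N)) = (\<integral>\<^sup>+A. ?f A * indicator (Gamma0 M) A \<partial>count_space (Gamma0 N)) + (\<integral>\<^sup>+A. ?f A * indicator (Gamma0 N - Gamma0 M) A \<partial>count_space (Gamma0 N))"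
      by (rule nn_integral_add) simp_all
    have 6: "(\<integral>\<^sup>+A. ?f A * indicator (Gamma0 M) A \<partial>count_space (Gamma0 N)) = 2"
      using nn_integral_count_space_subset[OF M(2), of ?f] elim by simp
    have 7: "(\<integral>\<^sup>+A. ?f A * indicator (Gamma0 N - Gamma0 M) A \<partial>count_space (Gamma0 N)) = 2"
      using nn_integral_count_space_subset[OF Diff_subset[of "Gamma0 N" "Gamma0 M"], of ?f] 2 by simp
    show ?case unfolding 4 5 6 7 by simp
  qed
  from orbit_weights_exchange[OF assms(2) _ _ inv this orbit_weight_sum[OF N]]
  have "2 * orbit_integral M H = 4 * orbit_integral N H"
    by (simp add: orbit_integral_weight)
  also have "\<dots> = 2 * (2 * orbit_integral N H)" by (simp flip: mult.assoc)
  finally show ?thesis by (subst (asm) ennreal_mult_cancel_left) simp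
qed

section \<open>Cusp forms\<close>

lemma powi_odd: "x powi (- 2 * int k - 1) = inverse ((x :: complex) ^ (2 * k + 1))"
proof -
  have "- 2 * int k - 1 = - int (2 * k + 1)" by simp
  then show ?thesis by (simp only: power_int_minus power_int_of_nat)
qed

lemma slash_apply: "slash k A \<phi> f z = (if Im z > 0 then f (moebius A z) * inverse (\<phi> z ^ (2 * k + 1)) else 0)"
  by (simp only: slash_def uhp_iff powi_odd)

lemma theta_factor_nonzero:
  assumes "4 dvd c" "coprime c d" "Im z > 0"
  shows "theta_factor c d z \<noteq> 0"
  using theta_factor_square(1)[OF assms(1,2), of z] uhp_denom_nonzero_int[OF assms(3,2)] by auto

text \<open>Invariance without division and at points of the half-plane only; it thus applies also
  to functions such as \<open>half_shift f\<close> or \<open>eval_at k c f\<close>, which are not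
  cut off at the real axis.\<close>

definition theta_inv :: "nat \<Rightarrow> nat \<Rightarrow> (complex \<Rightarrow> complex) \<Rightarrow> bool" where
  "theta_inv k N f \<longleftrightarrow> (\<forall>a b c d z. a * d - b * c = 1 \<longrightarrow> int N dvd c \<longrightarrow> Im z > 0 \<longrightarrow>
     f (mob a b c d z) = theta_factor c d z ^ (2 * k + 1) * f z)"

lemma theta_invD:
  "theta_inv k N f \<Longrightarrow> a * d - b * c = 1 \<Longrightarrow> int N dvd c \<Longrightarrow> Im z > 0 \<Longrightarrow>
     f (mob a b c d z) = theta_factor c d z ^ (2 * k + 1) * f z"
  by (simp add: theta_inv_def)

lemma slash_invariant_iff:
  assumes "4 dvd N" "\<And>z. Im z \<le> 0 \<Longrightarrow> f z = 0"
  shows "(\<forall>a b c d :: int. a * d - b * c = 1 \<and> int N dvd c \<longrightarrow>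
        slash k (mat2 (of_int a) (of_int b) (of_int c) (of_int d)) (theta_factor c d) f = f) \<longleftrightarrow> theta_inv k N f"
proof -
  have "slash k (mat2 (of_int a) (of_int b) (of_int c) (of_int d)) (theta_factor c d) f = f \<longleftrightarrow>
     (\<forall>z. Im z > 0 \<longrightarrow> f (mob a b c d z) = theta_factor c d z ^ (2 * k + 1) * f z)"
    if *: "a * d - b * c = 1" "int N dvd c" for a b c d
  proof -
    have c4: "4 dvd c" using assms(1) *(2) by (metis dvd_trans int_dvd_int_iff of_nat_numeral)
    have "(f (mob a b c d z) * inverse (theta_factor c d z ^ (2 * k + 1)) = f z)
      \<longleftrightarrow> (f (mob a b c d z) = theta_factor c d z ^ (2 * k + 1) * f z)" if "Im z > 0" for z
    proof -
      have "theta_factor c d z ^ (2 * k + 1) \<noteq> 0"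
        using theta_factor_nonzero[OF c4 coprime_det[OF *(1)] that] by simp
      then show ?thesis by (simp only: divide_inverse[symmetric] divide_eq_eq) (simp only: mult.commute if_True simp_thms)
    qed
    then show ?thesis
      unfolding fun_eq_iff slash_apply moebius_int using assms(2) by (metis linorder_not_less)
  qed
  then show ?thesis unfolding theta_inv_def by blast
qed

text \<open>The invariant absolute value, with half of the weight k + 1/2 as exponent: its square is
  the Petersson integrand of f with itself, and multipliers of absolute value 1 do not affect
  it.\<close>

definition hnorm :: "nat \<Rightarrow> (complex \<Rightarrow> complex) \<Rightarrow> complex \<Rightarrow> real" where
  "hnorm k f z = cmod (f z) * Im z powr (real k / 2 + 1 / 4)"

lemma hnorm_nonneg [simp]: "hnorm k f z \<ge> 0"
  by (simp add: hnorm_def)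

text \<open>Here s is |cz + d| and r the absolute value of the factor of weight 1/2. As k/2 + 1/4 is
  a quarter of 2k + 1, the power of s^2 = r^4 with this exponent is r^(2k+1).\<close>

lemma hnorm_transform:
  assumes "s > 0" "r \<ge> 0" "r\<^sup>2 = s" "Im w = Im z / s\<^sup>2" "Im z > 0" "cmod (f w) = r ^ (2 * k + 1) * cmod (g z)"
  shows "hnorm k f w = hnorm k g z"
proof -
  let ?a = "real k / 2 + 1 / 4"
  have r: "r > 0" using assms(1-3) by (cases "r = 0") auto
  have "s powr ?a = r powr (2 * ?a)" using r by (simp add: assms(3)[symmetric] powr_powr flip: powr_numeral)
  then have "s\<^sup>2 powr ?a = r powr (2 * ?a) * r powr (2 * ?a)"
    using assms(1) by (simp add: power2_eq_square powr_mult)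
  also have "\<dots> = r powr real (2 * k + 1)"
  proof -
    have "2 * ?a + 2 * ?a = real (2 * k + 1)" by simp
    then show ?thesis by (simp only: powr_add[symmetric])
  qed
  also have "\<dots> = r ^ (2 * k + 1)" using r by (simp only: powr_realpow)
  finally have "s\<^sup>2 powr ?a = r ^ (2 * k + 1)" .
  moreover have "Im w powr ?a = Im z powr ?a / s\<^sup>2 powr ?a"
    using assms by (simp add: powr_divide)
  ultimately show ?thesis using r assms(6) by (simp add: hnorm_def)
qed

lemma hnorm_csqrt_slash:
  assumes "a * d - b * c = 1" "Im z > 0"
  shows "hnorm k f (mob a b c d z) =
    hnorm k (slash k (mat2 (of_int a) (of_int b) (of_int c) (of_int d)) (\<lambda>z. csqrt (of_int c * z + of_int d)) f) z"
proof (rule hnorm_transform)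
  let ?D = "of_int c * z + of_int d :: complex"
  have D: "?D \<noteq> 0" using uhp_denom_nonzero_int assms coprime_det by blast
  show "cmod ?D > 0" "cmod (csqrt ?D) \<ge> 0" "(cmod (csqrt ?D))\<^sup>2 = cmod ?D" using D by auto
  show "Im (mob a b c d z) = Im z / (cmod ?D)\<^sup>2" by (rule Im_mob[OF assms(1)])
  define X where "X = csqrt ?D ^ (2 * k + 1)"
  have X: "X \<noteq> 0" using D by (simp add: X_def)
  show "cmod (f (mob a b c d z)) = cmod (csqrt ?D) ^ (2 * k + 1) *
      cmod (slash k (mat2 (of_int a) (of_int b) (of_int c) (of_int d)) (\<lambda>z. csqrt (of_int c * z + of_int d)) f z)"
    using assms(2) X unfolding slash_apply moebius_int norm_power[symmetric] X_def[symmetric]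
    by (simp add: norm_mult norm_inverse)
qed (rule assms)

lemma hnorm_theta_inv:
  assumes "theta_inv k N f" "4 dvd N" "a * d - b * c = 1" "int N dvd c" "Im z > 0"
  shows "hnorm k f (mob a b c d z) = hnorm k f z"
proof (rule hnorm_transform)
  let ?D = "of_int c * z + of_int d :: complex"
  have c4: "4 dvd c" using assms(2,4) by (metis dvd_trans int_dvd_int_iff of_nat_numeral)
  show "cmod ?D > 0" using uhp_denom_nonzero_int assms coprime_det by simp
  show "(cmod (theta_factor c d z))\<^sup>2 = cmod ?D"
    by (rule theta_factor_square[OF c4 coprime_det[OF assms(3)]])
  show "Im (mob a b c d z) = Im z / (cmod ?D)\<^sup>2" by (rule Im_mob[OF assms(3)])
  show "cmod (f (mob a b c d z)) = cmod (theta_factor c d z) ^ (2 * k + 1) * cmod (f z)"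
    by (simp only: theta_invD[OF assms(1,3,4,5)] norm_mult norm_power)
qed (use assms in auto)

text \<open>Being stated for \<open>hnorm\<close>, the condition is blind to square roots and
  multipliers. The threshold y is arbitrary because rational substitutions rescale heights.\<close>

definition cusp_decay :: "nat \<Rightarrow> (complex \<Rightarrow> complex) \<Rightarrow> bool" where
  "cusp_decay k f \<longleftrightarrow> (\<forall>a b c d :: int. a * d - b * c = 1 \<longrightarrow> (\<forall>y>0. \<exists>C e. e > 0 \<and>
     (\<forall>z. y \<le> Im z \<longrightarrow> hnorm k f (mob a b c d z) \<le> C * exp (- e * Im z))))"

lemma powr_le_exp:
  assumes "a > 0" "e > 0" "y > (0::real)"
  shows "y powr a \<le> (a / e) powr a * exp (e * y)"
proof -
  define x where "x = e * y / a"
  have x: "x > 0" "y = (a / e) * x" using assms by (simp_all add: x_def)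
  have "x \<le> exp x" using exp_ge_add_one_self[of x] by linarith
  then have "x powr a \<le> exp x powr a" using x assms by (intro powr_mono2) auto
  also have "\<dots> = exp (e * y)" using assms by (simp add: powr_def x_def)
  finally have "x powr a \<le> exp (e * y)" .
  moreover have "y powr a = (a / e) powr a * x powr a" unfolding x(2) using assms x(1) by (subst powr_mult) auto
  ultimately show ?thesis by (simp add: mult_left_mono)
qed

lemma norm_exp_fourier:
  "cmod (exp (2 * of_real pi * \<i> * of_real x * z / of_nat h)) = exp (- (2 * pi * x * Im z / real h))"
proof -
  have "Re (2 * of_real pi * \<i> * of_real x * z / of_nat h) = - (2 * pi * x * Im z / real h)"
    by (simp add: Re_divide_of_nat)
  then show ?thesis by (simp only: norm_exp_eq_Re)
qed

text \<open>All terms are bounded at height y/2. Between there and a height Im z \<ge> y each term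
  gains an exponential factor, which is split into one that decays in Im z and one that is geometric
  in n and makes the sum converge.\<close>

lemma fourier_expansion_decay:
  assumes "has_fourier_expansion h r F u" "h > 0" "0 \<le> r" "r = 0 \<longrightarrow> u 0 = 0" "y > 0"
  shows "\<exists>C e. e > 0 \<and> (\<forall>z. y \<le> Im z \<longrightarrow> cmod (F z) \<le> C * exp (- e * Im z))"
proof -
  define t where "t n z = u n * exp (2 * of_real pi * \<i> * of_real (real n + r) * z / of_nat h)" for n z
  have sums: "(\<lambda>n. t n z) sums F z" if "Im z > 0" for z
    using assms(1) that by (simp add: has_fourier_expansion_def t_def)
  have norm_t: "cmod (t n z) = cmod (u n) * exp (- (2 * pi * (real n + r) * Im z / real h))" for n z
    unfolding t_def norm_mult norm_exp_fourier by simp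
  define z1 where "z1 = Complex 0 (y / 2)"
  have "Bseq (\<lambda>n. t n z1)"
    using sums[of z1] assms(5) summable_LIMSEQ_zero[of "\<lambda>n. t n z1"]
    by (intro convergent_imp_Bseq convergentI[of _ 0]) (auto simp: sums_iff z1_def)
  then obtain K where K: "K > 0" "\<And>n. cmod (t n z1) \<le> K" by (auto elim: BseqE)
  \<comment> \<open>The smallest exponent that can occur: for r = 0 the constant term vanishes, so n
    starts at 1.\<close>
  define \<delta> where "\<delta> = (if r = 0 then 1 else r)"
  have \<delta>: "\<delta> > 0" using assms(3) by (simp add: \<delta>_def)
  \<comment> \<open>Both rates, e and the one in q, come from 4 (n + r) (Im z - y/2) \<ge> 2 (n + r)
    Im z \<ge> \<delta> Im z + n y, multiplied by pi/(2h).\<close>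
  define e where "e = pi * \<delta> / (2 * real h)"
  define q where "q = exp (- (pi * y / (2 * real h)))"
  have q: "0 \<le> q" "q < 1" using assms by (simp_all add: q_def)
  have bound: "cmod (t n z) \<le> K * exp (- e * Im z) * q ^ n" if z: "y \<le> Im z" for n z
  proof (cases "u n = 0")
    case True
    then show ?thesis using K q by (simp add: t_def)
  next
    case False
    have nr: "real n + r \<ge> \<delta>" "real n + r \<ge> real n"
      using assms(3,4) False by (cases n; auto simp: \<delta>_def)+
    have "cmod (t n z) = cmod (t n z1) * exp (- (2 * pi * (real n + r) * (Im z - y / 2) / real h))"
      unfolding norm_t z1_def using assms(2) by (simp add: mult.assoc flip: exp_add) (simp add: field_simps)
    also have "\<dots> \<le> K * exp (- (2 * pi * (real n + r) * (Im z - y / 2) / real h))"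
      by (intro mult_right_mono K) simp
    also have "\<dots> \<le> K * exp (- e * Im z + real n * (- (pi * y / (2 * real h))))"
    proof -
      have "\<delta> * Im z \<le> (real n + r) * Im z" using nr z assms by (intro mult_right_mono) auto
      moreover have "real n * y \<le> (real n + r) * Im z" using nr z assms by (intro mult_mono) auto
      ultimately have "\<delta> * Im z + real n * y \<le> 2 * ((real n + r) * Im z)" by linarith
      also have "\<dots> \<le> 4 * ((real n + r) * (Im z - y / 2))"
      proof -
        have "(real n + r) * Im z \<le> (real n + r) * (2 * (Im z - y / 2))"
          using z assms by (intro mult_left_mono) auto
        moreover have "(real n + r) * (2 * (Im z - y / 2)) = 2 * ((real n + r) * (Im z - y / 2))" by simp
        ultimately show ?thesis by linarith
      qed
      finally have "pi * (\<delta> * Im z + real n * y) / (2 * real h) \<le> pi * (4 * ((real n + r) * (Im z - y / 2))) / (2 * real h)"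
        by (intro mult_left_mono divide_right_mono) auto
      moreover have "e * Im z + real n * (pi * y / (2 * real h)) = pi * (\<delta> * Im z + real n * y) / (2 * real h)"
        using assms(2) by (simp add: e_def field_simps)
      moreover have "2 * pi * (real n + r) * (Im z - y / 2) / real h = pi * (4 * ((real n + r) * (Im z - y / 2))) / (2 * real h)"
        by simp
      ultimately have "- (2 * pi * (real n + r) * (Im z - y / 2) / real h) \<le> - e * Im z + real n * (- (pi * y / (2 * real h)))"
        by (simp only: mult_minus_left mult_minus_right)
      then show ?thesis using K by simp
    qed
    also have "\<dots> = K * exp (- e * Im z) * q ^ n"
      by (simp only: exp_add q_def exp_of_nat_mult mult.assoc)
    finally show ?thesis .
  qed
  have "cmod (F z) \<le> K / (1 - q) * exp (- e * Im z)" if z: "y \<le> Im z" for z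
  proof -
    have s1: "(\<lambda>n. K * exp (- e * Im z) * q ^ n) sums (K * exp (- e * Im z) * (1 / (1 - q)))"
      using q by (intro sums_mult geometric_sums) auto
    have s2: "(\<lambda>n. t n z) sums F z" using sums[of z] assms z by simp
    have "cmod (F z) \<le> K * exp (- e * Im z) * (1 / (1 - q))"
      by (rule norm_sums_le[OF s2 s1]) (rule bound[OF z])
    then show ?thesis by (simp add: mult_ac)
  qed
  moreover have "e > 0" using \<delta> assms by (simp add: e_def)
  ultimately show ?thesis by blast
qed

text \<open>Half of the exponential rate is spent on absorbing the power of Im z contained in
  \<open>hnorm\<close>.\<close>

lemma decay_of_vanishes:
  assumes "vanishes_at_cusps k f"
  shows "cusp_decay k f"
  unfolding cusp_decay_def
proof (intro allI impI)
  fix a b c d :: int and y :: real assume det: "a * d - b * c = 1" and y: "y > 0"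
  define F where "F = slash k (mat2 (of_int a) (of_int b) (of_int c) (of_int d)) (\<lambda>z. csqrt (of_int c * z + of_int d)) f"
  obtain h r u where "h > 0" "0 \<le> r" "r = 0 \<longrightarrow> u 0 = 0" "has_fourier_expansion h r F u"
    using assms det unfolding vanishes_at_cusps_def F_def by blast
  then obtain C e where e: "e > 0" and C: "\<And>z. y \<le> Im z \<Longrightarrow> cmod (F z) \<le> C * exp (- e * Im z)"
    using fourier_expansion_decay[of h r F u y] y by blast
  define p where "p = real k / 2 + 1 / 4"
  have p: "p > 0" by (simp add: p_def)
  have "hnorm k f (mob a b c d z) \<le> (C * (p / (e / 2)) powr p) * exp (- (e / 2) * Im z)" if z: "y \<le> Im z" for z
  proof -
    have C0: "C * exp (- e * Im z) \<ge> 0" using C[OF z] norm_ge_zero order_trans by blast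
    have "hnorm k f (mob a b c d z) = cmod (F z) * Im z powr p"
      using hnorm_csqrt_slash[OF det, of z k f] z y by (simp add: F_def hnorm_def p_def)
    also have "\<dots> \<le> C * exp (- e * Im z) * ((p / (e / 2)) powr p * exp ((e / 2) * Im z))"
      using C[OF z] C0 e p y z by (intro mult_mono powr_le_exp) auto
    also have "\<dots> = (C * (p / (e / 2)) powr p) * (exp (- e * Im z) * exp ((e / 2) * Im z))"
      by (simp only: mult_ac)
    also have "exp (- e * Im z) * exp ((e / 2) * Im z) = exp (- (e / 2) * Im z)"
      by (simp flip: exp_add)
    finally show ?thesis .
  qed
  then show "\<exists>C e. e > 0 \<and> (\<forall>z. y \<le> Im z \<longrightarrow> hnorm k f (mob a b c d z) \<le> C * exp (- e * Im z))"
    using e by (intro exI[of _ "C * (p / (e / 2)) powr p"] exI[of _ "e / 2"]) auto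
qed

text \<open>The function of $q = e^{2\pi i z/h}$ given by a function of period \<open>h\<close>. The value at $q = 0$ is the
  right one for functions that decay at the cusp.\<close>

definition qfun :: "nat \<Rightarrow> (complex \<Rightarrow> complex) \<Rightarrow> complex \<Rightarrow> complex" where
  "qfun h F q = (if q = 0 then 0 else F (of_nat h * Ln q / (2 * of_real pi * \<i>)))"

lemma Im_qfun_arg: "Im (of_nat h * w / (2 * of_real pi * \<i>)) = - (real h * Re w / (2 * pi))"
proof -
  have "of_nat h * w / (2 * of_real pi * \<i>) = - \<i> * (of_nat h * w / of_real (2 * pi))"
    by (simp add: field_simps)
  also have "Im \<dots> = - (real h * Re w / (2 * pi))" by (simp only: Im_divide_of_real Re_divide_of_real mult.commute) simp
  finally show ?thesis .
qed

text \<open>The logarithm recovers z up to an integral multiple of h, which the period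
  absorbs.\<close>

lemma qfun_exp:
  assumes "h > 0" "\<And>z. Im z > 0 \<Longrightarrow> F (z + of_nat h) = F z" "Im z > 0"
  shows "qfun h F (exp (2 * of_real pi * \<i> * z / of_nat h)) = F z"
proof -
  have pern: "F (z + of_nat n * of_nat h) = F z" if "Im z > 0" for z n
    using assms(2)[of "z + of_nat n' * of_nat h" for n'] that
    by (induction n) (simp_all add: algebra_simps)
  have peri: "F (z + of_int n * of_nat h) = F z" for n
  proof (cases "n \<ge> 0")
    case True
    then show ?thesis using pern[OF assms(3), of "nat n"] by simp
  next
    case False
    then show ?thesis using pern[of "z + of_int n * of_nat h" "nat (- n)"] assms(3) by simp
  qed
  define w where "w = 2 * of_real pi * \<i> * z / of_nat h"
  have "exp (Ln (exp w)) = exp w" by simp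
  then obtain n :: int where "Ln (exp w) = w + of_real (of_int (2 * n) * pi) * \<i>" unfolding exp_eq by blast
  then have "of_nat h * Ln (exp w) / (2 * of_real pi * \<i>) = z + of_int n * of_nat h"
    using assms(1) by (simp add: w_def field_simps)
  then show ?thesis using peri by (simp add: qfun_def w_def)
qed

text \<open>Two branches of the logarithm, cut along the negative and along the positive half-axis,
  give holomorphy on two slit discs that cover the punctured disc. The decay of F becomes a positive
  power of |q|, so the singularity at 0 is removable with value 0.\<close>

lemma qfun_holomorphic:
  assumes h: "h > 0" and F: "F holomorphic_on uhp" and per: "\<And>z. Im z > 0 \<Longrightarrow> F (z + of_nat h) = F z"
    and e: "e > 0" and C: "\<And>z. 1 \<le> Im z \<Longrightarrow> cmod (F z) \<le> C * exp (- e * Im z)"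
  shows "qfun h F holomorphic_on ball 0 1"
proof -
  define L where "L q = of_nat h * Ln q / (2 * of_real pi * \<i>)" for q
  define L2 where "L2 q = of_nat h * (Ln (- q) + of_real pi * \<i>) / (2 * of_real pi * \<i>)" for q
  have ImL: "Im (L q) = - (real h * ln (cmod q) / (2 * pi))" if "q \<noteq> 0" for q
    using that unfolding L_def Im_qfun_arg by (simp add: Re_Ln)
  have ImL2: "Im (L2 q) = - (real h * ln (cmod q) / (2 * pi))" if "q \<noteq> 0" for q
    using that unfolding L2_def Im_qfun_arg by (simp add: Re_Ln)
  have pos: "- (real h * ln (cmod q) / (2 * pi)) > 0" if "q \<noteq> 0" "cmod q < 1" for q
    using that h by (simp add: mult_less_0_iff divide_less_0_iff)
  have q2: "qfun h F q = F (L2 q)" if "q \<noteq> 0" "cmod q < 1" for q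
  proof -
    have "2 * of_real pi * \<i> * L2 q / of_nat h = Ln (- q) + of_real pi * \<i>" using h by (simp add: L2_def)
    then have "exp (2 * of_real pi * \<i> * L2 q / of_nat h) = q" using that by (simp add: exp_add)
    then show ?thesis using qfun_exp[of h F "L2 q"] h per pos that ImL2 by simp
  qed
  have "qfun h F holomorphic_on (ball 0 1 - \<real>\<^sub>\<le>\<^sub>0)"
  proof -
    have "F \<circ> L holomorphic_on (ball 0 1 - \<real>\<^sub>\<le>\<^sub>0)"
    proof (rule holomorphic_on_compose_gen[OF _ F])
      show "L holomorphic_on ball 0 1 - \<real>\<^sub>\<le>\<^sub>0"
        unfolding L_def by (intro holomorphic_intros) auto
      show "L ` (ball 0 1 - \<real>\<^sub>\<le>\<^sub>0) \<subseteq> uhp"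
      proof safe
        fix q :: complex assume "q \<in> ball 0 1" "q \<notin> \<real>\<^sub>\<le>\<^sub>0"
        then show "L q \<in> uhp" using ImL[of q] pos[of q] by (cases "q = 0") auto
      qed
    qed
    then show ?thesis
      by (rule holomorphic_transform) (auto simp: qfun_def L_def)
  qed
  moreover have "qfun h F holomorphic_on (ball 0 1 - \<real>\<^sub>\<ge>\<^sub>0)"
  proof -
    have "F \<circ> L2 holomorphic_on (ball 0 1 - \<real>\<^sub>\<ge>\<^sub>0)"
    proof (rule holomorphic_on_compose_gen[OF _ F])
      show "L2 holomorphic_on ball 0 1 - \<real>\<^sub>\<ge>\<^sub>0"
        unfolding L2_def by (intro holomorphic_intros) auto
      show "L2 ` (ball 0 1 - \<real>\<^sub>\<ge>\<^sub>0) \<subseteq> uhp"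
      proof safe
        fix q :: complex assume "q \<in> ball 0 1" "q \<notin> \<real>\<^sub>\<ge>\<^sub>0"
        then show "L2 q \<in> uhp" using ImL2[of q] pos[of q] by (cases "q = 0") auto
      qed
    qed
    then show ?thesis
    proof (rule holomorphic_transform)
      show "(F \<circ> L2) q = qfun h F q" if "q \<in> ball 0 1 - \<real>\<^sub>\<ge>\<^sub>0" for q
        using q2[of q] that by (cases "q = 0") auto
    qed
  qed
  ultimately have "qfun h F holomorphic_on ((ball 0 1 - \<real>\<^sub>\<le>\<^sub>0) \<union> (ball 0 1 - \<real>\<^sub>\<ge>\<^sub>0))"
    by (intro holomorphic_on_Un open_Diff closed_nonpos_Reals_complex closed_nonneg_Reals_complex open_ball)
  moreover have "(ball 0 1 - \<real>\<^sub>\<le>\<^sub>0) \<union> (ball 0 1 - \<real>\<^sub>\<ge>\<^sub>0) = ball 0 1 - {0 :: complex}"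
    by (auto simp: complex_nonpos_Reals_iff complex_nonneg_Reals_iff complex_eq_iff)
  ultimately have hol: "qfun h F holomorphic_on (ball 0 1 - {0})" by simp
  have "(qfun h F \<longlongrightarrow> 0) (at 0)"
  proof (rule Lim_null_comparison)
    define R where "R = exp (- (2 * pi / real h))"
    have "R > 0" by (simp add: R_def)
    have "cmod (qfun h F q) \<le> C * cmod q powr (e * real h / (2 * pi))" if "q \<noteq> 0" "dist q 0 < R" for q
    proof -
      have "ln (cmod q) < ln R" using that by (subst ln_less_cancel_iff) (auto simp: R_def)
      then have "- (real h * ln (cmod q) / (2 * pi)) \<ge> 1" using h by (simp add: R_def field_simps)
      then have "cmod (F (L q)) \<le> C * exp (- e * Im (L q))" using C[of "L q"] ImL[OF that(1)] by simp
      also have "exp (- e * Im (L q)) = cmod q powr (e * real h / (2 * pi))"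
        using that by (simp add: ImL powr_def)
      finally show ?thesis using that by (simp add: qfun_def L_def)
    qed
    then show "\<forall>\<^sub>F q in at 0. cmod (qfun h F q) \<le> C * cmod q powr (e * real h / (2 * pi))"
      unfolding eventually_at using \<open>R > 0\<close> by blast
    have "((\<lambda>q :: complex. cmod q powr (e * real h / (2 * pi))) \<longlongrightarrow> 0) (at 0)"
    proof (rule tendsto_zero_powrI)
      show "((\<lambda>q :: complex. cmod q) \<longlongrightarrow> 0) (at 0)" by (intro tendsto_norm_zero tendsto_ident_at)
      show "0 < e * real h / (2 * pi)" using e h by simp
    qed auto
    then show "((\<lambda>q :: complex. C * cmod q powr (e * real h / (2 * pi))) \<longlongrightarrow> 0) (at 0)"
      by (rule tendsto_mult_right_zero)
  qed
  then have "isCont (qfun h F) 0" by (simp add: isCont_def qfun_def)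
  moreover have "isCont (qfun h F) q" if "q \<in> ball 0 1 - {0}" for q
    using holomorphic_on_imp_continuous_on[OF hol] that
    by (auto simp: continuous_on_eq_continuous_at open_Diff)
  ultimately have "continuous_on (ball 0 1) (qfun h F)"
    by (intro continuous_at_imp_continuous_on ballI) (metis DiffI singletonD)
  then show ?thesis by (rule no_isolated_singularity[OF _ hol]) auto
qed

lemma qfun_fourier_expansion:
  assumes h: "h > 0" and F: "F holomorphic_on uhp" and per: "\<And>z. Im z > 0 \<Longrightarrow> F (z + of_nat h) = F z"
    and e: "e > 0" and C: "\<And>z. 1 \<le> Im z \<Longrightarrow> cmod (F z) \<le> C * exp (- e * Im z)"
  shows "has_fourier_expansion h 0 F (\<lambda>n. (deriv ^^ n) (qfun h F) 0 / fact n)"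
  unfolding has_fourier_expansion_def
proof
  fix z assume "z \<in> uhp"
  then have z: "Im z > 0" by simp
  define q where "q = exp (2 * of_real pi * \<i> * z / of_nat h)"
  have "cmod q < 1"
    using norm_exp_fourier[of 1 z h] z h by (simp add: q_def)
  then have "(\<lambda>n. (deriv ^^ n) (qfun h F) 0 / fact n * (q - 0) ^ n) sums qfun h F q"
    by (intro holomorphic_power_series[OF qfun_holomorphic[OF assms]]) auto
  moreover have "qfun h F q = F z" unfolding q_def using qfun_exp[of h F z] h per z by blast
  moreover have "q ^ n = exp (2 * of_real pi * \<i> * of_real (real n + 0) * z / of_nat h)" for n
    unfolding q_def exp_of_nat_mult[symmetric] by (simp add: mult_ac)
  ultimately show "(\<lambda>n. (deriv ^^ n) (qfun h F) 0 / fact n * exp (2 * of_real pi * \<i> * of_real (real n + 0) * z / of_nat h)) sums F z"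
    by simp
qed


section \<open>Periodicity at the cusps and the analytic description of cusp forms\<close>

lemma holomorphic_csqrt_linear: "(\<lambda>z. csqrt (of_int c * z + of_int d)) holomorphic_on uhp"
proof (cases "c = 0")
  case False
  then show ?thesis
    by (intro holomorphic_intros) (auto simp: complex_nonpos_Reals_iff)
qed simp

lemma holomorphic_mob: "coprime c d \<Longrightarrow> mob a b c d holomorphic_on uhp"
  unfolding mob_def using uhp_denom_nonzero_int by (intro holomorphic_intros) auto

lemma connected_uhp: "connected uhp"
  unfolding uhp_def by (intro convex_connected convex_halfspace_Im_gt)

text \<open>The stabiliser of a cusp acts on the expansion there through a root of unity, whose fourth
  power is $1$.\<close>

lemma slash_periodic:
  assumes inv: "theta_inv k N f" and N: "4 dvd N" "N > 0" and det: "a * d - b * c = 1" and z: "Im z > 0"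
  defines "F \<equiv> slash k (mat2 (of_int a) (of_int b) (of_int c) (of_int d)) (\<lambda>z. csqrt (of_int c * z + of_int d)) f"
  shows "F (z + of_nat (4 * N)) = F z"
proof -
  define n where "n = int N"
  \<comment> \<open>The entries of the translation by N conjugated by the matrix with entries a, b,
    c, d; the lower left one is divisible by N.\<close>
  define a' b' c' d' where "a' = 1 - a * c * n" and "b' = a\<^sup>2 * n" and "c' = - c\<^sup>2 * n" and "d' = 1 + a * c * n"
  have det': "a' * d' - b' * c' = 1"
    by (simp add: a'_def b'_def c'_def d'_def power2_eq_square algebra_simps)
  have "4 dvd n" using N(1) unfolding n_def by (metis int_dvd_int_iff of_nat_numeral)
  then have c': "int N dvd c'" "4 dvd c'" by (simp_all add: c'_def n_def)
  have entries: "a' * a + b' * c = a" "a' * b + b' * d = b + a * n" "c' * a + d' * c = c" "c' * b + d' * d = d + c * n"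
  proof -
    have "a' * b + b' * d = b + a * n * (a * d - b * c)"
      by (simp add: a'_def b'_def power2_eq_square algebra_simps)
    then show "a' * b + b' * d = b + a * n" using det by simp
    have "c' * b + d' * d = d + c * n * (a * d - b * c)"
      by (simp add: c'_def d'_def power2_eq_square algebra_simps)
    then show "c' * b + d' * d = d + c * n" using det by simp
  qed (simp_all add: a'_def b'_def c'_def d'_def power2_eq_square algebra_simps)
  define J where "J z = of_int c * z + of_int d" for z :: complex
  have J0: "J z \<noteq> 0" if "Im z > 0" for z
    using uhp_denom_nonzero_int[OF that coprime_det[OF det]] by (simp add: J_def)
  have shift: "mob a' b' c' d' (mob a b c d z) = mob a b c d (z + of_int n)" if "Im z > 0" for z
    unfolding mob_mult[OF det that] entries by (simp add: mob_def algebra_simps)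
  have cocyc: "(of_int c' * mob a b c d z + of_int d') * J z = J (z + of_int n)" if "Im z > 0" for z
  proof -
    have "(of_int c' * mob a b c d z + of_int d') * J z = of_int c' * (mob a b c d z * J z) + of_int d' * J z"
      by (simp add: algebra_simps)
    also have "mob a b c d z * J z = of_int a * z + of_int b"
      using J0[OF that] by (simp add: mob_def J_def)
    also have "of_int c' * (of_int a * z + of_int b) + of_int d' * J z
      = of_int (c' * a + d' * c) * z + of_int (c' * b + d' * d)"
      by (simp add: J_def algebra_simps)
    finally show ?thesis unfolding entries by (simp add: J_def algebra_simps)
  qed
  \<comment> \<open>The multiplier with which translation by N acts on F, before it is raised to the
    power 2k + 1.\<close>
  define \<rho> where "\<rho> z = theta_factor c' d' (mob a b c d z) * csqrt (J z) / csqrt (J (z + of_int n))" for z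
  have csq4: "csqrt w ^ 4 = w\<^sup>2" for w :: complex
    by (metis power2_csqrt power_mult mult_2 numeral_Bit0 power2_eq_square power_add)
  have rho4: "\<rho> z ^ 4 = 1" if "Im z > 0" for z
  proof -
    have "\<rho> z ^ 4 = (of_int c' * mob a b c d z + of_int d')\<^sup>2 * (J z)\<^sup>2 / (J (z + of_int n))\<^sup>2"
      unfolding \<rho>_def power_divide power_mult_distrib csq4 theta_factor_square(1)[OF c'(2) coprime_det[OF det']] ..
    also have "\<dots> = 1"
      unfolding power_mult_distrib[symmetric] cocyc[OF that] using J0[of "z + of_int n"] that by simp
    finally show ?thesis .
  qed
  have step: "F (z + of_int n) = \<rho> z ^ (2 * k + 1) * F z" if "Im z > 0" for z
  proof -
    define X where "X = csqrt (J z) ^ (2 * k + 1)"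
    have X: "X \<noteq> 0" using J0[OF that] by (simp add: X_def)
    have "f (mob a b c d (z + of_int n)) = theta_factor c' d' (mob a b c d z) ^ (2 * k + 1) * f (mob a b c d z)"
      unfolding shift[OF that, symmetric] by (rule theta_invD[OF inv det' c'(1) mob_uhp[OF det that]])
    then show ?thesis
      using that X unfolding F_def slash_apply moebius_int J_def[symmetric] \<rho>_def power_mult_distrib power_divide X_def[symmetric]
      by (simp add: divide_inverse)
  qed
  have "continuous_on uhp \<rho>"
  proof -
    have th: "continuous_on uhp (theta_factor c' d')"
      unfolding theta_factor_def
      by (intro continuous_intros holomorphic_on_imp_continuous_on[OF holomorphic_csqrt_linear])
    have "continuous_on uhp (\<lambda>z. theta_factor c' d' (mob a b c d z))"
      by (rule continuous_on_compose2[OF th holomorphic_on_imp_continuous_on[OF holomorphic_mob[OF coprime_det[OF det]]]])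
         (use mob_uhp[OF det] in auto)
    moreover have "continuous_on uhp (\<lambda>z. csqrt (J z))"
      unfolding J_def by (rule holomorphic_on_imp_continuous_on[OF holomorphic_csqrt_linear])
    moreover have "continuous_on uhp (\<lambda>z. csqrt (J (z + of_int n)))"
    proof -
      have e: "J (z + of_int n) = of_int c * z + of_int (d + c * n)" for z by (simp add: J_def algebra_simps)
      show ?thesis unfolding e by (rule holomorphic_on_imp_continuous_on[OF holomorphic_csqrt_linear])
    qed
    ultimately show ?thesis unfolding \<rho>_def using J0 by (intro continuous_intros) auto
  qed
  \<comment> \<open>A continuous function on a connected set whose values are fourth roots of unity
    is constant. Hence four successive translations by N multiply F by the fourth power of one
    constant, which is 1: this is the origin of the period 4N.\<close>
  moreover have "finite (\<rho> ` uhp)"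
    by (rule finite_subset[of _ "{w. w ^ 4 = 1}"]) (use rho4 in \<open>auto intro!: finite_roots_unity\<close>)
  ultimately have "\<rho> constant_on uhp"
    by (intro continuous_finite_range_constant connected_uhp) auto
  then obtain r where r: "\<And>z. Im z > 0 \<Longrightarrow> \<rho> z = r" by (auto simp: constant_on_def)
  have r4: "r ^ 4 = 1" using rho4[OF z] r[OF z] by simp
  define R where "R = r ^ (2 * k + 1)"
  have R4: "R * (R * (R * R)) = 1"
  proof -
    have "R * (R * (R * R)) = R ^ 4" by (simp add: power4_eq_xxxx mult.assoc)
    also have "\<dots> = (r ^ 4) ^ (2 * k + 1)" unfolding R_def by (simp only: power_mult[symmetric] mult.commute)
    finally show ?thesis using r4 by simp
  qed
  have step': "F (w + of_int n) = R * F w" if "Im w > 0" for w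
    using step[OF that] r[OF that] by (simp add: R_def)
  have "z + of_nat (4 * N) = z + of_int n + of_int n + of_int n + of_int n" by (simp add: n_def)
  then have "F (z + of_nat (4 * N)) = R * (R * (R * (R * F z)))"
    using z by (simp only: step' plus_complex.sel complex_Im_of_int add_0_right)
  also have "\<dots> = (R * (R * (R * R))) * F z" by (simp only: mult.assoc)
  finally show ?thesis unfolding R4 by simp
qed

lemma holomorphic_slash:
  assumes "f holomorphic_on uhp" "a * d - b * c = 1"
  shows "slash k (mat2 (of_int a) (of_int b) (of_int c) (of_int d)) (\<lambda>z. csqrt (of_int c * z + of_int d)) f holomorphic_on uhp"
proof -
  have "(f \<circ> mob a b c d) holomorphic_on uhp"
    by (rule holomorphic_on_compose_gen[OF holomorphic_mob[OF coprime_det[OF assms(2)]] assms(1)])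
       (use mob_uhp[OF assms(2)] in auto)
  then have "(\<lambda>z. f (mob a b c d z)) holomorphic_on uhp" by (simp add: o_def)
  then have "(\<lambda>z. f (mob a b c d z) * inverse (csqrt (of_int c * z + of_int d) ^ (2 * k + 1))) holomorphic_on uhp"
    using uhp_denom_nonzero_int[OF _ coprime_det[OF assms(2)]]
    by (intro holomorphic_on_mult holomorphic_on_inverse holomorphic_on_power holomorphic_csqrt_linear) auto
  then show ?thesis
    by (rule holomorphic_transform) (auto simp: slash_apply moebius_int)
qed

lemma slash_bound_of_decay:
  assumes "cusp_decay k f" "a * d - b * c = 1"
  shows "\<exists>C e. e > 0 \<and> (\<forall>z. 1 \<le> Im z \<longrightarrow> cmod (slash k (mat2 (of_int a) (of_int b) (of_int c) (of_int d)) (\<lambda>z. csqrt (of_int c * z + of_int d)) f z) \<le> C * exp (- e * Im z))"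
proof -
  obtain C e where e: "e > 0" and C: "\<And>z. 1 \<le> Im z \<Longrightarrow> hnorm k f (mob a b c d z) \<le> C * exp (- e * Im z)"
    using assms unfolding cusp_decay_def by (metis zero_less_one)
  let ?F = "slash k (mat2 (of_int a) (of_int b) (of_int c) (of_int d)) (\<lambda>z. csqrt (of_int c * z + of_int d)) f"
  have "cmod (?F z) \<le> C * exp (- e * Im z)" if z: "1 \<le> Im z" for z
  proof -
    have "cmod (?F z) * 1 \<le> hnorm k ?F z"
      unfolding hnorm_def using z by (intro mult_left_mono ge_one_powr_ge_zero) auto
    also have "\<dots> = hnorm k f (mob a b c d z)"
      using hnorm_csqrt_slash[OF assms(2), of z k f] z by simp
    finally show ?thesis using C[OF z] by simp
  qed
  then show ?thesis using e by blast
qed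

text \<open>The definition admits any width and shift at each cusp. In the other direction,
  invariance and decay yield expansions of width 4N and shift 0 at all cusps, and their constant
  term is the value 0 of \<open>qfun\<close> at 0.\<close>

theorem cusp_forms_iff:
  assumes N: "4 dvd N" "N > 0"
  shows "f \<in> cusp_forms k N \<longleftrightarrow>
    f holomorphic_on uhp \<and> (\<forall>z. Im z \<le> 0 \<longrightarrow> f z = 0) \<and> theta_inv k N f \<and> cusp_decay k f"
proof
  assume "f \<in> cusp_forms k N"
  then show "f holomorphic_on uhp \<and> (\<forall>z. Im z \<le> 0 \<longrightarrow> f z = 0) \<and> theta_inv k N f \<and> cusp_decay k f"
    using slash_invariant_iff[OF N(1), of f k] decay_of_vanishes by (auto simp: cusp_forms_def)
next
  assume *: "f holomorphic_on uhp \<and> (\<forall>z. Im z \<le> 0 \<longrightarrow> f z = 0) \<and> theta_inv k N f \<and> cusp_decay k f"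
  have "vanishes_at_cusps k f"
    unfolding vanishes_at_cusps_def
  proof (intro allI impI)
    fix a b c d :: int assume det: "a * d - b * c = 1"
    let ?F = "slash k (mat2 (of_int a) (of_int b) (of_int c) (of_int d)) (\<lambda>z. csqrt (of_int c * z + of_int d)) f"
    obtain C e where e: "e > 0" and C: "\<And>z. 1 \<le> Im z \<Longrightarrow> cmod (?F z) \<le> C * exp (- e * Im z)"
      using slash_bound_of_decay[OF _ det] * by blast
    have "has_fourier_expansion (4 * N) 0 ?F (\<lambda>n. (deriv ^^ n) (qfun (4 * N) ?F) 0 / fact n)"
    proof (rule qfun_fourier_expansion[OF _ _ _ e C])
      show "?F holomorphic_on uhp" using * det by (intro holomorphic_slash) auto
      show "?F (z + of_nat (4 * N)) = ?F z" if "Im z > 0" for z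
        using * by (intro slash_periodic[OF _ N det that]) auto
    qed (use N in auto)
    then show "\<exists>h r u. h > 0 \<and> 0 \<le> r \<and> r < 1 \<and> (r = 0 \<longrightarrow> u 0 = 0) \<and> has_fourier_expansion h r ?F u"
      using N by (intro exI[of _ "4 * N"] exI[of _ 0] exI[of _ "\<lambda>n. (deriv ^^ n) (qfun (4 * N) ?F) 0 / fact n"])
                 (simp add: qfun_def)
  qed
  then show "f \<in> cusp_forms k N"
    using slash_invariant_iff[OF N(1), of f k] * by (auto simp: cusp_forms_def)
qed

section \<open>Linear operations, rational substitutions and the Fricke slash\<close>

lemma theta_inv_add: "theta_inv k N f \<Longrightarrow> theta_inv k N g \<Longrightarrow> theta_inv k N (\<lambda>z. f z + g z)"
  by (simp add: theta_inv_def algebra_simps)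

lemma theta_inv_scale: "theta_inv k N f \<Longrightarrow> theta_inv k N (\<lambda>z. x * f z)"
  by (simp add: theta_inv_def)

lemma theta_inv_mono: "theta_inv k N f \<Longrightarrow> N dvd M \<Longrightarrow> theta_inv k M f"
  unfolding theta_inv_def by (meson dvd_trans int_dvd_int_iff)

lemma hnorm_add: "hnorm k (\<lambda>z. f z + g z) z \<le> hnorm k f z + hnorm k g z"
  unfolding hnorm_def by (simp add: norm_triangle_ineq mult_right_mono flip: distrib_right)

lemma hnorm_scale: "hnorm k (\<lambda>z. x * f z) z = cmod x * hnorm k f z"
  by (simp add: hnorm_def norm_mult)

lemma cusp_decay_add:
  assumes "cusp_decay k f" "cusp_decay k g"
  shows "cusp_decay k (\<lambda>z. f z + g z)"
  unfolding cusp_decay_def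
proof (intro allI impI)
  fix a b c d :: int and y :: real assume *: "a * d - b * c = 1" "y > 0"
  obtain C e where e: "e > 0" and C: "\<And>z. y \<le> Im z \<Longrightarrow> hnorm k f (mob a b c d z) \<le> C * exp (- e * Im z)"
    using assms(1) * unfolding cusp_decay_def by meson
  obtain C' e' where e': "e' > 0" and C': "\<And>z. y \<le> Im z \<Longrightarrow> hnorm k g (mob a b c d z) \<le> C' * exp (- e' * Im z)"
    using assms(2) * unfolding cusp_decay_def by meson
  have *: "X * exp (- x * Im z) \<le> \<bar>X\<bar> * exp (- min e e' * Im z)" if "x = e \<or> x = e'" "y \<le> Im z" for X x z
  proof -
    have "X * exp (- x * Im z) \<le> \<bar>X\<bar> * exp (- x * Im z)" by (intro mult_right_mono) auto
    also have "\<dots> \<le> \<bar>X\<bar> * exp (- min e e' * Im z)"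
      using that \<open>y > 0\<close> by (intro mult_left_mono) (auto intro!: mult_right_mono)
    finally show ?thesis .
  qed
  have "hnorm k (\<lambda>z. f z + g z) (mob a b c d z) \<le> (\<bar>C\<bar> + \<bar>C'\<bar>) * exp (- min e e' * Im z)" if z: "y \<le> Im z" for z
    using hnorm_add[of k f g "mob a b c d z"] C[OF z] C'[OF z] *[of e z C] *[of e' z C'] z
    unfolding distrib_right by linarith
  then show "\<exists>C e. e > 0 \<and> (\<forall>z. y \<le> Im z \<longrightarrow> hnorm k (\<lambda>z. f z + g z) (mob a b c d z) \<le> C * exp (- e * Im z))"
    using e e' by (intro exI[of _ "\<bar>C\<bar> + \<bar>C'\<bar>"] exI[of _ "min e e'"]) auto
qed

lemma cusp_decay_scale:
  assumes "cusp_decay k f"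
  shows "cusp_decay k (\<lambda>z. x * f z)"
  unfolding cusp_decay_def
proof (intro allI impI)
  fix a b c d :: int and y :: real assume *: "a * d - b * c = 1" "y > 0"
  obtain C e where e: "e > 0" and C: "\<And>z. y \<le> Im z \<Longrightarrow> hnorm k f (mob a b c d z) \<le> C * exp (- e * Im z)"
    using assms(1) * unfolding cusp_decay_def by meson
  have "hnorm k (\<lambda>z. x * f z) (mob a b c d z) \<le> (cmod x * C) * exp (- e * Im z)" if z: "y \<le> Im z" for z
    unfolding hnorm_scale mult.assoc by (intro mult_left_mono C z) simp
  then show "\<exists>C e. e > 0 \<and> (\<forall>z. y \<le> Im z \<longrightarrow> hnorm k (\<lambda>z. x * f z) (mob a b c d z) \<le> C * exp (- e * Im z))"
    using e by blast
qed

text \<open>An integral matrix of positive determinant is a matrix in SL2(Z) times an upper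
  triangular one with rows (u, v) and (0, w). Decay of g at a cusp is therefore decay of f at
  another cusp, with heights rescaled by u/w.\<close>

lemma cusp_decay_rational:
  assumes f: "cusp_decay k f" and det: "p * s - q * r > 0"
    and g: "\<And>z. Im z > 0 \<Longrightarrow> hnorm k g z = hnorm k f (mob p q r s z)"
  shows "cusp_decay k g"
  unfolding cusp_decay_def
proof (intro allI impI)
  fix a b c d :: int and y :: real assume ad: "a * d - b * c = 1" and y: "y > 0"
  define P Q R S where "P = p*a + q*c" and "Q = p*b + q*d" and "R = r*a + s*c" and "S = r*b + s*d"
  have PS: "P * S - Q * R > 0"
  proof -
    have "P * S - Q * R = (p * s - q * r) * (a * d - b * c)"
      by (simp add: P_def Q_def R_def S_def algebra_simps)
    then show ?thesis using det ad by simp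
  qed
  \<comment> \<open>The first column divided by its gcd is completed to a matrix in SL2(Z); v and w
    are then determined by the second column.\<close>
  define u where "u = gcd P R"
  have "P \<noteq> 0 \<or> R \<noteq> 0" using PS by auto
  then have u: "u > 0" by (simp add: u_def gcd_pos_int)
  obtain a' c' where ac: "P = u * a'" "R = u * c'" unfolding u_def by (meson dvdE gcd_dvd1 gcd_dvd2)
  have "coprime a' c'"
  proof -
    have "u * gcd a' c' = u * 1" using ac u unfolding u_def by (metis abs_of_pos gcd_mult_distrib_int mult.right_neutral)
    then show ?thesis using u by (simp add: coprime_iff_gcd_eq_1)
  qed
  then obtain d' b' where bd: "a' * d' - b' * c' = 1"
  proof -
    obtain x y where "x * a' + y * c' = 1" using bezout_int[of a' c'] \<open>coprime a' c'\<close> by auto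
    then show ?thesis using that[of x "- y"] by (simp add: algebra_simps)
  qed
  define v w where "v = d' * Q - b' * S" and "w = a' * S - c' * Q"
  have uw: "u * w = P * S - Q * R" by (simp add: w_def ac algebra_simps)
  then have w: "w > 0" using PS u by (metis zero_less_mult_pos)
  have Q: "a' * v + b' * w = Q" and S: "c' * v + d' * w = S"
  proof -
    have "a' * v + b' * w = (a' * d' - b' * c') * Q" by (simp add: v_def w_def algebra_simps)
    then show "a' * v + b' * w = Q" using bd by simp
    have "c' * v + d' * w = (a' * d' - b' * c') * S" by (simp add: v_def w_def algebra_simps)
    then show "c' * v + d' * w = S" using bd by simp
  qed
  have dec: "mob P Q R S z = mob a' b' c' d' ((of_int u * z + of_int v) / of_int w)" for z
  proof -
    define t where "t = (of_int u * z + of_int v) / (of_int w :: complex)"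
    have t: "t * of_int w = of_int u * z + of_int v" using w by (simp add: t_def)
    have "mob a' b' c' d' t = ((of_int a' * t + of_int b') * of_int w) / ((of_int c' * t + of_int d') * of_int w)"
      using w by (simp add: mob_def)
    also have "(of_int a' * t + of_int b') * of_int w = of_int a' * (t * of_int w) + of_int b' * of_int w"
      by (simp add: algebra_simps)
    also have "\<dots> = of_int P * z + of_int Q"
      unfolding t by (simp add: Q[symmetric] ac algebra_simps)
    also have "(of_int c' * t + of_int d') * of_int w = of_int c' * (t * of_int w) + of_int d' * of_int w"
      by (simp add: algebra_simps)
    also have "\<dots> = of_int R * z + of_int S"
      unfolding t by (simp add: S[symmetric] ac algebra_simps)
    finally show ?thesis by (simp add: t_def mob_def)
  qed
  have im: "Im ((of_int u * z + of_int v) / of_int w) = of_int u / of_int w * Im z" for z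
    using Im_divide_of_real[of "of_int u * z + of_int v" "real_of_int w"] by simp
  have uwp: "real_of_int u / real_of_int w > 0" using u w by simp
  obtain C e where e: "e > 0" and C: "\<And>z. of_int u / of_int w * y \<le> Im z \<Longrightarrow> hnorm k f (mob a' b' c' d' z) \<le> C * exp (- e * Im z)"
    using f bd y mult_pos_pos[OF uwp y] unfolding cusp_decay_def by meson
  have "hnorm k g (mob a b c d z) \<le> C * exp (- (e * (of_int u / of_int w)) * Im z)" if z: "y \<le> Im z" for z
  proof -
    have z0: "Im z > 0" using y z by simp
    have "hnorm k g (mob a b c d z) = hnorm k f (mob P Q R S z)"
      using g[OF mob_uhp[OF ad z0]] mob_mult[OF ad z0] by (simp add: P_def Q_def R_def S_def)
    also have "\<dots> \<le> C * exp (- e * Im ((of_int u * z + of_int v) / of_int w))"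
      unfolding dec by (rule C) (use z uwp in \<open>simp only: im mult_left_mono less_imp_le\<close>)
    finally show ?thesis by (simp add: im mult.assoc)
  qed
  moreover have "e * (of_int u / of_int w) > 0" using e uwp by (rule mult_pos_pos)
  ultimately show "\<exists>C e. e > 0 \<and> (\<forall>z. y \<le> Im z \<longrightarrow> hnorm k g (mob a b c d z) \<le> C * exp (- e * Im z))"
    by blast
qed

text \<open>The slash by the matrix with rows (0, -1) and (4t^2, 0) and the normalised factor
  (2tz)^(1/2). Level 4 is t = 1, level 16 is t = 2.\<close>

definition fricke :: "nat \<Rightarrow> nat \<Rightarrow> (complex \<Rightarrow> complex) \<Rightarrow> complex \<Rightarrow> complex" where
  "fricke k t f z = (if Im z > 0 then f (- 1 / (of_nat (4 * t\<^sup>2) * z)) * inverse (csqrt (of_nat (2 * t) * z) ^ (2 * k + 1)) else 0)"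

definition half_shift :: "(complex \<Rightarrow> complex) \<Rightarrow> complex \<Rightarrow> complex" where
  "half_shift f z = f (z + 1 / 2)"

lemma csqrt_of_nat_mult: "csqrt (of_nat n * z) = of_real (sqrt (real n)) * csqrt z"
proof (rule csqrt_unique)
  show "(of_real (sqrt (real n)) * csqrt z)\<^sup>2 = of_nat n * z"
    by (simp add: power_mult_distrib flip: of_real_power)
  show "0 < Re (of_real (sqrt (real n)) * csqrt z) \<or> Re (of_real (sqrt (real n)) * csqrt z) = 0 \<and> 0 \<le> Im (of_real (sqrt (real n)) * csqrt z)"
    using csqrt_principal[of z] by (cases "n = 0") (auto simp: zero_less_mult_iff)
qed

lemma Im_fricke:
  assumes "t > 0" "Im z > 0"
  shows "Im (- 1 / (of_nat (4 * t\<^sup>2) * z)) = Im z / (cmod (of_nat (2 * t) * z))\<^sup>2"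
    and "Im (- 1 / (of_nat (4 * t\<^sup>2) * z)) > 0"
proof -
  have z: "z \<noteq> 0" using assms by auto
  have "- 1 / (of_nat (4 * t\<^sup>2) * z) = - cnj z / of_real (4 * real t ^ 2 * (cmod z)\<^sup>2)"
  proof -
    have "complex_of_real ((cmod z)\<^sup>2) = z * cnj z" by (rule complex_norm_square)
    then have "complex_of_real (4 * real t ^ 2 * (cmod z)\<^sup>2) = of_nat (4 * t\<^sup>2) * (z * cnj z)"
      by (simp only: of_real_mult) simp
    then show ?thesis using assms z by (simp only:) (simp add: divide_simps)
  qed
  then have "Im (- 1 / (of_nat (4 * t\<^sup>2) * z)) = Im z / (4 * real t ^ 2 * (cmod z)\<^sup>2)"
    by (simp only: Im_divide_of_real uminus_complex.sel cnj.sel minus_minus)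
  moreover have "(cmod (of_nat (2 * t) * z))\<^sup>2 = 4 * real t ^ 2 * (cmod z)\<^sup>2"
    by (simp add: norm_mult power_mult_distrib)
  ultimately show "Im (- 1 / (of_nat (4 * t\<^sup>2) * z)) = Im z / (cmod (of_nat (2 * t) * z))\<^sup>2" by simp
  then show "Im (- 1 / (of_nat (4 * t\<^sup>2) * z)) > 0" using assms z by simp
qed

lemma hnorm_fricke:
  assumes "t > 0" "Im z > 0"
  shows "hnorm k (fricke k t f) z = hnorm k f (- 1 / (of_nat (4 * t\<^sup>2) * z))"
proof (rule hnorm_transform[symmetric])
  let ?J = "of_nat (2 * t) * z"
  have J: "?J \<noteq> 0" using assms by auto
  define X where "X = csqrt ?J ^ (2 * k + 1)"
  have "csqrt ?J \<noteq> 0" using J csqrt_eq_0 by blast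
  then have X: "X \<noteq> 0" unfolding X_def by (rule power_not_zero)
  show "cmod ?J > 0" using J by (rule zero_less_norm_iff[THEN iffD2])
  show "(cmod (csqrt ?J))\<^sup>2 = cmod ?J" by simp
  show "cmod (f (- 1 / (of_nat (4 * t\<^sup>2) * z))) = cmod (csqrt ?J) ^ (2 * k + 1) * cmod (fricke k t f z)"
    unfolding norm_power[symmetric] fricke_def X_def[symmetric] using X assms(2) by (simp add: norm_mult norm_inverse)
qed (use assms Im_fricke in auto)

lemma fricke_mob: "- 1 / (of_nat (4 * t\<^sup>2) * z) = mob 0 (-1) (4 * (int t)\<^sup>2) 0 z"
  by (simp add: mob_def)

lemma cusp_decay_fricke:
  assumes "t > 0" "cusp_decay k f"
  shows "cusp_decay k (fricke k t f)"
proof (rule cusp_decay_rational[OF assms(2)])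
  show "0 * 0 - (- 1) * (4 * (int t)\<^sup>2) > 0" using assms(1) by simp
  show "hnorm k (fricke k t f) z = hnorm k f (mob 0 (- 1) (4 * (int t)\<^sup>2) 0 z)" if "Im z > 0" for z
    unfolding fricke_mob[symmetric] by (rule hnorm_fricke[OF assms(1) that])
qed

lemma hnorm_half_shift: "hnorm k (half_shift f) z = hnorm k f (z + 1 / 2)"
  by (simp add: hnorm_def half_shift_def)

lemma cusp_decay_half_shift:
  assumes "cusp_decay k f"
  shows "cusp_decay k (half_shift f)"
  by (rule cusp_decay_rational[OF assms, of 2 2 1 0]) (auto simp: hnorm_half_shift mob_def add_divide_distrib)

lemma holomorphic_fricke:
  assumes "t > 0" "f holomorphic_on uhp"
  shows "fricke k t f holomorphic_on uhp"
proof -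
  have nz: "of_nat (4 * t\<^sup>2) * z \<noteq> 0" if "Im z > 0" for z :: complex using that assms by auto
  have "(f \<circ> (\<lambda>z. - 1 / (of_nat (4 * t\<^sup>2) * z))) holomorphic_on uhp"
  proof (rule holomorphic_on_compose_gen[OF _ assms(2)])
    show "(\<lambda>z. - 1 / (of_nat (4 * t\<^sup>2) * z)) holomorphic_on uhp"
      by (intro holomorphic_intros) (use nz in auto)
    show "(\<lambda>z. - 1 / (of_nat (4 * t\<^sup>2) * z)) ` uhp \<subseteq> uhp"
      using Im_fricke(2)[OF assms(1)] by auto
  qed
  then have "(\<lambda>z. f (- 1 / (of_nat (4 * t\<^sup>2) * z))) holomorphic_on uhp" by (simp add: o_def)
  moreover have "(\<lambda>z. csqrt (of_nat (2 * t) * z)) holomorphic_on uhp"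
    using holomorphic_csqrt_linear[of "2 * int t" 0] by simp
  ultimately have "(\<lambda>z. f (- 1 / (of_nat (4 * t\<^sup>2) * z)) * inverse (csqrt (of_nat (2 * t) * z) ^ (2 * k + 1))) holomorphic_on uhp"
    using assms(1) by (intro holomorphic_on_mult holomorphic_on_inverse holomorphic_on_power) auto
  then show ?thesis
    by (rule holomorphic_transform) (auto simp: fricke_def)
qed

lemma holomorphic_half_shift:
  assumes "f holomorphic_on uhp"
  shows "half_shift f holomorphic_on uhp"
proof -
  have "(f \<circ> (\<lambda>z. z + 1 / 2)) holomorphic_on uhp"
    by (rule holomorphic_on_compose_gen[OF _ assms]) (auto intro!: holomorphic_intros)
  then show ?thesis by (simp add: o_def half_shift_def[abs_def])
qed

lemma cross_multiply:
  "a * x = y * t \<Longrightarrow> x \<noteq> 0 \<Longrightarrow> y \<noteq> 0 \<Longrightarrow> a * f * inverse y = t * (f * inverse (x :: 'a :: field))"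
  by (simp add: field_simps)

text \<open>Put n = t^2. Scaling the variable by n conjugates level 4n to level 4, where
  \<open>theta_factor_fricke\<close> applies. As n is 1 or 4, passing from c to c/n does not change
  the symbol.\<close>

lemma theta_inv_fricke:
  assumes t: "t = 1 \<or> t = 2" and f: "theta_inv k (4 * t\<^sup>2) f"
  shows "theta_inv k (4 * t\<^sup>2) (fricke k t f)"
  unfolding theta_inv_def
proof (intro allI impI)
  fix a b c d z assume det: "a * d - b * c = 1" and dvd: "int (4 * t\<^sup>2) dvd c" and z: "Im z > 0"
  define n where "n = (int t)\<^sup>2"
  obtain c0 where c: "c = 4 * n * c0" using dvd by (auto simp: n_def)
  define \<gamma>z where "\<gamma>z = mob a b c d z"
  define w where "w = - 1 / (of_nat (4 * t\<^sup>2) * z)"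
  have im: "Im \<gamma>z > 0" "Im w > 0"
    using mob_uhp[OF det z] Im_fricke(2)[of t z] t z by (auto simp: \<gamma>z_def w_def)
  have t0: "t > 0" using t by auto
  have det2: "d * a - (- c0) * (- 4 * n * b) = 1" using det by (simp add: c algebra_simps)
  have detw: "0 * 0 - (- 1) * (4 * (int t)\<^sup>2) = 4 * n" by (simp add: n_def)
  have J: "of_int c * z + of_int d \<noteq> 0" using uhp_denom_nonzero_int[OF z coprime_det[OF det]] .
  have z0: "z \<noteq> 0" "\<gamma>z \<noteq> 0" using z im by auto
  have conj: "- 1 / (of_nat (4 * t\<^sup>2) * \<gamma>z) = mob d (- c0) (- 4 * n * b) a w"
  proof -
    have gz: "\<gamma>z * (of_int c * z + of_int d) = of_int a * z + of_int b" using J by (simp add: \<gamma>z_def mob_def)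
    then have az: "of_int a * z + of_int b \<noteq> 0" using z0 J by (metis mult_eq_0_iff)
    have nn: "complex_of_int n \<noteq> 0" using t0 by (simp add: n_def)
    have w': "w * (4 * of_int n * z) = - 1" using z0 nn by (simp add: w_def n_def)
    have "mob d (- c0) (- 4 * n * b) a w = ((of_int d * w - of_int c0) * (4 * of_int n * z)) / ((- 4 * of_int n * of_int b * w + of_int a) * (4 * of_int n * z))"
      using z0 nn by (simp add: mob_def)
    also have "(of_int d * w - of_int c0) * (4 * of_int n * z) = of_int d * (w * (4 * of_int n * z)) - of_int c0 * (4 * of_int n * z)"
      by (simp add: algebra_simps)
    also have "\<dots> = - (of_int c * z + of_int d)" unfolding w' by (simp add: c algebra_simps)
    also have "(- 4 * of_int n * of_int b * w + of_int a) * (4 * of_int n * z) = - 4 * of_int n * of_int b * (w * (4 * of_int n * z)) + of_int a * (4 * of_int n * z)"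
      by (simp add: algebra_simps)
    also have "\<dots> = 4 * of_int n * (of_int a * z + of_int b)" unfolding w' by (simp add: algebra_simps)
    also have "- (of_int c * z + of_int d) / (4 * of_int n * (of_int a * z + of_int b)) = - 1 / (4 * of_int n * \<gamma>z)"
      using z0 nn J az unfolding gz[symmetric] by (simp add: divide_simps)
    finally show ?thesis by (simp add: n_def)
  qed
  have dvd2: "int (4 * t\<^sup>2) dvd - 4 * n * b" by (simp add: n_def)
  have f1: "f (- 1 / (of_nat (4 * t\<^sup>2) * \<gamma>z)) = theta_factor (- 4 * n * b) a w ^ (2 * k + 1) * f w"
    unfolding conj by (rule theta_invD[OF f det2 dvd2 im(2)])
  have sc: "csqrt (of_nat (2 * t) * v) = of_real (sqrt (2 / real t)) * csqrt (of_int n * v)" for v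
  proof -
    have "csqrt (of_int n * v) = of_real (sqrt (real (t\<^sup>2))) * csqrt v"
      using csqrt_of_nat_mult[of "t\<^sup>2" v] by (simp add: n_def)
    moreover have "sqrt (real (2 * t)) = sqrt (2 / real t) * sqrt (real (t\<^sup>2))"
      unfolding real_sqrt_mult[symmetric] using t0 by (simp add: power2_eq_square)
    ultimately show ?thesis unfolding csqrt_of_nat_mult by simp
  qed
  have det3: "a * d - (n * b) * (4 * c0) = 1" using det by (simp add: c algebra_simps)
  have "odd d" using odd_of_coprime4[OF _ coprime_det[OF det]] by (simp add: c)
  then have odd': "odd (nat \<bar>d\<bar>)" by (simp add: even_nat_iff)
  have sym: "shimura_symbol (4 * c0) d = shimura_symbol c d"
    using t jacobi_four_mult[OF odd'] jacobi_four_mult[OF odd', of "4 * c0"] by (auto simp: shimura_symbol_jacobi c n_def mult_less_0_iff)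
  have th: "theta_factor (4 * c0) d (of_int n * z) = theta_factor c d z"
    unfolding theta_factor_def sym by (simp add: c mult_ac)
  have mo: "mob a (n * b) (4 * c0) d (of_int n * z) = of_int n * \<gamma>z"
    by (simp add: mob_def \<gamma>z_def c algebra_simps add_divide_distrib)
  have "Im (of_int n * z) > 0" using z t0 by (simp add: n_def)
  from theta_factor_fricke[OF det3 _ this]
  have "theta_factor (- 4 * (n * b)) a (- 1 / (4 * (of_int n * z))) * csqrt (of_int n * z) = csqrt (of_int n * \<gamma>z) * theta_factor c d z"
    unfolding mo th by simp
  moreover have "- 1 / (4 * (of_int n * z)) = w" by (simp add: w_def n_def)
  ultimately have key: "theta_factor (- 4 * n * b) a w * csqrt (of_nat (2 * t) * z) = csqrt (of_nat (2 * t) * \<gamma>z) * theta_factor c d z"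
    unfolding sc by (simp add: mult_ac)
  define A where "A = theta_factor (- 4 * n * b) a w"
  define X where "X = csqrt (of_nat (2 * t) * z)"
  define Y where "Y = csqrt (of_nat (2 * t) * \<gamma>z)"
  have XY: "X \<noteq> 0" "Y \<noteq> 0" using t0 z0 by (auto simp: X_def Y_def)
  have "fricke k t f \<gamma>z = A ^ (2 * k + 1) * f w * inverse (Y ^ (2 * k + 1))"
    using im f1 by (simp add: fricke_def A_def Y_def)
  also have "\<dots> = theta_factor c d z ^ (2 * k + 1) * (f w * inverse (X ^ (2 * k + 1)))"
  proof -
    have "(A * X) ^ (2 * k + 1) = (Y * theta_factor c d z) ^ (2 * k + 1)"
      using key by (simp only: A_def X_def Y_def)
    then have "A ^ (2 * k + 1) * X ^ (2 * k + 1) = Y ^ (2 * k + 1) * theta_factor c d z ^ (2 * k + 1)"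
      by (simp only: power_mult_distrib)
    moreover have "X ^ (2 * k + 1) \<noteq> 0" "Y ^ (2 * k + 1) \<noteq> 0" using XY by auto
    ultimately show ?thesis by (rule cross_multiply)
  qed
  also have "f w * inverse (X ^ (2 * k + 1)) = fricke k t f z"
    using z by (simp add: fricke_def w_def X_def)
  finally show "fricke k t f (mob a b c d z) = theta_factor c d z ^ (2 * k + 1) * fricke k t f z"
    by (simp add: \<gamma>z_def)
qed


text \<open>For a subgroup of index two, $f + f|\delta$ is a trace.\<close>

definition eval_at :: "nat \<Rightarrow> int \<Rightarrow> (complex \<Rightarrow> complex) \<Rightarrow> complex \<Rightarrow> complex" where
  "eval_at k c f z = inverse (theta_factor c 1 z ^ (2 * k + 1)) * f (mob 1 0 c 1 z)"

text \<open>If c/N is odd, then 2N divides c - eNd, because d and e are odd. The matrix is then one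
  of level 2N times the lower unipotent matrix with entry eN.\<close>

lemma theta_inv_index2_cases:
  assumes g: "theta_inv k (2 * N) g" and N: "4 dvd N" and e: "odd e"
    and det: "a * d - b * c = 1" and c: "int N dvd c" and z: "Im z > 0"
  shows "g (mob a b c d z) = theta_factor c d z ^ (2 * k + 1) *
    (if int (2 * N) dvd c then g z else eval_at k (e * int N) g z)"
proof (cases "int (2 * N) dvd c")
  case True
  then show ?thesis using theta_invD[OF g det _ z] by simp
next
  case False
  define n where "n = int N"
  obtain c0 where c0: "c = n * c0" using c by (auto simp: n_def)
  have "4 dvd n" using N unfolding n_def by (metis int_dvd_int_iff of_nat_numeral)
  then have n4: "4 dvd c" "4 dvd e * n" "4 dvd c - e * n * d" using c0 by simp_all
  have oddd: "odd d" by (rule odd_of_coprime4[OF n4(1) coprime_det[OF det]])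
  have "odd c0" using False c0 by (auto simp: n_def mult.commute)
  then have "2 dvd c0 - e * d" using e oddd by simp
  then have dvd: "int (2 * N) dvd c - e * n * d"
  proof -
    have "c - e * n * d = n * (c0 - e * d)" by (simp add: c0 algebra_simps)
    moreover have "int (2 * N) = n * 2" by (simp add: n_def)
    ultimately show ?thesis using \<open>2 dvd c0 - e * d\<close> by (simp only: mult_dvd_mono dvd_refl)
  qed
  have det': "(a - e * n * b) * d - b * (c - e * n * d) = 1" using det by (simp add: algebra_simps)
  have det1: "1 * 1 - 0 * (e * n) = (1 :: int)" by simp
  define w where "w = mob 1 0 (e * n) 1 z"
  have w: "Im w > 0" unfolding w_def by (rule mob_uhp[OF det1 z])
  have "mob (a - e * n * b) b (c - e * n * d) d w = mob a b c d z"
    unfolding w_def mob_mult[OF det1 z] by (simp add: algebra_simps)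
  moreover have "theta_factor c d z = theta_factor (c - e * n * d) d w * theta_factor (e * n) 1 z"
    using theta_factor_cocycle[OF det' n4(3) det1 n4(2) z] by (simp add: w_def algebra_simps)
  moreover define A B where "A = theta_factor (c - e * n * d) d w ^ (2 * k + 1)"
    and "B = theta_factor (e * n) 1 z ^ (2 * k + 1)"
  ultimately have "theta_factor c d z ^ (2 * k + 1) = A * B" "g (mob a b c d z) = A * g w"
    using theta_invD[OF g det' dvd w] by (simp_all only: power_mult_distrib)
  moreover have "theta_factor (e * n) 1 z \<noteq> 0" by (rule theta_factor_nonzero[OF n4(2) _ z]) simp
  then have "B \<noteq> 0" unfolding B_def by (rule power_not_zero)
  moreover have "eval_at k (e * int N) g z = inverse B * g w"
    by (simp only: eval_at_def n_def[symmetric] w_def[symmetric] B_def)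
  ultimately show ?thesis using False by simp
qed

text \<open>Multiplying on the left by the unipotent matrix \<delta> toggles membership in level 2N,
  so an element of \<open>Gamma0 N\<close> either preserves g and g|\<delta> or exchanges them. The
  values e = 1 and e = -1 serve \<open>V4\<close> and \<open>W8\<close>.\<close>

lemma theta_inv_trace:
  assumes g: "theta_inv k (2 * N) g" and N: "4 dvd N" "N > 0" and e: "odd e"
  shows "theta_inv k N (\<lambda>z. g z + eval_at k (e * int N) g z)"
  unfolding theta_inv_def
proof (intro allI impI)
  fix a b c d z assume det: "a * d - b * c = 1" and c: "int N dvd c" and z: "Im z > 0"
  define n where "n = int N"
  define \<delta> where "\<delta> = e * n"
  obtain c0 where c0: "c = n * c0" using c by (auto simp: n_def)
  have "4 dvd n" using N unfolding n_def by (metis int_dvd_int_iff of_nat_numeral)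
  then have n4: "4 dvd c" "4 dvd \<delta>" using c0 by (simp_all add: \<delta>_def)
  have det1: "1 * 1 - 0 * \<delta> = (1 :: int)" by simp
  define \<gamma>z where "\<gamma>z = mob a b c d z"
  have im: "Im \<gamma>z > 0" unfolding \<gamma>z_def by (rule mob_uhp[OF det z])
  have det2: "a * (\<delta> * b + d) - b * (\<delta> * a + c) = 1" using det by (simp add: algebra_simps)
  have c2: "int N dvd \<delta> * a + c" by (simp add: c0 \<delta>_def n_def)
  have "odd a"
  proof
    assume "even a"
    then have "even (a * d - b * c)" using n4 by auto
    then show False using det by simp
  qed
  have n0: "n \<noteq> 0" using N by (simp add: n_def)
  have par: "int (2 * N) dvd n * x \<longleftrightarrow> even x" for x
    using n0 by (simp add: n_def mult.commute)
  have "\<delta> * a + c = n * (e * a + c0)" by (simp add: \<delta>_def c0 algebra_simps)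
  then have par2: "int (2 * N) dvd \<delta> * a + c \<longleftrightarrow> \<not> int (2 * N) dvd c"
    unfolding c0 using par e \<open>odd a\<close> by simp
  define T where "T = theta_factor c d z ^ (2 * k + 1)"
  define G where "G = eval_at k (e * int N) g z"
  have 1: "g \<gamma>z = T * (if int (2 * N) dvd c then g z else G)"
    unfolding \<gamma>z_def T_def G_def by (rule theta_inv_index2_cases[OF g N(1) e det c z])
  have "mob 1 0 \<delta> 1 \<gamma>z = mob a b (\<delta> * a + c) (\<delta> * b + d) z"
    unfolding \<gamma>z_def mob_mult[OF det z] by simp
  then have "g (mob 1 0 \<delta> 1 \<gamma>z) = theta_factor (\<delta> * a + c) (\<delta> * b + d) z ^ (2 * k + 1) *
      (if int (2 * N) dvd \<delta> * a + c then g z else G)"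
    using theta_inv_index2_cases[OF g N(1) e det2 c2 z] by (simp only: G_def)
  also have "theta_factor (\<delta> * a + c) (\<delta> * b + d) z = theta_factor \<delta> 1 \<gamma>z * theta_factor c d z"
    using theta_factor_cocycle[OF det1 n4(2) det n4(1) z] by (simp add: \<gamma>z_def)
  finally have 2: "g (mob 1 0 \<delta> 1 \<gamma>z) = theta_factor \<delta> 1 \<gamma>z ^ (2 * k + 1) * T * (if int (2 * N) dvd c then G else g z)"
    unfolding power_mult_distrib T_def par2 by simp
  define D where "D = theta_factor \<delta> 1 \<gamma>z ^ (2 * k + 1)"
  have "theta_factor \<delta> 1 \<gamma>z \<noteq> 0" by (rule theta_factor_nonzero[OF n4(2) _ im]) simp
  then have "D \<noteq> 0" unfolding D_def by (rule power_not_zero)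
  with 2 have "eval_at k (e * int N) g \<gamma>z = T * (if int (2 * N) dvd c then G else g z)"
    unfolding eval_at_def n_def[symmetric] \<delta>_def[symmetric] D_def[symmetric] by simp
  with 1 show "g (mob a b c d z) + eval_at k (e * int N) g (mob a b c d z) = theta_factor c d z ^ (2 * k + 1) * (g z + eval_at k (e * int N) g z)"
    unfolding \<gamma>z_def[symmetric] T_def[symmetric] G_def[symmetric] by (simp add: algebra_simps)
qed

section \<open>The operators $V_4$, $W_4$ and $W_8$\<close>

lemma theta_inv_cong:
  assumes "theta_inv k N f" "\<And>z. Im z > 0 \<Longrightarrow> g z = f z"
  shows "theta_inv k N g"
  using assms unfolding theta_inv_def by (simp add: mob_uhp)

lemma cusp_decay_cong:
  assumes "cusp_decay k f" "\<And>z. Im z > 0 \<Longrightarrow> g z = f z"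
  shows "cusp_decay k g"
  by (rule cusp_decay_rational[OF assms(1), of 1 1 0 0]) (use assms(2) in \<open>auto simp: hnorm_def mob_def\<close>)

lemma cusp_forms_add:
  assumes "4 dvd N" "N > 0" "f \<in> cusp_forms k N" "g \<in> cusp_forms k N"
  shows "(\<lambda>z. f z + g z) \<in> cusp_forms k N"
  using assms(3,4) unfolding cusp_forms_iff[OF assms(1,2)]
  by (auto intro!: holomorphic_intros theta_inv_add cusp_decay_add)

lemma cusp_forms_scale:
  assumes "4 dvd N" "N > 0" "f \<in> cusp_forms k N"
  shows "(\<lambda>z. x * f z) \<in> cusp_forms k N"
  using assms(3) unfolding cusp_forms_iff[OF assms(1,2)]
  by (auto intro!: holomorphic_intros theta_inv_scale cusp_decay_scale)

lemma cusp_forms_4_8: "cusp_forms k 4 \<subseteq> cusp_forms k 8"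
  using theta_inv_mono[of k 4 _ 8] by (auto simp: cusp_forms_iff)

lemma theta_factor_one_right: "theta_factor c 1 z = csqrt (of_int c * z + 1)"
  by (simp add: theta_factor_def theta_eps_def shimura_symbol_jacobi)

lemma V4_eq: "V4 k f z = (if Im z > 0 then eval_at k 4 f z else 0)"
  unfolding V4_def slash_apply eval_at_def theta_factor_one_right
  using moebius_int[of 1 0 4 1] by (simp add: mult.commute)

lemma hnorm_eval_at:
  assumes "4 dvd c" "Im z > 0"
  shows "hnorm k (eval_at k c f) z = hnorm k f (mob 1 0 c 1 z)"
proof (rule hnorm_transform[symmetric])
  let ?D = "of_int c * z + of_int 1 :: complex"
  have D: "?D \<noteq> 0" using uhp_denom_nonzero_int[of z c 1] assms by simp
  show "cmod ?D > 0" using D by simp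
  show "(cmod (theta_factor c 1 z))\<^sup>2 = cmod ?D" by (rule theta_factor_square[OF assms(1)]) simp
  show "Im (mob 1 0 c 1 z) = Im z / (cmod ?D)\<^sup>2" by (rule Im_mob) simp
  define X where "X = theta_factor c 1 z ^ (2 * k + 1)"
  have "theta_factor c 1 z \<noteq> 0" by (rule theta_factor_nonzero[OF assms(1) _ assms(2)]) simp
  then have "X \<noteq> 0" unfolding X_def by (rule power_not_zero)
  then show "cmod (f (mob 1 0 c 1 z)) = cmod (theta_factor c 1 z) ^ (2 * k + 1) * cmod (eval_at k c f z)"
    unfolding norm_power[symmetric] eval_at_def X_def[symmetric] by (simp add: norm_mult norm_inverse)
qed (use assms in auto)

lemma cusp_decay_eval_at:
  assumes "4 dvd c" "cusp_decay k f"
  shows "cusp_decay k (eval_at k c f)"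
  by (rule cusp_decay_rational[OF assms(2), of 1 1 0 c]) (simp_all add: hnorm_eval_at assms(1))

lemma holomorphic_eval_at:
  assumes "4 dvd c" "f holomorphic_on uhp"
  shows "eval_at k c f holomorphic_on uhp"
proof -
  have "(f \<circ> mob 1 0 c 1) holomorphic_on uhp"
    by (rule holomorphic_on_compose_gen[OF holomorphic_mob assms(2)]) (use mob_uhp[of 1 1 0 c] in auto)
  then have "(\<lambda>z. f (mob 1 0 c 1 z)) holomorphic_on uhp" by (simp add: o_def)
  moreover have "theta_factor c 1 holomorphic_on uhp"
    using holomorphic_csqrt_linear[of c 1] by (simp add: theta_factor_one_right[abs_def])
  ultimately show ?thesis
    unfolding eval_at_def using theta_factor_nonzero[OF assms(1)]
    by (intro holomorphic_on_mult holomorphic_on_inverse holomorphic_on_power) auto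
qed

lemma V4_trace:
  assumes "f \<in> cusp_forms k 8"
  shows "(\<lambda>z. f z + V4 k f z) \<in> cusp_forms k 4"
proof -
  have f: "f holomorphic_on uhp" "\<And>z. Im z \<le> 0 \<Longrightarrow> f z = 0" "theta_inv k (2 * 4) f" "cusp_decay k f"
    using assms by (auto simp: cusp_forms_iff)
  have V: "Im z > 0 \<Longrightarrow> V4 k f z = eval_at k 4 f z" for z by (simp add: V4_eq)
  have "V4 k f holomorphic_on uhp"
    by (rule holomorphic_transform[OF holomorphic_eval_at[OF _ f(1), of 4]]) (auto simp: V)
  moreover have "theta_inv k 4 (\<lambda>z. f z + V4 k f z)"
    using theta_inv_cong[OF theta_inv_trace[OF f(3), of 1]] V by auto
  moreover have "cusp_decay k (V4 k f)"
    using cusp_decay_cong[OF cusp_decay_eval_at[OF _ f(4), of 4]] V by auto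
  moreover have "V4 k f z = 0" if "Im z \<le> 0" for z using that by (simp add: V4_eq)
  ultimately show ?thesis
    using f by (auto simp: cusp_forms_iff intro!: holomorphic_intros cusp_decay_add)
qed

lemma eval_at_fixes:
  assumes "theta_inv k N f" "4 dvd N" "int N dvd c" "Im z > 0"
  shows "eval_at k c f z = f z"
proof -
  define X where "X = theta_factor c 1 z ^ (2 * k + 1)"
  have "4 dvd c" using assms(2,3) by (metis dvd_trans int_dvd_int_iff of_nat_numeral)
  then have "theta_factor c 1 z \<noteq> 0" by (rule theta_factor_nonzero[OF _ _ assms(4)]) simp
  then have X: "X \<noteq> 0" unfolding X_def by (rule power_not_zero)
  have "f (mob 1 0 c 1 z) = X * f z"
    unfolding X_def by (rule theta_invD[OF assms(1) _ assms(3,4)]) simp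
  then show ?thesis unfolding eval_at_def X_def[symmetric] using X by simp
qed

lemma V4_fixes:
  assumes "f \<in> cusp_forms k 4"
  shows "V4 k f = f"
proof
  fix z
  have f: "\<And>z. Im z \<le> 0 \<Longrightarrow> f z = 0" "theta_inv k 4 f"
    using assms by (auto simp: cusp_forms_iff)
  show "V4 k f z = f z"
    using f(1)[of z] eval_at_fixes[OF f(2), of 4 z] by (auto simp: V4_eq)
qed

lemma V4_add: "V4 k (\<lambda>z. f z + g z) = (\<lambda>z. V4 k f z + V4 k g z)"
  and V4_scale: "V4 k (\<lambda>z. x * f z) = (\<lambda>z. x * V4 k f z)"
  by (auto simp: V4_eq eval_at_def algebra_simps)

lemma V4_cusp_forms:
  assumes "f \<in> cusp_forms k 8"
  shows "V4 k f \<in> cusp_forms k 8"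
proof -
  have "(\<lambda>z. f z + V4 k f z) \<in> cusp_forms k 8" using V4_trace[OF assms] cusp_forms_4_8 by blast
  from cusp_forms_add[OF _ _ this cusp_forms_scale[OF _ _ assms, of "-1"]]
  show ?thesis by simp
qed

section \<open>The constants of the operators and their form in terms of Fricke slashes\<close>

definition iK :: "nat \<Rightarrow> complex" where "iK k = \<i> ^ (2 * k + 1)"

lemma iK_square: "iK k * iK k = - 1"
  unfolding iK_def power_add[symmetric] by (simp add: power_mult)

lemma iK_nonzero [simp]: "iK k \<noteq> 0"
  by (simp add: iK_def)

lemma cnj_zeta8: "cnj (zeta8 k) = (1 + iK k) / of_real (sqrt 2)"
proof -
  have "cnj (iK k) = (- \<i>) ^ (2 * k + 1)" by (simp add: iK_def)
  also have "\<dots> = - iK k" unfolding iK_def by (simp add: power_mult)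
  finally show ?thesis unfolding zeta8_def iK_def[symmetric] by simp
qed

lemma sqrt2_complex: "complex_of_real (sqrt 2) * complex_of_real (sqrt 2) = 2" "complex_of_real (sqrt 2) \<noteq> 0"
  by (simp_all flip: of_real_mult)

text \<open>The constant in front of \<open>W8\<close>. Its square is half of \<open>iK k\<close>,
  which offsets the factor that two Fricke slashes leave behind in the square of
  \<open>W8\<close>.\<close>

definition kap :: "nat \<Rightarrow> complex" where
  "kap k = 1 / of_real (sqrt 2) * cnj (zeta8 k)"

lemma kap_eq: "kap k = (1 + iK k) / 2"
  using sqrt2_complex unfolding kap_def cnj_zeta8 by (simp add: field_simps)

lemma kap_square: "kap k * kap k = iK k / 2"
  using iK_square[of k] by (simp add: kap_eq field_simps)

lemma csqrt_neg_inverse_mult: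
  assumes "Im x > 0"
  shows "csqrt (- 1 / x) * csqrt x = \<i>"
proof -
  have x: "x \<noteq> 0" using assms by auto
  have e: "- 1 / x * x = -1" using x by simp
  have im: "Im (- 1 / x) > 0"
    using Im_neg_inverse[of "x / 4"] assms by simp
  have i: "csqrt (- 1) = \<i>" using csqrt_of_real'[of "-1"] by simp
  have "csqrt (- 1 / x * x) = csqrt (- 1 / x) * csqrt x"
    by (rule csqrt_mult_upper(1)[OF im assms]) (simp only: e i imaginary_unit.sel zero_le_one)
  then show ?thesis by (simp only: e i)
qed

text \<open>On points the map is an involution, but the principal roots at z and at its image
  multiply to i, and the power 2k + 1 of i is \<open>iK k\<close>.\<close>

lemma fricke_fricke:
  assumes "t > 0" "Im z > 0"
  shows "fricke k t (fricke k t f) z = inverse (iK k) * f z"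
proof -
  define w where "w = - 1 / (of_nat (4 * t\<^sup>2) * z)"
  have w: "Im w > 0" unfolding w_def by (rule Im_fricke(2)[OF assms])
  have z0: "z \<noteq> 0" using assms by auto
  have ww: "- 1 / (of_nat (4 * t\<^sup>2) * w) = z" using assms z0 by (simp add: w_def)
  have "of_nat (2 * t) * w = - 1 / (of_nat (2 * t) * z)"
    using assms z0 by (simp add: w_def power2_eq_square divide_simps)
  then have c: "csqrt (of_nat (2 * t) * w) * csqrt (of_nat (2 * t) * z) = \<i>"
    using csqrt_neg_inverse_mult[of "of_nat (2 * t) * z"] assms by simp
  have "fricke k t (fricke k t f) z = fricke k t f w * inverse (csqrt (of_nat (2 * t) * z) ^ (2 * k + 1))"
    unfolding fricke_def[of k t "fricke k t f" z] w_def[symmetric] using assms by simp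
  also have "fricke k t f w = f z * inverse (csqrt (of_nat (2 * t) * w) ^ (2 * k + 1))"
    unfolding fricke_def[of k t f w] ww using w by simp
  also have "f z * inverse (csqrt (of_nat (2 * t) * w) ^ (2 * k + 1)) * inverse (csqrt (of_nat (2 * t) * z) ^ (2 * k + 1))
     = inverse ((csqrt (of_nat (2 * t) * w) * csqrt (of_nat (2 * t) * z)) ^ (2 * k + 1)) * f z"
    by (simp only: power_mult_distrib inverse_mult_distrib mult_ac)
  finally show ?thesis by (simp only: c iK_def)
qed

text \<open>The matrices in the definitions of \<open>W4\<close> and \<open>W8\<close> differ from the Fricke matrix by an element
  of \<open>\<Gamma>\<^sub>0(16)\<close>, followed by a translation by $1/2$ for the second summand of \<open>W8\<close>.\<close>

lemma slash_via_fricke: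
  assumes f: "theta_inv k N f" and N: "4 dvd N" and z: "Im z > 0"
    and det: "a * 1 - b * c = 1" and c: "int N dvd c"
    and A: "moebius A z = mob a b c 1 w" and w: "Im w > 0"
    and \<phi>: "\<phi> = csqrt (of_int c * w + 1) * csqrt u"
  shows "f (moebius A z) * inverse (\<phi> ^ (2 * k + 1)) = f w * inverse (csqrt u ^ (2 * k + 1))"
proof -
  define T where "T = csqrt (of_int c * w + 1)"
  have "4 dvd c" using c N by (metis dvd_trans int_dvd_int_iff of_nat_numeral)
  then have "T \<noteq> 0" using theta_factor_nonzero[of c 1 w] w by (simp add: T_def theta_factor_one_right)
  then have T: "T ^ (2 * k + 1) \<noteq> 0" by (rule power_not_zero)
  have p: "\<phi> ^ (2 * k + 1) = T ^ (2 * k + 1) * csqrt u ^ (2 * k + 1)"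
    unfolding \<phi> T_def by (simp only: power_mult_distrib)
  have "f (moebius A z) = T ^ (2 * k + 1) * f w"
    unfolding A using theta_invD[OF f _ c w, of a 1 b] det by (simp only: theta_factor_one_right T_def of_int_1)
  then show ?thesis using T unfolding p by (simp del: power_Suc)
qed


lemma W4_eq:
  assumes "8 * n' - m' = (1 :: int)" "theta_inv k 4 f"
  shows "W4 k n' m' f = (\<lambda>z. cnj (zeta8 k) * fricke k 1 f z)"
proof
  fix z
  show "W4 k n' m' f z = cnj (zeta8 k) * fricke k 1 f z"
  proof (cases "Im z > 0")
    case True
    define w where "w = - 1 / (of_nat (4 * 1\<^sup>2) * z)"
    have w: "Im w > 0" unfolding w_def by (rule Im_fricke(2)) (use True in auto)
    have z0: "z \<noteq> 0" using True by auto
    have wz: "w * z = - 1 / 4" using z0 by (simp add: w_def)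
    have m: "m' = 8 * n' - 1" using assms(1) by simp
    let ?A = "mat2 (of_int (4 * n')) (of_int m') 4 8 :: real^2^2"
    \<comment> \<open>The matrix with rows (4n', m'), (4, 8) is the product of the one with rows
      (-m', n'), (-8, 1) and the Fricke matrix; the left factor has determinant 8n' - m' =
      1.\<close>
    have A: "moebius ?A z = mob (- m') n' (- 8) 1 w"
    proof -
      have "moebius ?A z = (of_int (4 * n') * z + of_int m') / (4 * z + 8)"
        by (simp add: moebius_def)
      also have "of_int (4 * n') * z + of_int m' = - 4 * of_int m' * (w * z) + 4 * of_int n' * z"
        unfolding wz by simp
      also have "\<dots> = (of_int (- m') * w + of_int n') * (4 * z)" by (simp add: algebra_simps)
      also have "4 * z + 8 = - 32 * (w * z) + 4 * z" unfolding wz by simp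
      also have "\<dots> = (of_int (- 8) * w + of_int 1) * (4 * z)" by (simp add: algebra_simps)
      finally show ?thesis using z0 by (simp only: mob_def) simp
    qed
    have phi: "csqrt (2 * z + 4) = csqrt (of_int (- 8) * w + 1) * csqrt (2 * z)"
    proof -
      have "(2 * z) * (of_int (- 8) * w + 1) = - 16 * (w * z) + 2 * z" by (simp add: algebra_simps)
      also have "\<dots> = 2 * z + 4" unfolding wz by simp
      finally have "(2 * z) * (of_int (- 8) * w + 1) = 2 * z + 4" .
      moreover have "csqrt ((2 * z) * (of_int (- 8) * w + 1)) = csqrt (2 * z) * csqrt (of_int (- 8) * w + 1)"
        by (rule csqrt_mult_quadrants) (use True w in auto)
      ultimately show ?thesis by (simp add: mult.commute)
    qed
    have "f (moebius ?A z) * inverse (csqrt (2 * z + 4) ^ (2 * k + 1)) = f w * inverse (csqrt (2 * z) ^ (2 * k + 1))"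
      by (rule slash_via_fricke[OF assms(2) _ True _ _ A w phi]) (auto simp: m)
    then show ?thesis
      using True by (simp only: W4_def slash_apply fricke_def if_True w_def) simp
  qed (simp add: W4_def slash_apply fricke_def)
qed

lemma W8_eq:
  assumes "16 * n - m = (1 :: int)" "theta_inv k 8 f"
  shows "W8 k n m f = (\<lambda>z. kap k * (fricke k 2 f z + fricke k 2 (half_shift f) z))"
proof
  fix z
  let ?A = "\<lambda>s :: int. mat2 (of_int (16 * n - 8 * m * s)) (of_int m) (of_int (16 - 128 * s)) 16 :: real^2^2"
  let ?\<phi> = "\<lambda>s z. csqrt (of_int (4 - 32 * s) * z + 4)"
  have two: "{0..1 :: int} = {0, 1}" by auto
  show "W8 k n m f z = kap k * (fricke k 2 f z + fricke k 2 (half_shift f) z)"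
  proof (cases "Im z > 0")
    case True
    have z0: "z \<noteq> 0" using True by auto
    have m: "m = 16 * n - 1" using assms(1) by simp
    have main: "f (moebius (?A s) z) * inverse (?\<phi> s z ^ (2 * k + 1))
       = f (- 1 / (16 * z) + of_int s / 2) * inverse (csqrt (4 * z) ^ (2 * k + 1))" for s
    proof -
      define w where "w = - 1 / (16 * z) + of_int s / 2"
      have w: "Im w > 0" using Im_fricke(2)[of 2 z] True by (simp add: w_def)
      have wz: "w * (16 * z) = - 1 + 8 * of_int s * z" using z0 by (simp add: w_def field_simps)
      \<comment> \<open>w belongs to the matrix with rows (8s, -1), (16, 0); multiplied from the
        left by the one with rows (-m, n), (-16, 1) it gives the matrix of the s-th summand.\<close>
      have A: "moebius (?A s) z = mob (- m) n (- 16) 1 w"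
      proof -
        have "moebius (?A s) z = (of_int (16 * n - 8 * m * s) * z + of_int m) / (of_int (16 - 128 * s) * z + 16)"
          by (simp add: moebius_def)
        also have "of_int (16 * n - 8 * m * s) * z + of_int m = - of_int m * (w * (16 * z)) + of_int n * (16 * z)"
          unfolding wz by (simp add: algebra_simps)
        also have "\<dots> = (of_int (- m) * w + of_int n) * (16 * z)" by (simp add: algebra_simps)
        also have "of_int (16 - 128 * s) * z + 16 = - 16 * (w * (16 * z)) + 16 * z"
          unfolding wz by (simp add: algebra_simps)
        also have "\<dots> = (of_int (- 16) * w + of_int 1) * (16 * z)" by (simp add: algebra_simps)
        finally show ?thesis using z0 by (simp only: mob_def) simp
      qed
      have phi: "?\<phi> s z = csqrt (of_int (- 16) * w + 1) * csqrt (4 * z)"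
      proof -
        have "(4 * z) * (of_int (- 16) * w + 1) = - 4 * (w * (16 * z)) + 4 * z" by (simp add: algebra_simps)
        also have "\<dots> = of_int (4 - 32 * s) * z + 4" unfolding wz by (simp add: algebra_simps)
        finally have "(4 * z) * (of_int (- 16) * w + 1) = of_int (4 - 32 * s) * z + 4" .
        moreover have "csqrt ((4 * z) * (of_int (- 16) * w + 1)) = csqrt (4 * z) * csqrt (of_int (- 16) * w + 1)"
          by (rule csqrt_mult_quadrants) (use True w in auto)
        ultimately show ?thesis by (simp add: mult.commute)
      qed
      have "f (moebius (?A s) z) * inverse (?\<phi> s z ^ (2 * k + 1)) = f w * inverse (csqrt (4 * z) ^ (2 * k + 1))"
        by (rule slash_via_fricke[OF assms(2) _ True _ _ A w phi]) (auto simp: m)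
      then show ?thesis by (simp only: w_def)
    qed
    have "W8 k n m f z = kap k * (\<Sum>s\<in>{0, 1}. f (moebius (?A s) z) * inverse (?\<phi> s z ^ (2 * k + 1)))"
      unfolding W8_def slash_apply two kap_def using True by simp
    also have "\<dots> = kap k * (f (- 1 / (16 * z)) * inverse (csqrt (4 * z) ^ (2 * k + 1)) + f (- 1 / (16 * z) + 1 / 2) * inverse (csqrt (4 * z) ^ (2 * k + 1)))"
      unfolding main by simp
    also have "\<dots> = kap k * (fricke k 2 f z + fricke k 2 (half_shift f) z)"
      using True by (simp add: fricke_def half_shift_def)
    finally show ?thesis .
  qed (simp add: W8_def slash_apply fricke_def)
qed

lemma W4_cusp_forms:
  assumes "8 * n' - m' = (1 :: int)" "f \<in> cusp_forms k 4"
  shows "W4 k n' m' f \<in> cusp_forms k 4"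
proof -
  have f: "f holomorphic_on uhp" "theta_inv k 4 f" "cusp_decay k f"
    using assms by (auto simp: cusp_forms_iff)
  have "fricke k 1 f \<in> cusp_forms k 4"
    using holomorphic_fricke[OF _ f(1), of 1] theta_inv_fricke[of 1 k f] f cusp_decay_fricke[OF _ f(3), of 1]
    by (auto simp: cusp_forms_iff fricke_def)
  then show ?thesis unfolding W4_eq[OF assms(1) f(2)] by (intro cusp_forms_scale) auto
qed

text \<open>The Fricke map of level 16 conjugates the translation by 1/2 to the lower unipotent
  matrix with entry -8. In this form the second summand of \<open>W8\<close> completes the first to
  a trace from level 16 to level 8.\<close>

lemma fricke_half_shift:
  assumes z: "Im z > 0"
  shows "fricke k 2 (half_shift f) z = eval_at k (- 8) (fricke k 2 f) z"
proof -
  define v where "v = mob 1 0 (- 8) 1 z"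
  have v: "Im v > 0" unfolding v_def by (rule mob_uhp) (use z in auto)
  have J: "1 - 8 * z \<noteq> 0" using uhp_denom_nonzero_int[of z "-8" 1] z by simp
  have z0: "z \<noteq> 0" using z by auto
  have vz: "v = z / (1 - 8 * z)" by (simp add: v_def mob_def)
  have arg: "- 1 / (of_nat (4 * 2\<^sup>2) * v) = - 1 / (of_nat (4 * 2\<^sup>2) * z) + 1 / 2"
    using J z0 by (simp add: vz field_simps)
  have cs: "csqrt (of_nat (2 * 2) * z) = csqrt (of_nat (2 * 2) * v) * csqrt (1 - 8 * z)"
  proof -
    have "of_nat (2 * 2) * v * (1 - 8 * z) = of_nat (2 * 2) * z" using J by (simp add: vz)
    moreover have "csqrt (of_nat (2 * 2) * v * (1 - 8 * z)) = csqrt (of_nat (2 * 2) * v) * csqrt (1 - 8 * z)"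
      by (rule csqrt_mult_quadrants) (use z v in auto)
    ultimately show ?thesis by (simp only:)
  qed
  have th: "theta_factor (- 8) 1 z = csqrt (1 - 8 * z)" by (simp add: theta_factor_one_right)
  have "fricke k 2 (half_shift f) z = f (- 1 / (of_nat (4 * 2\<^sup>2) * z) + 1 / 2) * inverse (csqrt (of_nat (2 * 2) * z) ^ (2 * k + 1))"
    using z by (simp only: fricke_def half_shift_def if_True)
  also have "\<dots> = inverse (csqrt (1 - 8 * z) ^ (2 * k + 1)) * (f (- 1 / (of_nat (4 * 2\<^sup>2) * v)) * inverse (csqrt (of_nat (2 * 2) * v) ^ (2 * k + 1)))"
    unfolding cs arg by (simp only: power_mult_distrib inverse_mult_distrib mult_ac)
  also have "\<dots> = eval_at k (- 8) (fricke k 2 f) z"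
    using v by (simp only: eval_at_def th v_def[symmetric] fricke_def if_True)
  finally show ?thesis .
qed

lemma fricke_shift_fricke:
  assumes z: "Im z > 0"
  shows "fricke k 2 (half_shift (fricke k 2 f)) z = inverse (iK k) * eval_at k (- 8) f z"
proof -
  define v where "v = mob 1 0 (- 8) 1 z"
  have v: "Im v > 0" unfolding v_def by (rule mob_uhp) (use z in auto)
  have "eval_at k (- 8) (fricke k 2 (fricke k 2 f)) z = inverse (iK k) * eval_at k (- 8) f z"
    using fricke_fricke[of 2 v k f] v by (simp add: eval_at_def v_def)
  then show ?thesis using fricke_half_shift[OF z, of k "fricke k 2 f"] by simp
qed

text \<open>The sign comes from the quadratic residue symbol $(-8/5) = -1$.\<close>

lemma eval_at_half_shift:
  assumes f: "theta_inv k 8 f" and z: "Im z > 0"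
  shows "eval_at k (- 8) (half_shift f) z = - half_shift f z"
proof -
  have J: "1 - 8 * z \<noteq> 0" using uhp_denom_nonzero_int[of z "-8" 1] z by simp
  have im: "Im (z + 1 / 2) > 0" using z by simp
  have m: "mob 1 0 (- 8) 1 z + 1 / 2 = mob (- 3) 2 (- 8) 5 (z + 1 / 2)"
    using J by (simp add: mob_def field_simps)
  have leg: "jacobi (- 8) 5 = - 1"
  proof -
    have "jacobi (- 8) 5 = jacobi 2 5" by (rule jacobi_cong) (auto simp: cong_def)
    also have "\<dots> = - 1" using jacobi_two[of 5] by simp
    finally show ?thesis .
  qed
  have th: "theta_factor (- 8) 5 (z + 1 / 2) = - csqrt (1 - 8 * z)"
    by (simp add: theta_factor_def theta_eps_def shimura_symbol_jacobi leg algebra_simps)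
  define X where "X = csqrt (1 - 8 * z) ^ (2 * k + 1)"
  have X: "X \<noteq> 0" unfolding X_def using J by (intro power_not_zero) simp
  have "(- csqrt (1 - 8 * z)) ^ (2 * k + 1) = - X" unfolding X_def by (rule power_minus_odd) simp
  note p = this
  have "f (mob (- 3) 2 (- 8) 5 (z + 1 / 2)) = theta_factor (- 8) 5 (z + 1 / 2) ^ (2 * k + 1) * f (z + 1 / 2)"
    by (rule theta_invD[OF f _ _ im]) auto
  then have fm: "f (mob (- 3) 2 (- 8) 5 (z + 1 / 2)) = - X * f (z + 1 / 2)" unfolding th p .
  have e: "of_int (- 8) * z + 1 = 1 - 8 * z" by simp
  show ?thesis
    unfolding eval_at_def half_shift_def m theta_factor_one_right e X_def[symmetric] fm using X by simp
qed

lemma W8_theta_inv: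
  assumes "16 * n - m = (1 :: int)" "theta_inv k 8 f"
  shows "theta_inv k 8 (W8 k n m f)"
proof -
  have "theta_inv k (2 * 8) f" using theta_inv_mono[OF assms(2), of 16] by simp
  then have "theta_inv k (2 * 8) (fricke k 2 f)" using theta_inv_fricke[of 2 k f] by simp
  then have "theta_inv k 8 (\<lambda>z. fricke k 2 f z + eval_at k (- 1 * int 8) (fricke k 2 f) z)"
    by (rule theta_inv_trace) auto
  then have "theta_inv k 8 (\<lambda>z. kap k * (fricke k 2 f z + eval_at k (- 1 * int 8) (fricke k 2 f) z))"
    by (rule theta_inv_scale)
  then show ?thesis
    unfolding W8_eq[OF assms] by (rule theta_inv_cong) (simp add: fricke_half_shift)
qed

lemma W8_cusp_forms:
  assumes "16 * n - m = (1 :: int)" "f \<in> cusp_forms k 8"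
  shows "W8 k n m f \<in> cusp_forms k 8"
proof -
  have f: "f holomorphic_on uhp" "theta_inv k 8 f" "cusp_decay k f"
    using assms by (auto simp: cusp_forms_iff)
  have "W8 k n m f holomorphic_on uhp" "cusp_decay k (W8 k n m f)"
    unfolding W8_eq[OF assms(1) f(2)]
    by (intro holomorphic_on_mult holomorphic_on_const holomorphic_on_add holomorphic_fricke holomorphic_half_shift f
          cusp_decay_scale cusp_decay_add cusp_decay_fricke cusp_decay_half_shift; simp)+
  moreover have "W8 k n m f z = 0" if "Im z \<le> 0" for z
    using that unfolding W8_eq[OF assms(1) f(2)] by (simp add: fricke_def)
  ultimately show ?thesis using W8_theta_inv[OF assms(1) f(2)] by (auto simp: cusp_forms_iff)
qed

lemma fricke_linear: "fricke k t (\<lambda>z. x * (f z + g z)) = (\<lambda>z. x * (fricke k t f z + fricke k t g z))"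
  by (auto simp: fricke_def algebra_simps)

lemma half_shift_linear: "half_shift (\<lambda>z. x * (f z + g z)) = (\<lambda>z. x * (half_shift f z + half_shift g z))"
  by (auto simp: half_shift_def)

text \<open>Of the four terms two equal f divided by \<open>iK k\<close>. The other two are the half
  shift of f divided by \<open>iK k\<close>, and cancel thanks to the sign in
  \<open>eval_at_half_shift\<close>.\<close>

theorem W8_W8:
  assumes "16 * n - m = (1 :: int)" "f \<in> cusp_forms k 8"
  shows "W8 k n m (W8 k n m f) = f"
proof
  fix z
  have f: "\<And>z. Im z \<le> 0 \<Longrightarrow> f z = 0" "theta_inv k 8 f"
    using assms by (auto simp: cusp_forms_iff)
  let ?M = "fricke k 2"
  note e1 = W8_eq[OF assms(1) W8_theta_inv[OF assms(1) f(2)]]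
  note e2 = W8_eq[OF assms(1) f(2)]
  have e3: "eval_at k (- 8) f z = f z" if "Im z > 0"
    by (rule eval_at_fixes[OF f(2) _ _ that]) auto
  show "W8 k n m (W8 k n m f) z = f z"
  proof (cases "Im z > 0")
    case True
    have "W8 k n m (W8 k n m f) z = kap k * kap k * (?M (?M f) z + ?M (?M (half_shift f)) z
        + (?M (half_shift (?M f)) z + ?M (half_shift (?M (half_shift f))) z))"
      unfolding e1 unfolding e2 fricke_linear half_shift_linear by (simp add: algebra_simps)
    also have "\<dots> = kap k * kap k * (2 * inverse (iK k) * f z)"
      unfolding fricke_fricke[OF zero_less_numeral True] fricke_shift_fricke[OF True]
        e3[OF True] eval_at_half_shift[OF f(2) True] by (simp add: algebra_simps)
    also have "\<dots> = f z" unfolding kap_square by simp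
    finally show ?thesis .
  qed (unfold e1, simp add: fricke_def f(1))
qed

section \<open>The plus space and \<open>W8\<close>\<close>

lemma i_power_mod4: "\<i> ^ n = \<i> ^ (n mod 4)"
proof -
  have "\<i> ^ n = \<i> ^ (4 * (n div 4) + n mod 4)" by simp
  also have "\<dots> = (\<i> ^ 4) ^ (n div 4) * \<i> ^ (n mod 4)" by (simp only: power_add power_mult)
  also have "\<i> ^ 4 = 1" by (simp add: power4_eq_xxxx)
  finally show ?thesis by simp
qed

lemma plus_coefficient:
  assumes "((- 1) ^ k * int n) mod 4 \<in> {0, 1}"
  shows "\<i> ^ n = 1 \<or> \<i> ^ n = iK k"
proof (cases "even k")
  case True
  then have "(2 * k + 1) mod 4 = 1" by presburger
  then have j: "iK k = \<i>" unfolding iK_def by (subst i_power_mod4) simp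
  have "int n mod 4 = 0 \<or> int n mod 4 = 1" using assms True by simp
  then have "n mod 4 = 0 \<or> n mod 4 = 1" by presburger
  then show ?thesis using i_power_mod4[of n] j by auto
next
  case False
  then have "(2 * k + 1) mod 4 = 3" by presburger
  then have j: "iK k = \<i> ^ 3" unfolding iK_def by (subst i_power_mod4) simp
  have "(- int n) mod 4 = 0 \<or> (- int n) mod 4 = 1" using assms False by simp
  then have "n mod 4 = 0 \<or> n mod 4 = 3" by presburger
  then show ?thesis using i_power_mod4[of n] j by auto
qed

text \<open>A form in the plus space is a sum of two eigenfunctions of $z \mapsto z + 1/4$, with
  eigenvalues $1$ and $i^{2k+1}$; hence it satisfies linear relations between its translates.\<close>

lemma plus_space_translates:
  assumes "f \<in> plus_space4 k" "Im z > 0"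
  shows "f (z + 1 / 4) = (1 + iK k) / 2 * f z + (1 - iK k) / 2 * f (z + 1 / 2)"
    and "f (z - 1 / 4) = (1 - iK k) / 2 * f z + (1 + iK k) / 2 * f (z + 1 / 2)"
proof -
  define j where "j = iK k"
  have jj: "j * j = - 1" by (simp add: j_def iK_square)
  have jT: "j * (j * x) = - x" for x by (simp add: jj flip: mult.assoc)
  obtain a where a: "has_fourier_expansion 1 0 f a"
    "\<And>n. ((- 1) ^ k * int n) mod 4 \<notin> {0, 1} \<Longrightarrow> a n = 0"
    using assms(1) by (auto simp: plus_space4_def)
  define t where "t n z = a n * exp (2 * of_real pi * \<i> * of_nat n * z)" for n z
  have sums: "(\<lambda>n. t n w) sums f w" if "Im w > 0" for w
    using a(1) that by (simp add: has_fourier_expansion_def t_def)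
  have e4: "exp (2 * of_real pi * \<i> * of_nat n * (1 / 4)) = \<i> ^ n" for n
  proof -
    have "exp (2 * of_real pi * \<i> * of_nat n * (1 / 4)) = exp (of_nat n * (\<i> * of_real (pi / 2)))"
      by (simp add: mult_ac)
    also have "\<dots> = exp (\<i> * of_real (pi / 2)) ^ n" by (rule exp_of_nat_mult)
    also have "exp (\<i> * of_real (pi / 2)) = \<i>" unfolding exp_Euler cos_of_real sin_of_real by simp
    finally show ?thesis .
  qed
  have t4: "t n (w + 1 / 4) = \<i> ^ n * t n w" for n w
  proof -
    have "exp (2 * of_real pi * \<i> * of_nat n * (w + 1 / 4)) = exp (2 * of_real pi * \<i> * of_nat n * (1 / 4)) * exp (2 * of_real pi * \<i> * of_nat n * w)"
      unfolding exp_add[symmetric] by (simp add: algebra_simps)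
    then show ?thesis unfolding e4 by (simp add: t_def)
  qed
  have t2: "t n (w + 1 / 2) = \<i> ^ n * (\<i> ^ n * t n w)" for n w
    using t4[of n "w + 1 / 4"] t4[of n w] by (simp add: add.assoc)
  have tm: "t n (w - 1 / 4) = \<i> ^ n * (\<i> ^ n * (\<i> ^ n * t n w))" for n w
  proof -
    have "\<i> ^ n * (\<i> ^ n * (\<i> ^ n * \<i> ^ n)) = (\<i> ^ n) ^ 4"
      by (simp only: power4_eq_xxxx mult.assoc)
    also have "\<dots> = (\<i> ^ 4) ^ n" by (simp only: power_mult[symmetric] mult.commute)
    finally have "\<i> ^ n * (\<i> ^ n * (\<i> ^ n * \<i> ^ n)) = 1" by (simp add: power4_eq_xxxx)
    moreover have "t n w = \<i> ^ n * t n (w - 1 / 4)" using t4[of n "w - 1 / 4"] by simp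
    ultimately show ?thesis by (simp add: mult.assoc[symmetric])
  qed
  have x: "a n = 0 \<or> \<i> ^ n = 1 \<or> \<i> ^ n = j" for n
  proof (cases "((- 1) ^ k * int n) mod 4 \<in> {0, 1}")
    case True
    from plus_coefficient[OF this] show ?thesis by (simp add: j_def)
  next
    case False
    from a(2)[OF this] show ?thesis by simp
  qed
  \<comment> \<open>With x = i^n this is the identity x = (1 + j)/2 + (1 - j)/2 x^2, the
    interpolation of x by 1 and x^2 at the two values x = 1 and x = j.\<close>
  have "t n (z + 1 / 4) = (1 + j) / 2 * t n z + (1 - j) / 2 * t n (z + 1 / 2)" for n
  proof -
    consider "t n z = 0" | "\<i> ^ n = 1" | "\<i> ^ n = j" using x[of n] by (auto simp: t_def)
    then have "\<i> ^ n * t n z = (1 + j) / 2 * t n z + (1 - j) / 2 * (\<i> ^ n * (\<i> ^ n * t n z))"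
    proof cases
      case 3
      then show ?thesis by (simp only: jT) (simp add: field_simps)
    qed (simp_all add: field_simps)
    then show ?thesis by (simp only: t4 t2)
  qed
  moreover have "(\<lambda>n. (1 + j) / 2 * t n z + (1 - j) / 2 * t n (z + 1 / 2)) sums ((1 + j) / 2 * f z + (1 - j) / 2 * f (z + 1 / 2))"
    by (intro sums_add sums_mult sums) (use assms in auto)
  moreover have "(\<lambda>n. t n (z + 1 / 4)) sums f (z + 1 / 4)" by (rule sums) (use assms in auto)
  ultimately show "f (z + 1 / 4) = (1 + iK k) / 2 * f z + (1 - iK k) / 2 * f (z + 1 / 2)"
    unfolding j_def[symmetric] by (simp add: sums_unique2)
  \<comment> \<open>Likewise x^3 = (1 - j)/2 + (1 + j)/2 x^2 at x = 1 and x = j; the cube is the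
    inverse of x because x^4 = 1.\<close>
  have "t n (z - 1 / 4) = (1 - j) / 2 * t n z + (1 + j) / 2 * t n (z + 1 / 2)" for n
  proof -
    consider "t n z = 0" | "\<i> ^ n = 1" | "\<i> ^ n = j" using x[of n] by (auto simp: t_def)
    then have "\<i> ^ n * (\<i> ^ n * (\<i> ^ n * t n z)) = (1 - j) / 2 * t n z + (1 + j) / 2 * (\<i> ^ n * (\<i> ^ n * t n z))"
    proof cases
      case 3
      then show ?thesis by (simp only: jT) (simp add: field_simps)
    qed (simp_all add: field_simps)
    then show ?thesis by (simp only: tm t2)
  qed
  moreover have "(\<lambda>n. (1 - j) / 2 * t n z + (1 + j) / 2 * t n (z + 1 / 2)) sums ((1 - j) / 2 * f z + (1 + j) / 2 * f (z + 1 / 2))"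
    by (intro sums_add sums_mult sums) (use assms in auto)
  moreover have "(\<lambda>n. t n (z - 1 / 4)) sums f (z - 1 / 4)" by (rule sums) (use assms in auto)
  ultimately show "f (z - 1 / 4) = (1 - iK k) / 2 * f z + (1 + iK k) / 2 * f (z + 1 / 2)"
    unfolding j_def[symmetric] by (simp add: sums_unique2)
qed

text \<open>For w = -1/(16z), the relations between translates turn f(w) + f(w + 1/2) into f(w +
  1/4) + f(w - 1/4). These two points are images of z - 1/4 and z + 1/4 under lower unipotent
  matrices of level 4. The relations at z then leave (1 - j) f(z), and \<open>kap k\<close> times 1
  - j is 1.\<close>

theorem W8_plus_space:
  assumes "16 * n - m = (1 :: int)" "f \<in> plus_space4 k"
  shows "W8 k n m f = f"
proof
  fix z
  have f4: "f \<in> cusp_forms k 4" using assms(2) by (simp add: plus_space4_def)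
  then have f: "\<And>z. Im z \<le> 0 \<Longrightarrow> f z = 0" "theta_inv k 4 f" "theta_inv k 8 f"
    using theta_inv_mono[of k 4 f 8] by (auto simp: cusp_forms_iff)
  note e = W8_eq[OF assms(1) f(3)]
  show "W8 k n m f z = f z"
  proof (cases "Im z > 0")
    case True
    have z0: "z \<noteq> 0" using True by auto
    define w where "w = - 1 / (16 * z)"
    have w: "Im w > 0" using Im_fricke(2)[of 2 z] True by (simp add: w_def)
    define j where "j = iK k"
    have jj: "j * j = - 1" by (simp add: j_def iK_square)
    define Q where "Q = csqrt (4 * z) ^ (2 * k + 1)"
    have Q: "Q \<noteq> 0" unfolding Q_def using z0 by (intro power_not_zero) simp
    have u1: "Im (z - 1 / 4) > 0" and u2: "Im (z + 1 / 4) > 0" using True by auto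
    have m1: "w + 1 / 4 = mob 1 0 4 1 (z - 1 / 4)" using z0 by (simp add: mob_def w_def field_simps)
    have th1: "theta_factor 4 1 (z - 1 / 4) = csqrt (4 * z)" by (simp add: theta_factor_one_right algebra_simps)
    have "f (w + 1 / 4) = theta_factor 4 1 (z - 1 / 4) ^ (2 * k + 1) * f (z - 1 / 4)"
      unfolding m1 by (rule theta_invD[OF f(2) _ _ u1]) auto
    then have f1: "f (w + 1 / 4) = Q * f (z - 1 / 4)" unfolding th1 Q_def .
    have m2: "w - 1 / 4 = mob 1 0 (- 4) 1 (z + 1 / 4)" using z0 by (simp add: mob_def w_def field_simps)
    have cs: "csqrt (- (4 * z)) = - \<i> * csqrt (4 * z)"
      by (intro csqrt_unique) (use csqrt_upper[of "4 * z"] True in \<open>auto simp: power_mult_distrib\<close>)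
    have th2: "theta_factor (- 4) 1 (z + 1 / 4) = - \<i> * csqrt (4 * z)"
      unfolding cs[symmetric] by (simp add: theta_factor_one_right algebra_simps)
    have th2K: "theta_factor (- 4) 1 (z + 1 / 4) ^ (2 * k + 1) = - j * Q"
    proof -
      have "(- \<i>) ^ (2 * k + 1) = - j" unfolding j_def iK_def by (rule power_minus_odd) simp
      then show ?thesis unfolding th2 power_mult_distrib Q_def by simp
    qed
    have "f (w - 1 / 4) = theta_factor (- 4) 1 (z + 1 / 4) ^ (2 * k + 1) * f (z + 1 / 4)"
      unfolding m2 by (rule theta_invD[OF f(2) _ _ u2]) auto
    then have f2: "f (w - 1 / 4) = - j * Q * f (z + 1 / 4)" unfolding th2K .
    have sum: "f w + f (w + 1 / 2) = f (w + 1 / 4) + f (w - 1 / 4)"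
      unfolding plus_space_translates[OF assms(2) w] by (simp add: field_simps)
    have "W8 k n m f z = kap k * ((f w + f (w + 1 / 2)) * inverse Q)"
      unfolding e using True by (simp add: fricke_def half_shift_def w_def Q_def algebra_simps)
    also have "\<dots> = kap k * (f (z - 1 / 4) - j * f (z + 1 / 4))"
      unfolding sum f1 f2 using Q by (simp add: field_simps)
    also have "f (z - 1 / 4) - j * f (z + 1 / 4) = (1 - j) * f z"
    proof -
      have "f (z - 1 / 4) - j * f (z + 1 / 4) = ((1 - j) - (j + j * j)) / 2 * f z + ((1 + j) - (j - j * j)) / 2 * f (z + 1 / 2)"
        unfolding plus_space_translates[OF assms(2) True] j_def[symmetric] by (simp add: field_simps)
      also have "((1 - j) - (j + j * j)) / 2 = 1 - j" unfolding jj by simp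
      also have "((1 + j) - (j - j * j)) / 2 = 0" unfolding jj by simp
      finally show ?thesis by simp
    qed
    also have "kap k * ((1 - j) * f z) = (1 - j * j) / 2 * f z"
      unfolding kap_eq j_def[symmetric] by (simp add: field_simps)
    finally show ?thesis unfolding jj by simp
  qed (unfold e, simp add: fricke_def f(1))
qed

section \<open>The Petersson product\<close>

lemma cusp_form_measurable:
  assumes "f holomorphic_on uhp" "\<And>z. Im z \<le> 0 \<Longrightarrow> f z = 0"
  shows "f \<in> borel_measurable borel"
proof -
  have "(\<lambda>z. indicator uhp z *\<^sub>R f z) \<in> borel_measurable borel"
    by (rule borel_measurable_continuous_on_indicator[OF _ holomorphic_on_imp_continuous_on[OF assms(1)]]) simp
  moreover have "(\<lambda>z. indicator uhp z *\<^sub>R f z) = f"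
    using assms(2) by (auto simp: fun_eq_iff indicator_def not_less)
  ultimately show ?thesis by simp
qed

lemma fund_domain_Im: "z \<in> std_fund_domain \<Longrightarrow> Im z \<ge> 1 / 2"
proof -
  assume "z \<in> std_fund_domain"
  then have zz: "\<bar>Re z\<bar> \<le> 1 / 2" "1 \<le> cmod z" "Im z > 0" by (auto simp: std_fund_domain_def)
  have "1 \<le> (cmod z)\<^sup>2" using zz by simp
  then have "1 \<le> (Re z)\<^sup>2 + (Im z)\<^sup>2" by (simp only: cmod_power2)
  moreover have "(Re z)\<^sup>2 \<le> 1 / 4"
    using power_mono[OF zz(1), of 2] by (simp add: power_divide)
  ultimately have "1 / 4 \<le> (Im z)\<^sup>2" by linarith
  then show ?thesis using zz(3) power2_le_imp_le[of "1 / 2" "Im z"] by (simp add: power_divide)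
qed

text \<open>The domain is covered by boxes of width 1 and height 1/2, the n-th of which starts at
  height (n + 1)/2, where the density is at most 4/(n + 1)^2.\<close>

lemma finite_hyperbolic_area: "emeasure hyperbolic_measure std_fund_domain < \<infinity>"
proof -
  define B where "B n = cbox (Complex (- 1 / 2) (real (Suc n) / 2)) (Complex (1 / 2) (real (Suc n) / 2 + 1 / 2))" for n
  have [measurable]: "B n \<in> sets borel" for n by (simp add: B_def)
  have inB: "z \<in> B n \<longleftrightarrow> \<bar>Re z\<bar> \<le> 1 / 2 \<and> real (Suc n) / 2 \<le> Im z \<and> Im z \<le> real (Suc n) / 2 + 1 / 2" for z n
    by (auto simp: B_def in_cbox_complex_iff)
  have cover: "std_fund_domain \<subseteq> (\<Union>n. B n)"
  proof
    fix z assume z: "z \<in> std_fund_domain"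
    then have zz: "\<bar>Re z\<bar> \<le> 1 / 2" "1 \<le> cmod z" "Im z > 0" by (auto simp: std_fund_domain_def)
    have im: "1 / 2 \<le> Im z" by (rule fund_domain_Im[OF z])
    define n where "n = nat \<lfloor>2 * Im z\<rfloor> - 1"
    have "\<lfloor>2 * Im z\<rfloor> \<ge> 1" using im by (simp add: le_floor_iff)
    then have "real (Suc n) = of_int \<lfloor>2 * Im z\<rfloor>" by (simp add: n_def)
    moreover have "of_int \<lfloor>2 * Im z\<rfloor> \<le> 2 * Im z" "2 * Im z < of_int \<lfloor>2 * Im z\<rfloor> + 1" by linarith+
    ultimately have "real (Suc n) \<le> 2 * Im z" "2 * Im z \<le> real (Suc n) + 1" by simp_all
    then have "real (Suc n) / 2 \<le> Im z \<and> Im z \<le> real (Suc n) / 2 + 1 / 2" by (simp add: field_simps)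
    then have "z \<in> B n" using zz(1) unfolding inB by blast
    then show "z \<in> (\<Union>n. B n)" by blast
  qed
  have "emeasure hyperbolic_measure (B n) \<le> ennreal (2 / (real (Suc n))\<^sup>2)" for n
  proof -
    have "emeasure hyperbolic_measure (B n) = (\<integral>\<^sup>+z\<in>B n. indicator uhp z * ennreal (1 / (Im z)\<^sup>2) \<partial>lborel)"
      unfolding hyperbolic_measure_def by (rule emeasure_density) auto
    also have "\<dots> \<le> (\<integral>\<^sup>+z. ennreal (4 / (real (Suc n))\<^sup>2) * indicator (B n) z \<partial>lborel)"
    proof (rule nn_integral_mono)
      fix z :: complex
      have "1 / (Im z)\<^sup>2 \<le> 4 / (real (Suc n))\<^sup>2" if "z \<in> B n"
      proof -
        have "0 < real (Suc n) / 2" "real (Suc n) / 2 \<le> Im z" using that by (auto simp: inB)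
        then have "1 / (Im z)\<^sup>2 \<le> 1 / (real (Suc n) / 2)\<^sup>2"
          by (intro divide_left_mono power_mono mult_pos_pos zero_less_power) auto
        then show ?thesis by (simp add: power_divide)
      qed
      then show "indicator uhp z * ennreal (1 / (Im z)\<^sup>2) * indicator (B n) z \<le> ennreal (4 / (real (Suc n))\<^sup>2) * indicator (B n) z"
        by (auto simp: indicator_def intro!: ennreal_leI simp del: of_nat_Suc)
    qed
    also have "\<dots> = ennreal (4 / (real (Suc n))\<^sup>2) * emeasure lborel (B n)"
      by (rule nn_integral_cmult_indicator) simp
    also have "emeasure lborel (B n) = ennreal (1 / 2)"
      unfolding B_def by (subst emeasure_lborel_cbox) (auto simp: Basis_complex_def)
    also have "ennreal (4 / (real (Suc n))\<^sup>2) * ennreal (1 / 2) = ennreal (2 / (real (Suc n))\<^sup>2)"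
      by (subst ennreal_mult'[symmetric]) simp_all
    finally show ?thesis .
  qed
  note each = this
  have "emeasure hyperbolic_measure std_fund_domain \<le> emeasure hyperbolic_measure (\<Union>n. B n)"
    by (rule emeasure_mono[OF cover]) auto
  also have "\<dots> \<le> (\<Sum>n. emeasure hyperbolic_measure (B n))"
    by (rule emeasure_subadditive_countably) auto
  also have "\<dots> \<le> (\<Sum>n. ennreal (2 / (real (Suc n))\<^sup>2))"
    by (rule suminf_le[OF each]) auto
  also have "\<dots> = ennreal (\<Sum>n. 2 / (real (Suc n))\<^sup>2)"
  proof (rule suminf_ennreal2)
    have "summable (\<lambda>n. inverse ((real (Suc n))\<^sup>2))"
      using inverse_power_summable[of 2, where ?'a = real] by (subst summable_Suc_iff) simp
    from summable_mult[OF this, of 2] show "summable (\<lambda>n. 2 / (real (Suc n))\<^sup>2)"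
      by (simp add: divide_inverse)
  qed simp
  also have "\<dots> < \<infinity>" by simp
  finally show ?thesis .
qed

text \<open>The Petersson norm with values in \<open>ennreal\<close>, the form in which nonnegative
  integrals can be unfolded.\<close>

definition sq_norm :: "nat \<Rightarrow> nat \<Rightarrow> (complex \<Rightarrow> complex) \<Rightarrow> ennreal" where
  "sq_norm k N f = orbit_integral N (\<lambda>z. ennreal ((hnorm k f z)\<^sup>2))"

locale form_space =
  fixes k N :: nat
  assumes N4: "4 dvd N" and Npos: "N > 0"
begin

abbreviation "S \<equiv> cusp_forms k N"

lemmas S_iff = cusp_forms_iff[OF N4 Npos, where k = k]

lemma S_add: "f \<in> S \<Longrightarrow> g \<in> S \<Longrightarrow> (\<lambda>z. f z + g z) \<in> S"
  by (rule cusp_forms_add[OF N4 Npos])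

lemma S_scale: "f \<in> S \<Longrightarrow> (\<lambda>z. x * f z) \<in> S"
  by (rule cusp_forms_scale[OF N4 Npos])

lemma S_measurable: "f \<in> S \<Longrightarrow> f \<in> borel_measurable borel"
  unfolding S_iff by (intro cusp_form_measurable) auto

definition density_term :: "(complex \<Rightarrow> complex) \<Rightarrow> (complex \<Rightarrow> complex) \<Rightarrow> (real^2^2) set \<Rightarrow> complex \<Rightarrow> complex" where
  "density_term f g C z = indicator std_fund_domain z *\<^sub>R
     (petersson_integrand k f g (moebius (coset_rep C) z) / of_real ((Im z)\<^sup>2))"

lemma petersson_eq: "petersson k N f g = (\<Sum>C\<in>Gamma0_cosets N. LINT z|lborel. density_term f g C z)"
  unfolding petersson_def set_lebesgue_integral_def density_term_def coset_rep_def ..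

lemma hnorm_bounded:
  assumes "f \<in> S" "A \<in> Gamma0 1"
  shows "\<exists>M\<ge>0. \<forall>z. 1 / 2 \<le> Im z \<longrightarrow> hnorm k f (moebius A z) \<le> M"
proof -
  obtain a b c d where A: "A = mat2 (of_int a) (of_int b) (of_int c) (of_int d)" "a * d - b * c = 1"
    using assms(2) by (elim Gamma0_E)
  obtain C e where e: "e > 0" and C: "\<And>z. 1 / 2 \<le> Im z \<Longrightarrow> hnorm k f (mob a b c d z) \<le> C * exp (- e * Im z)"
    using assms(1) A(2) unfolding S_iff cusp_decay_def by (metis half_gt_zero_iff zero_less_one)
  have "hnorm k f (moebius A z) \<le> \<bar>C\<bar>" if "1 / 2 \<le> Im z" for z
  proof -
    have "hnorm k f (moebius A z) \<le> C * exp (- e * Im z)" using C[OF that] by (simp add: A moebius_int)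
    also have "\<dots> \<le> \<bar>C\<bar> * exp (- e * Im z)" by (intro mult_right_mono) auto
    also have "\<dots> \<le> \<bar>C\<bar> * 1" using e that by (intro mult_left_mono) auto
    finally show ?thesis by simp
  qed
  then show ?thesis by (intro exI[of _ "\<bar>C\<bar>"]) auto
qed

lemma powr_half_weight: "x powr (real k + 1 / 2) = x powr (real k / 2 + 1 / 4) * x powr (real k / 2 + 1 / 4)"
proof -
  have "real k / 2 + 1 / 4 + (real k / 2 + 1 / 4) = real k + 1 / 2" by simp
  then show ?thesis by (simp only: powr_add[symmetric])
qed

lemma norm_integrand: "cmod (petersson_integrand k f g w) = hnorm k f w * hnorm k g w"
  by (simp add: petersson_integrand_def hnorm_def norm_mult powr_half_weight)

lemma measurable_density_term:
  assumes "f \<in> S" "g \<in> S"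
  shows "density_term f g C \<in> borel_measurable borel"
proof -
  note [measurable] = S_measurable[OF assms(1)] S_measurable[OF assms(2)]
  have [measurable]: "cnj \<in> borel_measurable borel" "(of_real :: real \<Rightarrow> complex) \<in> borel_measurable borel"
    by (intro borel_measurable_continuous_onI continuous_intros)+
  show ?thesis unfolding density_term_def petersson_integrand_def by measurable
qed

text \<open>\<open>hnorm\<close> is bounded on every translate of the domain, by decay at the cusps,
  and the domain has finite area.\<close>

lemma integrable_density_term:
  assumes "f \<in> S" "g \<in> S" "C \<in> Gamma0_cosets N"
  shows "integrable lborel (density_term f g C)"
proof -
  obtain M where M: "M \<ge> 0" "\<And>z. 1 / 2 \<le> Im z \<Longrightarrow> hnorm k f (moebius (coset_rep C) z) \<le> M"
    using hnorm_bounded[OF assms(1) coset_rep(2)[OF assms(3)]] by blast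
  obtain M' where M': "M' \<ge> 0" "\<And>z. 1 / 2 \<le> Im z \<Longrightarrow> hnorm k g (moebius (coset_rep C) z) \<le> M'"
    using hnorm_bounded[OF assms(2) coset_rep(2)[OF assms(3)]] by blast
  define D where "D z = indicator std_fund_domain z * (M * M' / (Im z)\<^sup>2)" for z :: complex
  have "integrable lborel D"
  proof (rule integrableI_nonneg)
    show "D \<in> borel_measurable lborel" unfolding D_def by measurable
    show "AE z in lborel. 0 \<le> D z" using M M' by (simp add: D_def)
    have "(\<integral>\<^sup>+z. ennreal (D z) \<partial>lborel) = (\<integral>\<^sup>+z. ennreal (M * M') * (indicator uhp z * ennreal (1 / (Im z)\<^sup>2) * indicator std_fund_domain z) \<partial>lborel)"
      using M M' by (intro nn_integral_cong) (auto simp: D_def indicator_def std_fund_domain_def ennreal_mult'[symmetric])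
    also have "\<dots> = ennreal (M * M') * (\<integral>\<^sup>+z. indicator uhp z * ennreal (1 / (Im z)\<^sup>2) * indicator std_fund_domain z \<partial>lborel)"
      by (rule nn_integral_cmult) measurable
    also have "(\<integral>\<^sup>+z. indicator uhp z * ennreal (1 / (Im z)\<^sup>2) * indicator std_fund_domain z \<partial>lborel) = emeasure hyperbolic_measure std_fund_domain"
      unfolding hyperbolic_measure_def by (rule emeasure_density[symmetric]) auto
    also have "ennreal (M * M') * \<dots> < \<infinity>"
      using finite_hyperbolic_area by (simp add: ennreal_mult_less_top)
    finally show "(\<integral>\<^sup>+z. ennreal (D z) \<partial>lborel) < \<infinity>" .
  qed
  moreover have "AE z in lborel. norm (density_term f g C z) \<le> norm (D z)"
  proof (rule AE_I2)
    fix z :: complex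
    show "norm (density_term f g C z) \<le> norm (D z)"
    proof (cases "z \<in> std_fund_domain")
      case True
      have "hnorm k f (moebius (coset_rep C) z) * hnorm k g (moebius (coset_rep C) z) \<le> M * M'"
        using M M' fund_domain_Im[OF True] by (intro mult_mono) auto
      then show ?thesis
        using M(1) M'(1) True by (simp add: density_term_def D_def norm_divide norm_integrand norm_power divide_right_mono)
    qed (simp add: density_term_def)
  qed
  moreover have "density_term f g C \<in> borel_measurable lborel"
    using measurable_density_term[OF assms(1,2)] by simp
  ultimately show ?thesis using Bochner_Integration.integrable_bound by blast
qed

lemma petersson_add:
  assumes "f \<in> S" "g \<in> S" "h \<in> S"
  shows "petersson k N (\<lambda>z. f z + g z) h = petersson k N f h + petersson k N g h"
proof -
  have e: "density_term (\<lambda>z. f z + g z) h C = (\<lambda>z. density_term f h C z + density_term g h C z)" for C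
    by (rule ext) (simp add: density_term_def petersson_integrand_def distrib_right add_divide_distrib scaleR_add_right)
  show ?thesis
    unfolding petersson_eq e sum.distrib[symmetric]
    by (rule sum.cong[OF refl], rule Bochner_Integration.integral_add) (use assms in \<open>auto intro: integrable_density_term\<close>)
qed

lemma petersson_scale: "petersson k N (\<lambda>z. x * f z) g = x * petersson k N f g"
proof -
  have e: "density_term (\<lambda>z. x * f z) g C = (\<lambda>z. x * density_term f g C z)" for C
    by (rule ext) (simp add: density_term_def petersson_integrand_def mult.assoc)
  show ?thesis unfolding petersson_eq e sum_distrib_left by simp
qed

lemma petersson_cnj: "petersson k N g f = cnj (petersson k N f g)"
proof -
  have e: "density_term g f C = (\<lambda>z. cnj (density_term f g C z))" for C
    by (rule ext) (simp add: density_term_def petersson_integrand_def mult.commute)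
  show ?thesis unfolding petersson_eq e cnj_sum by simp
qed

lemma petersson_add_right:
  "f \<in> S \<Longrightarrow> g \<in> S \<Longrightarrow> h \<in> S \<Longrightarrow> petersson k N h (\<lambda>z. f z + g z) = petersson k N h f + petersson k N h g"
  by (subst petersson_cnj, subst petersson_add) (simp_all add: petersson_cnj[symmetric])

lemma petersson_scale_right: "petersson k N g (\<lambda>z. x * f z) = cnj x * petersson k N g f"
  by (subst petersson_cnj, subst petersson_scale) (simp add: petersson_cnj[symmetric])

text \<open>The bridge from the extended norm, for which isometries are established, to the
  complex-valued product.\<close>

lemma sq_norm_petersson:
  assumes "f \<in> S"
  shows "\<exists>r\<ge>0. petersson k N f f = of_real r \<and> sq_norm k N f = ennreal r"
proof -
  define D where "D C z = indicator std_fund_domain z * ((hnorm k f (moebius (coset_rep C) z))\<^sup>2 / (Im z)\<^sup>2)" for C z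
  have D: "density_term f f C z = of_real (D C z)" for C z
  proof -
    have "petersson_integrand k f f w = of_real ((hnorm k f w)\<^sup>2)" for w
    proof -
      have "Im w powr (real k + 1 / 2) = (Im w powr (real k / 2 + 1 / 4))\<^sup>2"
        unfolding power2_eq_square by (rule powr_half_weight)
      moreover have "f w * cnj (f w) = of_real ((cmod (f w))\<^sup>2)" by (rule complex_norm_square[symmetric])
      ultimately show ?thesis by (simp add: petersson_integrand_def hnorm_def power_mult_distrib)
    qed
    then show ?thesis by (simp add: density_term_def D_def indicator_def)
  qed
  have int: "integrable lborel (D C)" if "C \<in> Gamma0_cosets N" for C
    using integrable_density_term[OF assms assms that] unfolding D complex_of_real_integrable_eq by simp
  define r where "r = (\<Sum>C\<in>Gamma0_cosets N. LINT z|lborel. D C z)"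
  have D0: "D C z \<ge> 0" for C z by (simp add: D_def)
  have "r \<ge> 0" unfolding r_def by (intro sum_nonneg Bochner_Integration.integral_nonneg D0)
  moreover have "petersson k N f f = of_real r"
    unfolding petersson_eq D r_def of_real_sum by simp
  moreover have "sq_norm k N f = ennreal r"
  proof -
    have [measurable]: "f \<in> borel_measurable borel" by (rule S_measurable[OF assms])
    have [measurable]: "hnorm k f \<in> borel_measurable borel" unfolding hnorm_def by measurable
    have "sq_norm k N f = (\<Sum>C\<in>Gamma0_cosets N. \<integral>\<^sup>+z. ennreal (D C z) \<partial>lborel)"
      unfolding sq_norm_def orbit_integral_def hyperbolic_measure_def
    proof (rule sum.cong[OF refl])
      fix C
      show "(\<integral>\<^sup>+z. indicator std_fund_domain z * ennreal ((hnorm k f (moebius (coset_rep C) z))\<^sup>2) \<partial>density lborel (\<lambda>z. indicator uhp z * ennreal (1 / (Im z)\<^sup>2))) = (\<integral>\<^sup>+z. ennreal (D C z) \<partial>lborel)"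
        by (subst nn_integral_density)
           (auto intro!: nn_integral_cong simp: D_def indicator_def std_fund_domain_def ennreal_mult'[symmetric])
    qed
    also have "\<dots> = (\<Sum>C\<in>Gamma0_cosets N. ennreal (LINT z|lborel. D C z))"
      by (intro sum.cong refl nn_integral_eq_integral int) (simp_all add: D0)
    also have "\<dots> = ennreal r"
      unfolding r_def by (rule sum_ennreal) (intro Bochner_Integration.integral_nonneg D0)
    finally show ?thesis .
  qed
  ultimately show ?thesis by blast
qed

text \<open>Norm 0 makes one translate of f vanish almost everywhere on the open domain F. Its
  nonvanishing set there is open and negligible, hence empty, and analytic continuation spreads the
  zero to the half-plane.\<close>

lemma petersson_definite:
  assumes f: "f \<in> S" and 0: "petersson k N f f = 0"
  shows "f = (\<lambda>z. 0)"
proof -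
  have "sq_norm k N f = 0" using sq_norm_petersson[OF f] 0 by auto
  have [measurable]: "f \<in> borel_measurable borel" by (rule S_measurable[OF f])
  have [measurable]: "hnorm k f \<in> borel_measurable borel" unfolding hnorm_def by measurable
  have hol: "f holomorphic_on uhp" and zero: "\<And>z. Im z \<le> 0 \<Longrightarrow> f z = 0" using f by (auto simp: S_iff)
  define C where "C = (\<lambda>X. X ** mat 1) ` Gamma0 N"
  have C: "C \<in> Gamma0_cosets N" unfolding C_def Gamma0_cosets_def using Gamma0_one by blast
  \<comment> \<open>Even for the trivial coset the representative is picked by \<open>SOME\<close>,
    so f has to be pulled back along R.\<close>
  define R where "R = coset_rep C"
  have R: "R \<in> Gamma0 1" using coset_rep(2)[OF C] by (simp add: R_def)
  obtain a b c d where R_eq: "R = mat2 (of_int a) (of_int b) (of_int c) (of_int d)" "a * d - b * c = 1"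
    using R by (elim Gamma0_E)
  have "(\<integral>\<^sup>+z. indicator std_fund_domain z * ennreal ((hnorm k f (moebius R z))\<^sup>2) \<partial>hyperbolic_measure) = 0"
    using \<open>sq_norm k N f = 0\<close> C finite_Gamma0_cosets[OF Npos] unfolding sq_norm_def orbit_integral_def R_def by (simp add: sum_nonneg_eq_0_iff)
  then have "AE z in hyperbolic_measure. indicator std_fund_domain z * ennreal ((hnorm k f (moebius R z))\<^sup>2) = 0"
    by (subst (asm) nn_integral_0_iff_AE) auto
  then have "AE z in lborel. 0 < indicator uhp z * ennreal (1 / (Im z)\<^sup>2) \<longrightarrow> indicator std_fund_domain z * ennreal ((hnorm k f (moebius R z))\<^sup>2) = 0"
    unfolding hyperbolic_measure_def by (subst (asm) AE_density) auto
  define F where "F = {z. \<bar>Re z\<bar> < 1 / 2 \<and> 1 < cmod z \<and> 0 < Im z}"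
  have "open F" unfolding F_def by (intro open_Collect_conj open_Collect_less continuous_intros)
  have "2 * \<i> \<in> F" by (simp add: F_def norm_mult)
  define g where "g z = f (mob a b c d z)" for z
  have ghol: "g holomorphic_on uhp"
  proof -
    have "(f \<circ> mob a b c d) holomorphic_on uhp"
      by (rule holomorphic_on_compose_gen[OF holomorphic_mob[OF coprime_det[OF R_eq(2)]] hol])
         (use mob_uhp[OF R_eq(2)] in auto)
    then show ?thesis by (simp add: o_def g_def[abs_def])
  qed
  define U where "U = {z \<in> F. g z \<noteq> 0}"
  have "open U"
  proof -
    have "continuous_on F g"
      by (rule continuous_on_subset[OF holomorphic_on_imp_continuous_on[OF ghol]]) (auto simp: F_def)
    then have "open (F \<inter> g -` (- {0}))" using \<open>open F\<close> by (rule continuous_open_preimage) auto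
    moreover have "F \<inter> g -` (- {0}) = U" by (auto simp: U_def)
    ultimately show ?thesis by simp
  qed
  have "AE z in lborel. z \<notin> U"
    using \<open>AE z in lborel. 0 < indicator uhp z * ennreal (1 / (Im z)\<^sup>2) \<longrightarrow> _\<close>
  proof eventually_elim
    case (elim z)
    show ?case
    proof
      assume z: "z \<in> U"
      then have zF: "z \<in> std_fund_domain" "Im z > 0" by (auto simp: U_def F_def std_fund_domain_def)
      then have "hnorm k f (moebius R z) = 0" using elim by (auto simp: indicator_def)
      moreover have "Im (mob a b c d z) > 0" by (rule mob_uhp[OF R_eq(2) zF(2)])
      ultimately have "g z = 0" by (simp add: R_eq moebius_int hnorm_def g_def)
      then show False using z by (simp add: U_def)
    qed
  qed
  then have "U \<in> null_sets lborel" using \<open>open U\<close> by (subst (asm) AE_iff_null_sets[symmetric]) auto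
  then have "negligible U" unfolding negligible_iff_null_sets by (rule null_sets_completionI)
  then have "U = {}" using open_not_negligible[OF \<open>open U\<close>] by blast
  then have gF: "g z = 0" if "z \<in> F" for z using that by (auto simp: U_def)
  have "g z = 0" if "z \<in> uhp" for z
  proof (rule analytic_continuation_open[of F uhp g "\<lambda>_. 0"])
    show "F \<noteq> {}" using \<open>2 * \<i> \<in> F\<close> by blast
    show "F \<subseteq> uhp" by (auto simp: F_def)
  qed (use gF ghol \<open>open F\<close> that open_uhp connected_uhp in auto)
  then have g0: "g z = 0" if "Im z > 0" for z using that by simp
  have "f w = 0" if w: "Im w > 0" for w
  proof -
    define v where "v = moebius (inv2 R) w"
    have v: "Im v > 0" unfolding v_def by (rule moebius_uhp) (use R w in simp_all)
    have "moebius R v = w" unfolding v_def by (rule moebius_inv2') (use R w in simp_all)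
    then have "g v = f w" by (simp add: g_def R_eq(1) moebius_int)
    then show ?thesis using g0[OF v] by simp
  qed
  then show ?thesis using zero by (auto simp: fun_eq_iff not_less[symmetric])
qed

end

section \<open>Norms under normalising matrices\<close>

lemma matrix2_scaleR:
  fixes A B :: "real^2^2"
  shows "(x *\<^sub>R A) ** B = x *\<^sub>R (A ** B)" "A ** (x *\<^sub>R B) = x *\<^sub>R (A ** B)"
  by (simp_all add: vec_eq_iff forall_2 matrix_matrix_mult_def sum_2 algebra_simps)

lemma inv2_mult_gen: "inv2 B ** B = det B *\<^sub>R mat 1" "B ** inv2 B = det B *\<^sub>R mat 1"
proof -
  have "inv2 B ** B = det B *\<^sub>R mat 1 \<and> B ** inv2 B = det B *\<^sub>R mat 1"
  proof (cases B rule: mat2_cases)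
    case (1 a b c d)
    have "x *\<^sub>R mat2 1 0 0 1 = (mat2 x 0 0 x :: real^2^2)" for x
      by (simp add: vec_eq_iff forall_2)
    then show ?thesis unfolding 1 by (simp add: mat2_mult mat2_one[symmetric] mult.commute)
  qed
  then show "inv2 B ** B = det B *\<^sub>R mat 1" "B ** inv2 B = det B *\<^sub>R mat 1" by blast+
qed

text \<open>Normalising is phrased as A' B = B A, which can be checked entrywise also for the
  determinants 4 and 16. Having this for B and for its adjugate makes conjugation a
  bijection.\<close>

lemma orbit_integral_conj:
  assumes N: "N > 0" and H: "H \<in> borel_measurable borel"
    and inv: "\<And>A z. A \<in> Gamma0 N \<Longrightarrow> Im z > 0 \<Longrightarrow> H (moebius A z) = H z"
    and det: "det B > 0"
    and ex1: "\<And>A. A \<in> Gamma0 N \<Longrightarrow> \<exists>A'\<in>Gamma0 N. A' ** inv2 B = inv2 B ** A"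
    and ex2: "\<And>A. A \<in> Gamma0 N \<Longrightarrow> \<exists>A'\<in>Gamma0 N. A' ** B = B ** A"
  shows "orbit_integral N (\<lambda>z. H (moebius B z)) = orbit_integral N H"
proof (rule orbit_integral_normalizer[OF N H inv det])
  define s where "s A = (1 / det B) *\<^sub>R (inv2 B ** A ** B)" for A
  define s' where "s' A = (1 / det B) *\<^sub>R (B ** A ** inv2 B)" for A
  have d0: "det B \<noteq> 0" using det by simp
  have s: "s A \<in> Gamma0 N" "s A ** inv2 B = inv2 B ** A" if "A \<in> Gamma0 N" for A
  proof -
    from ex1[OF that] obtain A' where A': "A' \<in> Gamma0 N" "A' ** inv2 B = inv2 B ** A" by blast
    have "s A = (1 / det B) *\<^sub>R (A' ** inv2 B ** B)" by (simp add: s_def A'(2))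
    also have "\<dots> = A'" using d0 by (simp add: matrix_mul_assoc[symmetric] inv2_mult_gen matrix2_scaleR)
    finally show "s A \<in> Gamma0 N" "s A ** inv2 B = inv2 B ** A" using A' by simp_all
  qed
  have s': "s' A \<in> Gamma0 N" if "A \<in> Gamma0 N" for A
  proof -
    from ex2[OF that] obtain A' where A': "A' \<in> Gamma0 N" "A' ** B = B ** A" by blast
    have "s' A = (1 / det B) *\<^sub>R (A' ** B ** inv2 B)" by (simp add: s'_def A'(2))
    also have "\<dots> = A'" using d0 by (simp add: matrix_mul_assoc[symmetric] inv2_mult_gen matrix2_scaleR)
    finally show ?thesis using A' by simp
  qed
  have ss: "s' (s A) = A" "s (s' A) = A" for A
  proof -
    have "s' (s A) = (1 / det B * (1 / det B)) *\<^sub>R ((B ** inv2 B) ** A ** (B ** inv2 B))"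
      by (simp add: s_def s'_def matrix2_scaleR matrix_mul_assoc)
    then show "s' (s A) = A" using d0 by (simp add: inv2_mult_gen matrix2_scaleR)
    have "s (s' A) = (1 / det B * (1 / det B)) *\<^sub>R ((inv2 B ** B) ** A ** (inv2 B ** B))"
      by (simp add: s_def s'_def matrix2_scaleR matrix_mul_assoc)
    then show "s (s' A) = A" using d0 by (simp add: inv2_mult_gen matrix2_scaleR)
  qed
  show "bij_betw s (Gamma0 N) (Gamma0 N)"
    by (rule bij_betw_byWitness[of _ s']) (use s s' ss in auto)
  show "moebius (inv2 B) (moebius A z) = moebius (s A) (moebius (inv2 B) z)" if "A \<in> Gamma0 N" "Im z > 0" for A z
  proof -
    have "moebius (inv2 B) (moebius A z) = moebius (inv2 B ** A) z"
      by (rule moebius_mult[symmetric]) (use that in auto)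
    also have "\<dots> = moebius (s A ** inv2 B) z" using s(2)[OF that(1)] by simp
    also have "\<dots> = moebius (s A) (moebius (inv2 B) z)"
      by (rule moebius_mult) (use that det in auto)
    finally show ?thesis .
  qed
qed

lemma Gamma0_odd_entries:
  assumes "a * d - b * c = (1 :: int)" "even c"
  shows "odd a" "odd d"
proof -
  have "odd (a * d - b * c)" using assms(1) by simp
  then have "odd (a * d)" using assms(2) by simp
  then show "odd a" "odd d" by auto
qed

text \<open>Conjugation turns c into c + e(a - d) - e^2 b. For even N the entries a and d are odd,
  so a - d is even. This covers e = 4 and -4 at level 8, and e = 8 and -8 at level 16.\<close>

lemma Gamma0_conj_lower:
  assumes A: "A \<in> Gamma0 N" and N: "even N" "int N dvd 2 * e" "int N dvd e * e"
  shows "\<exists>A'\<in>Gamma0 N. A' ** mat2 1 0 (of_int e) 1 = mat2 1 0 (of_int e) 1 ** A"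
proof -
  obtain a b c d where A_eq: "A = mat2 (of_int a) (of_int b) (of_int c) (of_int d)" and det: "a * d - b * c = 1" and c: "int N dvd c"
    using A by (elim Gamma0_E)
  have "even c" using c N(1) by (meson dvd_trans even_of_nat)
  then have "odd a" "odd d" using Gamma0_odd_entries[OF det] by auto
  then obtain x where x: "a - d = 2 * x" by (metis even_diff_nat even_add evenE odd_even_add diff_add_cancel even_diff)
  define c' where "c' = c + e * (a - d) - e * e * b"
  have "int N dvd c'"
    unfolding c'_def x using c N by (intro dvd_diff dvd_add) (auto simp: mult.assoc[symmetric] mult.commute[of e 2] intro: dvd_mult2)
  moreover have "(a - b * e) * (d + b * e) - b * c' = 1"
    using det by (simp add: c'_def algebra_simps)
  ultimately have "mat2 (of_int (a - b * e)) (of_int b) (of_int c') (of_int (d + b * e)) \<in> Gamma0 N"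
    by (simp only: Gamma0_mat2 simp_thms)
  moreover have "mat2 (of_int (a - b * e)) (of_int b) (of_int c') (of_int (d + b * e)) ** mat2 1 0 (of_int e) 1 = mat2 1 0 (of_int e) (1 :: real) ** A"
    by (simp add: A_eq mat2_mult mat2_eq_iff c'_def algebra_simps)
  ultimately show ?thesis by blast
qed

text \<open>Conjugation by the translation by e/2 turns b into b + e(d - a)/2 - c/4, which is
  integral since a and d are odd and 16 divides c.\<close>

lemma Gamma0_conj_half_shift:
  assumes A: "A \<in> Gamma0 16" and e: "e = 1 \<or> e = -1"
  shows "\<exists>A'\<in>Gamma0 16. A' ** mat2 2 (of_int e) 0 2 = mat2 2 (of_int e) 0 2 ** A"
proof -
  obtain a b c d where A_eq: "A = mat2 (of_int a) (of_int b) (of_int c) (of_int d)" and det: "a * d - b * c = 1" and c: "int 16 dvd c"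
    using A by (elim Gamma0_E)
  obtain c0 where c0: "c = 16 * c0" using c by auto
  have "odd a" "odd d" using Gamma0_odd_entries[OF det] c0 by auto
  then obtain x where x: "d = a + 2 * x"
  proof -
    assume *: "\<And>x. d = a + 2 * x \<Longrightarrow> thesis"
    have "even (d - a)" using \<open>odd a\<close> \<open>odd d\<close> by simp
    then obtain x where "d - a = 2 * x" by blast
    then show thesis using *[of x] by simp
  qed
  define a' b' d' where "a' = a + e * 8 * c0" and "b' = b + e * x - 4 * c0" and "d' = d - e * 8 * c0"
  have ee: "e * e = 1" using e by auto
  have "a' * d' - b' * c = a * d - b * c + 8 * c0 * e * (d - a) - 64 * c0 * c0 * (e * e) - 16 * c0 * e * x + 64 * c0 * c0"
    by (simp add: a'_def b'_def d'_def c0 algebra_simps)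
  also have "\<dots> = 1" unfolding ee using det x by (simp add: algebra_simps)
  finally have "mat2 (of_int a') (of_int b') (of_int c) (of_int d') \<in> Gamma0 16"
    using c by (simp only: Gamma0_mat2 simp_thms)
  moreover have "mat2 (of_int a') (of_int b') (of_int c) (of_int d') ** mat2 2 (of_int e) 0 2 = mat2 2 (of_int e) 0 (2 :: real) ** A"
  proof -
    have ee': "real_of_int e * (real_of_int e * y) = y" for y using e by auto
    show ?thesis by (simp add: A_eq mat2_mult mat2_eq_iff a'_def b'_def d'_def c0 x algebra_simps ee')
  qed
  ultimately show ?thesis by blast
qed

lemma Gamma0_conj_fricke:
  assumes A: "A \<in> Gamma0 16" and e: "e = 1 \<or> e = -1"
  shows "\<exists>A'\<in>Gamma0 16. A' ** mat2 0 (of_int (- e)) (of_int (16 * e)) 0 = mat2 0 (of_int (- e)) (of_int (16 * e)) 0 ** A"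
proof -
  obtain a b c d where A_eq: "A = mat2 (of_int a) (of_int b) (of_int c) (of_int d)" and det: "a * d - b * c = 1" and c: "int 16 dvd c"
    using A by (elim Gamma0_E)
  obtain c0 where c0: "c = 16 * c0" using c by auto
  have "d * a - (- c0) * (- 16 * b) = 1" using det by (simp add: c0 algebra_simps)
  then have "mat2 (of_int d) (of_int (- c0)) (of_int (- 16 * b)) (of_int a) \<in> Gamma0 16"
    by (simp only: Gamma0_mat2) simp
  moreover have "mat2 (of_int d) (of_int (- c0)) (of_int (- 16 * b)) (of_int a) ** mat2 0 (of_int (- e)) (of_int (16 * e)) 0
      = mat2 0 (of_int (- e)) (of_int (16 * e)) (0 :: real) ** A"
    by (simp add: A_eq mat2_mult mat2_eq_iff c0)
  ultimately show ?thesis by blast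
qed

lemma measurable_hnorm:
  assumes [measurable]: "f \<in> borel_measurable borel"
  shows "hnorm k f \<in> borel_measurable borel"
  unfolding hnorm_def by measurable

lemma sq_norm_weight:
  assumes "f \<in> borel_measurable borel"
  shows "sq_norm k N f = (\<integral>\<^sup>+z. ennreal ((hnorm k f z)\<^sup>2) * orbit_weight N z \<partial>hyperbolic_measure)"
proof -
  note [measurable] = measurable_hnorm[OF assms]
  show ?thesis unfolding sq_norm_def by (rule orbit_integral_weight) measurable
qed

text \<open>The norm sees g only through \<open>hnorm\<close>, so a slash enters as composition with
  B and a constant c. Conjugation by B has to preserve the group.\<close>

lemma sq_norm_conj:
  assumes N: "4 dvd N" "N > 0" and f: "f \<in> borel_measurable borel" "theta_inv k N f" and g: "g \<in> borel_measurable borel"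
    and c: "c \<ge> 0" "\<And>z. Im z > 0 \<Longrightarrow> hnorm k g z = c * hnorm k f (moebius B z)"
    and det: "det B > 0"
    and ex1: "\<And>A. A \<in> Gamma0 N \<Longrightarrow> \<exists>A'\<in>Gamma0 N. A' ** inv2 B = inv2 B ** A"
    and ex2: "\<And>A. A \<in> Gamma0 N \<Longrightarrow> \<exists>A'\<in>Gamma0 N. A' ** B = B ** A"
  shows "sq_norm k N g = ennreal (c\<^sup>2) * sq_norm k N f"
proof -
  note [measurable] = measurable_hnorm[OF f(1)] measurable_hnorm[OF g]
  have "sq_norm k N g = (\<integral>\<^sup>+z. ennreal ((hnorm k g z)\<^sup>2) * orbit_weight N z \<partial>hyperbolic_measure)"
    by (rule sq_norm_weight[OF g])
  also have "\<dots> = (\<integral>\<^sup>+z. ennreal (c\<^sup>2) * (ennreal ((hnorm k f (moebius B z))\<^sup>2) * orbit_weight N z) \<partial>hyperbolic_measure)"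
    by (rule nn_integral_cong_uhp) (simp add: c power_mult_distrib ennreal_mult mult.assoc)
  also have "\<dots> = ennreal (c\<^sup>2) * (\<integral>\<^sup>+z. ennreal ((hnorm k f (moebius B z))\<^sup>2) * orbit_weight N z \<partial>hyperbolic_measure)"
    by (rule nn_integral_cmult) measurable
  also have "(\<integral>\<^sup>+z. ennreal ((hnorm k f (moebius B z))\<^sup>2) * orbit_weight N z \<partial>hyperbolic_measure)
      = orbit_integral N (\<lambda>z. ennreal ((hnorm k f (moebius B z))\<^sup>2))"
    by (rule orbit_integral_weight[symmetric]) measurable
  also have "\<dots> = orbit_integral N (\<lambda>z. ennreal ((hnorm k f z)\<^sup>2))"
  proof (rule orbit_integral_conj[OF N(2) _ _ det ex1 ex2])
    show "ennreal ((hnorm k f (moebius A z))\<^sup>2) = ennreal ((hnorm k f z)\<^sup>2)" if "A \<in> Gamma0 N" "Im z > 0" for A z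
    proof -
      from that(1) obtain a b c d where "A = mat2 (of_int a) (of_int b) (of_int c) (of_int d)" "a * d - b * c = 1" "int N dvd c"
        by (elim Gamma0_E)
      then show ?thesis using hnorm_theta_inv[OF f(2) N(1) _ _ that(2)] by (simp add: moebius_int)
    qed
  qed auto
  finally show ?thesis by (simp add: sq_norm_def)
qed

lemma sq_norm_index2:
  assumes f: "f \<in> borel_measurable borel" "theta_inv k 8 f"
  shows "sq_norm k 16 f = 2 * sq_norm k 8 f"
  unfolding sq_norm_def
proof (rule orbit_integral_index2)
  note [measurable] = measurable_hnorm[OF f(1)]
  show "(\<lambda>z. ennreal ((hnorm k f z)\<^sup>2)) \<in> borel_measurable borel" by measurable
  show "ennreal ((hnorm k f (moebius A z))\<^sup>2) = ennreal ((hnorm k f z)\<^sup>2)" if "A \<in> Gamma0 8" "Im z > 0" for A z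
  proof -
    from that(1) obtain a b c d where "A = mat2 (of_int a) (of_int b) (of_int c) (of_int d)" "a * d - b * c = 1" "int 8 dvd c"
      by (elim Gamma0_E)
    then show ?thesis using hnorm_theta_inv[OF f(2) _ _ _ that(2)] by (simp add: moebius_int)
  qed
  let ?B = "mat2 (of_int 1) (of_int 0) (of_int 8) (of_int 1) :: real^2^2"
  show "?B \<in> Gamma0 8" unfolding Gamma0_mat2 by simp
  show "A ** inv2 ?B \<in> Gamma0 16 \<longleftrightarrow> A \<notin> Gamma0 16" if A: "A \<in> Gamma0 8" for A
  proof -
    obtain a b c d where A_eq: "A = mat2 (of_int a) (of_int b) (of_int c) (of_int d)" and det: "a * d - b * c = 1" and c: "int 8 dvd c"
      using A by (elim Gamma0_E)
    obtain c0 where c0: "c = 8 * c0" using c by auto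
    have "odd d" using Gamma0_odd_entries[OF det] c0 by auto
    have AB: "A ** inv2 ?B = mat2 (of_int (a - 8 * b)) (of_int b) (of_int (c - 8 * d)) (of_int d)"
      by (simp add: A_eq mat2_mult mat2_eq_iff)
    have "(a - 8 * b) * d - b * (c - 8 * d) = 1" using det by (simp add: algebra_simps)
    moreover have "int 16 dvd c - 8 * d \<longleftrightarrow> \<not> int 16 dvd c"
      using \<open>odd d\<close> unfolding c0 by (simp; presburger)
    moreover have "A \<in> Gamma0 16 \<longleftrightarrow> int 16 dvd c" unfolding A_eq Gamma0_mat2 using det by simp
    ultimately show ?thesis unfolding AB Gamma0_mat2 by simp
  qed
  show "Gamma0 16 \<subseteq> Gamma0 8" by (rule Gamma0_mono) simp
qed auto

lemma sq_norm_V4: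
  assumes "f \<in> cusp_forms k 8"
  shows "sq_norm k 8 (V4 k f) = sq_norm k 8 f"
proof -
  interpret F: form_space k 8 by unfold_locales auto
  let ?B = "mat2 1 0 (of_int 4) 1 :: real^2^2"
  have iB: "inv2 ?B = mat2 1 0 (of_int (- 4)) 1" by simp
  have mB: "moebius ?B = mob 1 0 4 1" using moebius_int[of 1 0 4 1] by simp
  have "sq_norm k 8 (V4 k f) = ennreal (1\<^sup>2) * sq_norm k 8 f"
  proof (rule sq_norm_conj)
    show "hnorm k (V4 k f) z = 1 * hnorm k f (moebius ?B z)" if "Im z > 0" for z
    proof -
      have "hnorm k (V4 k f) z = hnorm k (eval_at k 4 f) z" using that by (simp add: hnorm_def V4_eq)
      then show ?thesis unfolding mB using hnorm_eval_at[of 4 z k f] that by simp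
    qed
    show "\<exists>A'\<in>Gamma0 8. A' ** inv2 ?B = inv2 ?B ** A" if "A \<in> Gamma0 8" for A
      unfolding iB by (rule Gamma0_conj_lower[OF that]) auto
    show "\<exists>A'\<in>Gamma0 8. A' ** ?B = ?B ** A" if "A \<in> Gamma0 8" for A
      by (rule Gamma0_conj_lower[OF that]) auto
  qed (use F.S_measurable[OF assms] F.S_measurable[OF V4_cusp_forms[OF assms]] assms in \<open>auto simp: cusp_forms_iff\<close>)
  then show ?thesis by simp
qed

lemma cmod_kap: "cmod (kap k) ^ 2 = 1 / 2"
proof -
  have "cmod (iK k) = 1" by (simp add: iK_def norm_power norm_mult)
  then have "cmod (kap k * kap k) = 1 / 2" unfolding kap_square by (simp add: norm_divide)
  then show ?thesis by (simp add: norm_mult power2_eq_square)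
qed

lemma sq_norm_parallelogram:
  assumes f: "f \<in> borel_measurable borel" and g: "g \<in> borel_measurable borel"
  shows "sq_norm k N (\<lambda>z. f z + g z) + sq_norm k N (\<lambda>z. f z - g z) = 2 * sq_norm k N f + 2 * sq_norm k N g"
proof -
  note [measurable] = f g measurable_hnorm[OF f] measurable_hnorm[OF g]
  have [measurable]: "(\<lambda>z. f z + g z) \<in> borel_measurable borel" "(\<lambda>z. f z - g z) \<in> borel_measurable borel" by measurable
  note [measurable] = measurable_hnorm[OF this(1)] measurable_hnorm[OF this(2)]
  have par: "(hnorm k (\<lambda>z. f z + g z) z)\<^sup>2 + (hnorm k (\<lambda>z. f z - g z) z)\<^sup>2 = 2 * (hnorm k f z)\<^sup>2 + 2 * (hnorm k g z)\<^sup>2" for z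
  proof -
    have "(cmod (f z + g z))\<^sup>2 + (cmod (f z - g z))\<^sup>2 = 2 * (cmod (f z))\<^sup>2 + 2 * (cmod (g z))\<^sup>2"
      by (simp only: cmod_power2) (simp add: power2_eq_square algebra_simps)
    then show ?thesis unfolding hnorm_def power_mult_distrib by (simp add: distrib_right[symmetric] mult.assoc[symmetric])
  qed
  let ?w = "orbit_weight N"
  have "sq_norm k N (\<lambda>z. f z + g z) + sq_norm k N (\<lambda>z. f z - g z)
     = (\<integral>\<^sup>+z. ennreal ((hnorm k (\<lambda>z. f z + g z) z)\<^sup>2) * ?w z + ennreal ((hnorm k (\<lambda>z. f z - g z) z)\<^sup>2) * ?w z \<partial>hyperbolic_measure)"
    by (subst (1 2) sq_norm_weight) (auto intro!: nn_integral_add[symmetric])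
  also have "\<dots> = (\<integral>\<^sup>+z. 2 * (ennreal ((hnorm k f z)\<^sup>2) * ?w z) + 2 * (ennreal ((hnorm k g z)\<^sup>2) * ?w z) \<partial>hyperbolic_measure)"
  proof (rule nn_integral_cong)
    fix z
    have "ennreal ((hnorm k (\<lambda>z. f z + g z) z)\<^sup>2) + ennreal ((hnorm k (\<lambda>z. f z - g z) z)\<^sup>2) = 2 * ennreal ((hnorm k f z)\<^sup>2) + 2 * ennreal ((hnorm k g z)\<^sup>2)"
      using par[of z] by (simp add: ennreal_plus[symmetric] ennreal_mult'[symmetric] ennreal_numeral[symmetric] del: ennreal_plus ennreal_numeral)
    then show "ennreal ((hnorm k (\<lambda>z. f z + g z) z)\<^sup>2) * ?w z + ennreal ((hnorm k (\<lambda>z. f z - g z) z)\<^sup>2) * ?w z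
      = 2 * (ennreal ((hnorm k f z)\<^sup>2) * ?w z) + 2 * (ennreal ((hnorm k g z)\<^sup>2) * ?w z)"
      by (simp add: distrib_right[symmetric] mult.assoc[symmetric])
  qed
  also have "\<dots> = 2 * sq_norm k N f + 2 * sq_norm k N g"
    unfolding sq_norm_weight[OF f] sq_norm_weight[OF g] by (subst nn_integral_add) (auto simp: nn_integral_cmult)
  finally show ?thesis .
qed

text \<open>\<open>W8\<close> is, up to Fricke's involution, the averaging $f \mapsto f + f(\cdot + 1/2)$. As
  $f + f(\cdot + 1/2)$ and $f - f(\cdot + 1/2)$ are exchanged by the slash with $z \mapsto z / (1 - 8 z)$, they
  have the same norm, which the parallelogram law then expresses through $f$.\<close>

lemma sq_norm_W8:
  assumes nm: "16 * n - m = (1 :: int)" and f8: "f \<in> cusp_forms k 8"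
  shows "sq_norm k 8 (W8 k n m f) = sq_norm k 8 f"
proof -
  interpret F: form_space k 8 by unfold_locales auto
  define G where "G = W8 k n m f"
  have G8: "G \<in> cusp_forms k 8" unfolding G_def by (rule W8_cusp_forms[OF nm f8])
  have f: "f holomorphic_on uhp" "theta_inv k 8 f" "theta_inv k 16 f" "f \<in> borel_measurable borel"
    using f8 F.S_measurable[OF f8] theta_inv_mono[of k 8 f 16] by (auto simp: cusp_forms_iff)
  have G: "theta_inv k 8 G" "theta_inv k 16 G" "G \<in> borel_measurable borel"
    using G8 F.S_measurable[OF G8] theta_inv_mono[of k 8 G 16] by (auto simp: cusp_forms_iff)
  define u where "u = (\<lambda>z. f z + half_shift f z)"
  define v where "v = (\<lambda>z. f z - half_shift f z)"
  have hm: "half_shift f \<in> borel_measurable borel"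
    unfolding half_shift_def using f(4) by measurable
  have um: "u \<in> borel_measurable borel" "v \<in> borel_measurable borel"
    unfolding u_def v_def using f(4) hm by measurable
  have GW: "G z = kap k * fricke k 2 u z" for z
    unfolding G_def W8_eq[OF nm f(2)] u_def by (simp add: fricke_def algebra_simps)
  have kap0: "kap k \<noteq> 0" using cmod_kap[of k] by auto
  let ?W = "mat2 0 (of_int (- 1)) (of_int (16 * 1)) 0 :: real^2^2"
  have mW: "moebius ?W z = - 1 / (of_nat (4 * 2\<^sup>2) * z)" for z by (simp add: moebius_def)
  have iW: "inv2 ?W = mat2 0 (of_int (- (- 1))) (of_int (16 * (- 1))) 0" by simp
  \<comment> \<open>\<open>fricke_fricke\<close> inverts the relation \<open>GW\<close>. The
    invariance of u at level 16 is obtained along this way from that of G.\<close>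
  have ueq: "u z = (iK k / kap k) * fricke k 2 G z" if "Im z > 0" for z
  proof -
    have "fricke k 2 G z = kap k * fricke k 2 (fricke k 2 u) z"
      unfolding fricke_def[of k 2 G] fricke_def[of k 2 "fricke k 2 u"] GW by simp
    also have "\<dots> = kap k * (inverse (iK k) * u z)" using fricke_fricke[of 2 z k u] that by simp
    finally show ?thesis using kap0 by simp
  qed
  have u16: "theta_inv k 16 u"
  proof -
    have "theta_inv k 16 (fricke k 2 G)" using theta_inv_fricke[of 2 k G] G(2) by simp
    from theta_inv_cong[OF theta_inv_scale[OF this] ueq] show ?thesis .
  qed
  define x where "x = cmod (iK k / kap k)"
  have x2: "x\<^sup>2 = 2"
  proof -
    have "cmod (iK k) = 1" by (simp add: iK_def norm_power norm_mult)
    then show ?thesis unfolding x_def norm_divide power_divide cmod_kap by simp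
  qed
  have n1: "sq_norm k 16 u = 2 * sq_norm k 16 G"
  proof -
    have "sq_norm k 16 u = ennreal (x\<^sup>2) * sq_norm k 16 G"
    proof (rule sq_norm_conj[OF _ _ G(3,2) um(1)])
      show "hnorm k u z = x * hnorm k G (moebius ?W z)" if "Im z > 0" for z
      proof -
        have "hnorm k u z = x * hnorm k (fricke k 2 G) z"
          unfolding hnorm_def ueq[OF that] x_def norm_mult by simp
        then show ?thesis unfolding mW using hnorm_fricke[of 2 z k G] that by simp
      qed
      show "\<exists>A'\<in>Gamma0 16. A' ** inv2 ?W = inv2 ?W ** A" if "A \<in> Gamma0 16" for A
        unfolding iW by (rule Gamma0_conj_fricke[OF that]) auto
      show "\<exists>A'\<in>Gamma0 16. A' ** ?W = ?W ** A" if "A \<in> Gamma0 16" for A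
        by (rule Gamma0_conj_fricke[OF that]) auto
    qed (auto simp: x_def)
    then show ?thesis unfolding x2 by simp
  qed
  have n2: "sq_norm k 16 v = sq_norm k 16 u"
  proof -
    let ?D = "mat2 1 0 (of_int (- 8)) 1 :: real^2^2"
    have iD: "inv2 ?D = mat2 1 0 (of_int (- (- 8))) 1" by simp
    have mD: "moebius ?D = mob 1 0 (- 8) 1" using moebius_int[of 1 0 "-8" 1] by simp
    have "sq_norm k 16 v = ennreal (1\<^sup>2) * sq_norm k 16 u"
    proof (rule sq_norm_conj[OF _ _ um(1) u16 um(2)])
      show "hnorm k v z = 1 * hnorm k u (moebius ?D z)" if z: "Im z > 0" for z
      proof -
        \<comment> \<open>The slash fixes f, which has level 8, and changes the sign of its half
          shift; so u goes over into v.\<close>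
        have "eval_at k (- 8) u z = eval_at k (- 8) f z + eval_at k (- 8) (half_shift f) z"
          by (simp add: eval_at_def u_def algebra_simps)
        also have "\<dots> = v z"
          using eval_at_fixes[OF f(2) _ _ z, of "-8"] eval_at_half_shift[OF f(2) z] by (simp add: v_def)
        finally have "hnorm k v z = hnorm k (eval_at k (- 8) u) z" by (simp add: hnorm_def)
        then show ?thesis unfolding mD using hnorm_eval_at[of "-8" z k u] z by simp
      qed
      show "\<exists>A'\<in>Gamma0 16. A' ** inv2 ?D = inv2 ?D ** A" if "A \<in> Gamma0 16" for A
        unfolding iD by (rule Gamma0_conj_lower[OF that]) auto
      show "\<exists>A'\<in>Gamma0 16. A' ** ?D = ?D ** A" if "A \<in> Gamma0 16" for A
        by (rule Gamma0_conj_lower[OF that]) auto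
    qed auto
    then show ?thesis by simp
  qed
  have n3: "sq_norm k 16 (half_shift f) = sq_norm k 16 f"
  proof -
    let ?T = "mat2 2 (of_int 1) 0 2 :: real^2^2"
    have iT: "inv2 ?T = mat2 2 (of_int (- 1)) 0 2" by simp
    have "sq_norm k 16 (half_shift f) = ennreal (1\<^sup>2) * sq_norm k 16 f"
    proof (rule sq_norm_conj[OF _ _ f(4,3) hm])
      show "hnorm k (half_shift f) z = 1 * hnorm k f (moebius ?T z)" for z
        by (simp add: hnorm_half_shift moebius_def add_divide_distrib)
      show "\<exists>A'\<in>Gamma0 16. A' ** inv2 ?T = inv2 ?T ** A" if "A \<in> Gamma0 16" for A
        unfolding iT by (rule Gamma0_conj_half_shift[OF that]) auto
      show "\<exists>A'\<in>Gamma0 16. A' ** ?T = ?T ** A" if "A \<in> Gamma0 16" for A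
        by (rule Gamma0_conj_half_shift[OF that]) auto
    qed auto
    then show ?thesis by simp
  qed
  have "sq_norm k 16 u + sq_norm k 16 v = 2 * sq_norm k 16 f + 2 * sq_norm k 16 (half_shift f)"
    unfolding u_def v_def by (rule sq_norm_parallelogram[OF f(4) hm])
  \<comment> \<open>The norms of u and v are each twice that of G, and the half shift of f has the
    norm of f.\<close>
  then have "4 * sq_norm k 16 G = 4 * sq_norm k 16 f"
    unfolding n2 n3 n1 by (simp add: distrib_right[symmetric] mult.assoc[symmetric])
  then have "4 * (2 * sq_norm k 8 G) = 4 * (2 * sq_norm k 8 f)"
    unfolding sq_norm_index2[OF G(3,1)] sq_norm_index2[OF f(4,2)] .
  then have "8 * sq_norm k 8 G = 8 * sq_norm k 8 f" by (simp add: mult.assoc[symmetric])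
  then show ?thesis unfolding G_def by (subst (asm) ennreal_mult_cancel_left) simp
qed

section \<open>Polarisation and orthogonal projection\<close>

context form_space
begin

text \<open>Polarisation: norms of sums with g give the sum of the product and its conjugate, and
  replacing g by i g gives their difference.\<close>

lemma isometry_preserves_petersson:
  assumes T: "\<And>f. f \<in> S \<Longrightarrow> T f \<in> S" "\<And>f. f \<in> S \<Longrightarrow> sq_norm k N (T f) = sq_norm k N f"
    and lin: "\<And>f g. f \<in> S \<Longrightarrow> g \<in> S \<Longrightarrow> T (\<lambda>z. f z + g z) = (\<lambda>z. T f z + T g z)"
      "\<And>f x. f \<in> S \<Longrightarrow> T (\<lambda>z. x * f z) = (\<lambda>z. x * T f z)"
    and fg: "f \<in> S" "g \<in> S"
  shows "petersson k N (T f) (T g) = petersson k N f g"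
proof -
  have diag: "petersson k N (T h) (T h) = petersson k N h h" if "h \<in> S" for h
    using sq_norm_petersson[OF that] sq_norm_petersson[OF T(1)[OF that]] T(2)[OF that] by auto
  have pol: "petersson k N (T f) (T h) + petersson k N (T h) (T f) = petersson k N f h + petersson k N h f"
    if h: "h \<in> S" for h
    using diag[OF S_add[OF fg(1) h]] diag[OF fg(1)] diag[OF h] fg(1) h
    by (simp add: lin petersson_add petersson_add_right S_add T)
  note 1 = pol[OF fg(2)] and 2 = pol[OF S_scale[OF fg(2), of \<i>]]
  have "\<i> * (petersson k N (T g) (T f) - petersson k N (T f) (T g)) = \<i> * (petersson k N g f - petersson k N f g)"
    using 2 by (simp add: lin fg petersson_scale petersson_scale_right algebra_simps)
  then have "petersson k N (T g) (T f) - petersson k N (T f) (T g) = petersson k N g f - petersson k N f g" by simp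
  moreover have "2 * x = (x + y) - (y - x)" for x y :: complex by simp
  ultimately have "2 * petersson k N (T f) (T g) = 2 * petersson k N f g"
    using 1 by metis
  then show ?thesis by simp
qed

lemma petersson_zero: "petersson k N f (\<lambda>z. 0) = 0" "petersson k N (\<lambda>z. 0) f = 0"
  using petersson_scale_right[of f 0 f] petersson_scale[of 0 f f] by simp_all

text \<open>Finite dimension enters as finitely many functionals with trivial common kernel. The
  kernel P' of one of them is P or has codimension one; in the second case a Gram-Schmidt step
  supplies a vector v0 of P orthogonal to P', and the projection to P is the one to P' plus the one
  to v0.\<close>

lemma projection_exists:
  fixes \<phi> :: "'i \<Rightarrow> (complex \<Rightarrow> complex) \<Rightarrow> complex"
  assumes "finite I" and "P \<subseteq> S" "(\<lambda>z. 0) \<in> P"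
    and "\<And>p q. p \<in> P \<Longrightarrow> q \<in> P \<Longrightarrow> (\<lambda>z. p z + q z) \<in> P" "\<And>p x. p \<in> P \<Longrightarrow> (\<lambda>z. x * p z) \<in> P"
    and "\<And>i p q. i \<in> I \<Longrightarrow> p \<in> P \<Longrightarrow> q \<in> P \<Longrightarrow> \<phi> i (\<lambda>z. p z + q z) = \<phi> i p + \<phi> i q"
      "\<And>i p x. i \<in> I \<Longrightarrow> p \<in> P \<Longrightarrow> \<phi> i (\<lambda>z. x * p z) = x * \<phi> i p"
    and "\<And>p. p \<in> P \<Longrightarrow> (\<And>i. i \<in> I \<Longrightarrow> \<phi> i p = 0) \<Longrightarrow> p = (\<lambda>z. 0)"
    and "f \<in> S"
  shows "\<exists>p\<in>P. \<forall>q\<in>P. petersson k N (\<lambda>z. f z + (-1) * p z) q = 0"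
  using assms
proof (induction I arbitrary: P f rule: finite_induct)
  case empty
  then have "P = {\<lambda>z. 0}" by blast
  then show ?case by (auto simp: petersson_zero)
next
  case (insert i I)
  note PS = insert.prems(1) and P0 = insert.prems(2) and Padd = insert.prems(3) and Pscale = insert.prems(4)
    and ladd = insert.prems(5) and lscale = insert.prems(6) and ker = insert.prems(7) and f = insert.prems(8)
  define P' where "P' = {p \<in> P. \<phi> i p = 0}"
  have l0: "\<phi> j (\<lambda>z. 0) = 0" if "j \<in> insert i I" for j
    using lscale[OF that P0, of 0] by simp
  have IH: "\<exists>p\<in>P'. \<forall>q\<in>P'. petersson k N (\<lambda>z. h z + (-1) * p z) q = 0" if "h \<in> S" for h
  proof (rule insert.IH)
    show "P' \<subseteq> S" using PS by (auto simp: P'_def)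
    show "(\<lambda>z. 0) \<in> P'" using P0 l0 by (simp add: P'_def)
    show "(\<lambda>z. p z + q z) \<in> P'" if "p \<in> P'" "q \<in> P'" for p q
      using that Padd[of p q] ladd[of i p q] by (simp add: P'_def)
    show "(\<lambda>z. x * p z) \<in> P'" if "p \<in> P'" for p x
      using that Pscale[of p x] lscale[of i p x] by (simp add: P'_def)
    show "\<phi> j (\<lambda>z. p z + q z) = \<phi> j p + \<phi> j q" if "j \<in> I" "p \<in> P'" "q \<in> P'" for j p q
      using that ladd[of j p q] by (simp add: P'_def)
    show "\<phi> j (\<lambda>z. x * p z) = x * \<phi> j p" if "j \<in> I" "p \<in> P'" for j p x
      using that lscale[of j p x] by (simp add: P'_def)
    show "p = (\<lambda>z. 0)" if "p \<in> P'" "\<And>j. j \<in> I \<Longrightarrow> \<phi> j p = 0" for p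
      using that ker[of p] by (auto simp: P'_def)
  qed (rule that)
  show ?case
  proof (cases "\<forall>p\<in>P. \<phi> i p = 0")
    case True
    then have "P' = P" by (auto simp: P'_def)
    then show ?thesis using IH[OF f] by simp
  next
    case False
    then obtain v where v: "v \<in> P" "\<phi> i v \<noteq> 0" by blast
    have vS: "v \<in> S" using v PS by blast
    obtain w where w: "w \<in> P'" "\<And>q. q \<in> P' \<Longrightarrow> petersson k N (\<lambda>z. v z + (-1) * w z) q = 0"
      using IH[OF vS] by blast
    define v0 where "v0 = (\<lambda>z. v z + (-1) * w z)"
    have wP: "w \<in> P" "\<phi> i w = 0" using w by (auto simp: P'_def)
    have v0P: "v0 \<in> P" unfolding v0_def by (intro Padd Pscale v wP)
    have lv0: "\<phi> i v0 = \<phi> i v"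
      unfolding v0_def using ladd[OF insertI1 v(1) Pscale[OF wP(1)], of "-1"] lscale[OF insertI1 wP(1), of "-1"] wP by simp
    have v0S: "v0 \<in> S" using v0P PS by blast
    define s where "s = petersson k N v0 v0"
    have "v0 \<noteq> (\<lambda>z. 0)" using lv0 v(2) l0 by auto
    then have s0: "s \<noteq> 0" unfolding s_def using petersson_definite[OF v0S] by blast
    obtain p' where p': "p' \<in> P'" "\<And>q. q \<in> P' \<Longrightarrow> petersson k N (\<lambda>z. f z + (-1) * p' z) q = 0"
      using IH[OF f] by blast
    have p'P: "p' \<in> P" and p'S: "p' \<in> S" using p' PS by (auto simp: P'_def)
    define t where "t = petersson k N f v0 / s"
    define p where "p = (\<lambda>z. p' z + t * v0 z)"
    have pP: "p \<in> P" unfolding p_def by (intro Padd Pscale p'P v0P)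
    define r where "r = (\<lambda>z. f z + (-1) * p z)"
    have pS: "p \<in> S" using pP PS by blast
    have rS: "r \<in> S" unfolding r_def by (intro S_add S_scale f pS)
    have r_eq: "r = (\<lambda>z. (f z + (-1) * p' z) + (- t) * v0 z)" by (simp add: r_def p_def algebra_simps)
    have fp'S: "(\<lambda>z. f z + (-1) * p' z) \<in> S" by (intro S_add S_scale f p'S)
    have rP': "petersson k N r q = 0" if q: "q \<in> P'" for q
    proof -
      have qS: "q \<in> S" using q PS by (auto simp: P'_def)
      have "petersson k N v0 q = 0" unfolding v0_def by (rule w(2)[OF q])
      then show ?thesis unfolding r_eq petersson_add[OF fp'S S_scale[OF v0S] qS] petersson_scale
        using p'(2)[OF q] by simp
    qed
    have rv0: "petersson k N r v0 = 0"
    proof -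
      have "petersson k N p' v0 = 0"
        using w(2)[OF p'(1)] by (subst petersson_cnj) (simp add: v0_def)
      moreover have "petersson k N (\<lambda>z. f z + (-1) * p' z) v0 = petersson k N f v0 + (-1) * petersson k N p' v0"
        unfolding petersson_add[OF f S_scale[OF p'S] v0S] petersson_scale ..
      ultimately show ?thesis
        unfolding r_eq petersson_add[OF fp'S S_scale[OF v0S] v0S] petersson_scale using s0 by (simp add: t_def s_def)
    qed
    have "petersson k N r q = 0" if q: "q \<in> P" for q
    proof -
      \<comment> \<open>Subtracting the multiple of v0 with the same value of the functional brings
        q into P': this is how P' and v0 span P.\<close>
      define c where "c = \<phi> i q / \<phi> i v0"
      define q' where "q' = (\<lambda>z. q z + (- c) * v0 z)"
      have q'P: "q' \<in> P" unfolding q'_def by (intro Padd Pscale q v0P)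
      have "\<phi> i q' = 0"
        unfolding q'_def using ladd[OF insertI1 q Pscale[OF v0P], of "- c"] lscale[OF insertI1 v0P, of "- c"] lv0 v(2)
        by (simp add: c_def)
      then have q'P': "q' \<in> P'" using q'P by (simp add: P'_def)
      have q'S: "q' \<in> S" using q'P PS by blast
      have "q = (\<lambda>z. q' z + c * v0 z)" by (simp add: q'_def)
      then have "petersson k N r q = petersson k N r q' + cnj c * petersson k N r v0"
        using petersson_add_right[OF q'S S_scale[OF v0S] rS, of c] petersson_scale_right by simp
      then show ?thesis using rP'[OF q'P'] rv0 by simp
    qed
    then show ?thesis using pP unfolding r_def by blast
  qed
qed

end

section \<open>Finite dimensionality and the minus spaces\<close>

lemma slash_add: "slash k A \<phi> (\<lambda>z. f z + g z) = (\<lambda>z. slash k A \<phi> f z + slash k A \<phi> g z)"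
  and slash_scale: "slash k A \<phi> (\<lambda>z. x * f z) = (\<lambda>z. x * slash k A \<phi> f z)"
  by (auto simp: slash_def distrib_right)

lemma W4_add: "W4 k n' m' (\<lambda>z. f z + g z) = (\<lambda>z. W4 k n' m' f z + W4 k n' m' g z)"
  and W4_scale: "W4 k n' m' (\<lambda>z. x * f z) = (\<lambda>z. x * W4 k n' m' f z)"
  unfolding W4_def slash_add slash_scale by (simp_all add: distrib_left mult.left_commute)

lemma W8_add: "W8 k n m (\<lambda>z. f z + g z) = (\<lambda>z. W8 k n m f z + W8 k n m g z)"
  and W8_scale: "W8 k n m (\<lambda>z. x * f z) = (\<lambda>z. x * W8 k n m f z)"
  unfolding W8_def slash_add slash_scale
  by (simp_all only: sum.distrib distrib_left sum_distrib_left mult.left_commute)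

text \<open>Cauchy's inequality on the circle of radius r bounds the n-th Taylor coefficient by
  K/r^n. On the circle of radius x r the n-th term is then at most K x^n, and only n \<ge> M
  contribute.\<close>

lemma holomorphic_tail_bound:
  assumes G: "G holomorphic_on ball 0 1" and r: "0 < r" "r < 1"
    and K: "\<And>q. cmod q = r \<Longrightarrow> cmod (G q) \<le> K"
    and van: "\<And>n. n < M \<Longrightarrow> (deriv ^^ n) G 0 = 0"
    and x: "0 \<le> x" "x < 1" and q: "cmod q = x * r"
  shows "cmod (G q) \<le> K * x ^ M / (1 - x)"
proof -
  define a where "a n = (deriv ^^ n) G 0 / fact n" for n
  have sub: "ball (0 :: complex) r \<subseteq> ball 0 1" "cball (0 :: complex) r \<subseteq> ball 0 1"
    using r by (auto simp: subset_eq)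
  have "x * r < 1 * 1" using x r by (intro mult_strict_mono') auto
  then have "cmod q < 1" using q by simp
  then have sums: "(\<lambda>n. a n * q ^ n) sums G q"
    using holomorphic_power_series[OF G, of q] by (simp add: a_def)
  have an: "cmod (a n) \<le> K / r ^ n" for n
  proof -
    have "cmod ((deriv ^^ n) G 0) \<le> fact n * K / r ^ n"
    proof (rule Cauchy_inequality)
      show "G holomorphic_on ball 0 r" by (rule holomorphic_on_subset[OF G sub(1)])
      show "continuous_on (cball 0 r) G"
        by (rule holomorphic_on_imp_continuous_on[OF holomorphic_on_subset[OF G sub(2)]])
    qed (use r K in auto)
    then show ?thesis by (simp add: a_def norm_divide field_simps)
  qed
  have bnd: "cmod (a n * q ^ n) \<le> K * x ^ n" for n
  proof -
    have "cmod (a n * q ^ n) \<le> K / r ^ n * (x * r) ^ n"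
      unfolding norm_mult norm_power q by (rule mult_right_mono[OF an]) (use x r in auto)
    also have "\<dots> = K * x ^ n" using r by (simp add: power_mult_distrib)
    finally show ?thesis .
  qed
  have "(\<lambda>n. a (n + M) * q ^ (n + M)) sums G q"
    using sums by (subst sums_zero_iff_shift) (auto simp: a_def van)
  moreover have "(\<lambda>n. K * x ^ M * x ^ n) sums (K * x ^ M * (1 / (1 - x)))"
    by (intro sums_mult geometric_sums) (use x in auto)
  moreover have "cmod (a (n + M) * q ^ (n + M)) \<le> K * x ^ M * x ^ n" for n
    using bnd[of "n + M"] by (simp add: power_add mult.assoc mult.commute[of "x ^ n"])
  ultimately have "cmod (G q) \<le> K * x ^ M * (1 / (1 - x))" by (rule norm_sums_le)
  then show ?thesis by simp
qed

text \<open>One function for every coset, so a cusp may be represented several times. These finitely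
  many functions, at heights at least 1/2, account for all values of \<open>hnorm\<close>.\<close>

definition cusp_slash :: "nat \<Rightarrow> (real^2^2) set \<Rightarrow> (complex \<Rightarrow> complex) \<Rightarrow> complex \<Rightarrow> complex" where
  "cusp_slash k C = slash k (coset_rep C)
     (\<lambda>z. csqrt (of_real (coset_rep C $ 2 $ 1) * z + of_real (coset_rep C $ 2 $ 2)))"

definition cusp_coeff :: "nat \<Rightarrow> nat \<Rightarrow> (real^2^2) set \<times> nat \<Rightarrow> (complex \<Rightarrow> complex) \<Rightarrow> complex" where
  "cusp_coeff k N = (\<lambda>(C, j) f. (deriv ^^ j) (qfun (4 * N) (cusp_slash k C f)) 0)"

context form_space
begin

lemma cusp_slash_int:
  assumes "C \<in> Gamma0_cosets N"
  shows "\<exists>a b c d. a * d - b * c = 1 \<and> coset_rep C = mat2 (of_int a) (of_int b) (of_int c) (of_int d) \<and>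
    cusp_slash k C f = slash k (mat2 (of_int a) (of_int b) (of_int c) (of_int d)) (\<lambda>z. csqrt (of_int c * z + of_int d)) f"
proof -
  obtain a b c d where "coset_rep C = mat2 (of_int a) (of_int b) (of_int c) (of_int d)" "a * d - b * c = 1"
    using coset_rep(2)[OF assms] by (elim Gamma0_E)
  then show ?thesis by (intro exI[of _ a] exI[of _ b] exI[of _ c] exI[of _ d]) (simp add: cusp_slash_def)
qed

lemma cusp_slash_props:
  assumes f: "f \<in> S" and C: "C \<in> Gamma0_cosets N"
  shows "Im z > 0 \<Longrightarrow> cusp_slash k C f (z + of_nat (4 * N)) = cusp_slash k C f z"
    "Im z > 0 \<Longrightarrow> hnorm k f (moebius (coset_rep C) z) = hnorm k (cusp_slash k C f) z"
    "qfun (4 * N) (cusp_slash k C f) holomorphic_on ball 0 1"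
proof -
  obtain a b c d where det: "a * d - b * c = 1"
    and rep: "coset_rep C = mat2 (of_int a) (of_int b) (of_int c) (of_int d)"
    and F: "cusp_slash k C f = slash k (mat2 (of_int a) (of_int b) (of_int c) (of_int d)) (\<lambda>z. csqrt (of_int c * z + of_int d)) f"
    using cusp_slash_int[OF C] by metis
  have f': "f holomorphic_on uhp" "theta_inv k N f" "cusp_decay k f" using f by (auto simp: S_iff)
  show per: "Im z > 0 \<Longrightarrow> cusp_slash k C f (z + of_nat (4 * N)) = cusp_slash k C f z" for z
    unfolding F by (rule slash_periodic[OF f'(2) N4 Npos det])
  show "Im z > 0 \<Longrightarrow> hnorm k f (moebius (coset_rep C) z) = hnorm k (cusp_slash k C f) z"
    unfolding F rep moebius_int by (rule hnorm_csqrt_slash[OF det])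
  obtain D e where e: "e > 0" and D: "\<And>z. 1 \<le> Im z \<Longrightarrow> cmod (cusp_slash k C f z) \<le> D * exp (- e * Im z)"
    using slash_bound_of_decay[OF f'(3) det] unfolding F by blast
  have "cusp_slash k C f holomorphic_on uhp" unfolding F by (rule holomorphic_slash[OF f'(1) det])
  from qfun_holomorphic[OF _ this per e D] show "qfun (4 * N) (cusp_slash k C f) holomorphic_on ball 0 1"
    using Npos by simp
qed

lemma cusp_coeff_add:
  assumes "f \<in> S" "g \<in> S" "C \<in> Gamma0_cosets N"
  shows "cusp_coeff k N (C, j) (\<lambda>z. f z + g z) = cusp_coeff k N (C, j) f + cusp_coeff k N (C, j) g"
proof -
  have "qfun (4 * N) (cusp_slash k C (\<lambda>z. f z + g z)) = (\<lambda>q. qfun (4 * N) (cusp_slash k C f) q + qfun (4 * N) (cusp_slash k C g) q)"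
    by (auto simp: qfun_def cusp_slash_def slash_add)
  then show ?thesis
    using higher_deriv_add[OF cusp_slash_props(3)[OF assms(1,3)] cusp_slash_props(3)[OF assms(2,3)], of 0 j]
    by (simp add: cusp_coeff_def)
qed

lemma cusp_coeff_scale:
  assumes "f \<in> S" "C \<in> Gamma0_cosets N"
  shows "cusp_coeff k N (C, j) (\<lambda>z. x * f z) = x * cusp_coeff k N (C, j) f"
proof -
  have "qfun (4 * N) (cusp_slash k C (\<lambda>z. x * f z)) = (\<lambda>q. x * qfun (4 * N) (cusp_slash k C f) q)"
    by (auto simp: qfun_def cusp_slash_def slash_scale)
  then show ?thesis
    using higher_deriv_cmult[OF cusp_slash_props(3)[OF assms], of 0 j x] by (simp add: cusp_coeff_def)
qed

lemma hnorm_Gamma0: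
  assumes "f \<in> S" "A \<in> Gamma0 N" "Im z > 0"
  shows "hnorm k f (moebius A z) = hnorm k f z"
proof -
  obtain a b c d where "A = mat2 (of_int a) (of_int b) (of_int c) (of_int d)" "a * d - b * c = 1" "int N dvd c"
    using assms(2) by (elim Gamma0_E)
  then show ?thesis using hnorm_theta_inv[OF _ N4 _ _ assms(3), of k f] assms(1) by (simp add: S_iff moebius_int)
qed

text \<open>Let A move z into the standard domain. The representative of the coset of the inverse of
  A differs from that inverse by an element of \<open>Gamma0 N\<close>, under which
  \<open>hnorm\<close> is invariant.\<close>

lemma hnorm_reduce:
  assumes f: "f \<in> S" and z: "Im z > 0"
  shows "\<exists>C\<in>Gamma0_cosets N. \<exists>w. 1 / 2 \<le> Im w \<and> hnorm k f z = hnorm k f (moebius (coset_rep C) w)"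
proof -
  obtain A where A: "A \<in> Gamma0 1" "moebius A z \<in> std_fund_domain" using fund_domain_reachable[OF z] by blast
  have iA: "inv2 A \<in> Gamma0 1" by (rule Gamma0_inv[OF A(1)])
  define C where "C = (\<lambda>B. B ** inv2 A) ` Gamma0 N"
  have C: "C \<in> Gamma0_cosets N" using iA by (auto simp: C_def Gamma0_cosets_def)
  obtain X where X: "X \<in> Gamma0 N" "coset_rep C = X ** inv2 A" using coset_rep(1)[OF C] by (auto simp: C_def)
  have w: "Im (moebius A z) > 0" by (rule moebius_uhp) (use A z det_Gamma0 in auto)
  have "moebius (coset_rep C) (moebius A z) = moebius X (moebius (inv2 A) (moebius A z))"
    unfolding X(2) by (rule moebius_mult) (use w det_Gamma0[OF iA] in auto)
  also have "moebius (inv2 A) (moebius A z) = z" by (rule moebius_inv2) (use A z det_Gamma0 in auto)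
  finally have "hnorm k f z = hnorm k f (moebius (coset_rep C) (moebius A z))"
    using hnorm_Gamma0[OF f X(1) z] by simp
  then show ?thesis using C fund_domain_Im[OF A(2)] by blast
qed

lemma hnorm_bounded_uhp:
  assumes f: "f \<in> S"
  shows "\<exists>B. \<forall>z. Im z > 0 \<longrightarrow> hnorm k f z \<le> B"
proof -
  have "\<forall>C\<in>Gamma0_cosets N. \<exists>M\<ge>0. \<forall>z. 1 / 2 \<le> Im z \<longrightarrow> hnorm k f (moebius (coset_rep C) z) \<le> M"
    using hnorm_bounded[OF f] coset_rep(2) by blast
  then obtain M where M: "\<And>C. C \<in> Gamma0_cosets N \<Longrightarrow> M C \<ge> 0 \<and> (\<forall>z. 1 / 2 \<le> Im z \<longrightarrow> hnorm k f (moebius (coset_rep C) z) \<le> M C)"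
    by metis
  have "hnorm k f z \<le> sum M (Gamma0_cosets N)" if "Im z > 0" for z
  proof -
    from hnorm_reduce[OF f that] obtain C w
      where C: "C \<in> Gamma0_cosets N" "1 / 2 \<le> Im w" "hnorm k f z = hnorm k f (moebius (coset_rep C) w)" by blast
    then have "hnorm k f z \<le> M C" using M by simp
    also have "\<dots> \<le> sum M (Gamma0_cosets N)"
      by (rule member_le_sum) (use C M finite_Gamma0_cosets[OF Npos] in auto)
    finally show ?thesis .
  qed
  then show ?thesis by blast
qed

text \<open>If many Fourier coefficients vanish at every cusp, then Cauchy's estimates on the horocycle at
  half the height show that any bound for \<open>hnorm\<close> can be halved.\<close>

lemma hnorm_halve:
  assumes f: "f \<in> S" and B: "\<And>z. Im z > 0 \<Longrightarrow> hnorm k f z \<le> B"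
    and M: "2 powr (real k / 2 + 1 / 4) * exp (- pi / real (16 * N) * 2) ^ M / (1 - exp (- pi / real (16 * N) * 2)) \<le> 1 / 2"
    and van: "\<And>C j. C \<in> Gamma0_cosets N \<Longrightarrow> j < M \<Longrightarrow> cusp_coeff k N (C, j) f = 0"
    and z: "Im z > 0"
  shows "hnorm k f z \<le> B / 2"
proof -
  define p where "p = real k / 2 + 1 / 4"
  \<comment> \<open>The radius r below at the lowest height y = 1/2, namely exp(-pi/(8N)); larger
    heights only make r smaller.\<close>
  define x0 where "x0 = exp (- pi / real (16 * N) * 2)"
  have x0: "0 < x0" "x0 < 1" using Npos by (auto simp: x0_def)
  from hnorm_reduce[OF f z] obtain C w
    where C: "C \<in> Gamma0_cosets N" and w: "1 / 2 \<le> Im w" and eq: "hnorm k f z = hnorm k f (moebius (coset_rep C) w)" by blast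
  define F where "F = cusp_slash k C f"
  note F = cusp_slash_props[OF f C, folded F_def]
  define y where "y = Im w"
  have y: "y > 0" "1 / 2 \<le> y" using w by (auto simp: y_def)
  have B0: "0 \<le> B" using B[OF z] by (rule order_trans[rotated]) (simp add: hnorm_def)
  have FB: "cmod (F v) * Im v powr p \<le> B" if "Im v > 0" for v
  proof -
    have "cmod (F v) * Im v powr p = hnorm k f (moebius (coset_rep C) v)"
      using F(2)[OF that] by (simp add: hnorm_def p_def)
    also have "\<dots> \<le> B"
      by (intro B moebius_uhp) (use that coset_rep(2)[OF C] det_Gamma0 in auto)
    finally show ?thesis .
  qed
  \<comment> \<open>The circle of radius r is the horocycle at height y/2, while w, at height y, has
    |q| = r^2. So the tail bound is used with x = r, and halving the height costs the factor
    2^p.\<close>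
  define r where "r = exp (- (2 * pi * (y / 2) / real (4 * N)))"
  have r: "0 < r" "r < 1" using y Npos by (auto simp: r_def)
  have r_le: "r \<le> x0"
  proof -
    have "1 / 2 * (pi / real (4 * N)) \<le> y * (pi / real (4 * N))" by (rule mult_right_mono[OF y(2)]) simp
    then show ?thesis by (simp add: r_def x0_def mult.commute)
  qed
  have "cmod (qfun (4 * N) F q) \<le> B * (y / 2) powr (- p)" if q: "cmod q = r" for q
  proof -
    define v where "v = of_nat (4 * N) * Ln q / (2 * of_real pi * \<i>)"
    have q0: "q \<noteq> 0" using q r by auto
    have "Im v = - (real (4 * N) * ln r / (2 * pi))" unfolding v_def Im_qfun_arg using q0 q by (simp add: Re_Ln)
    also have "\<dots> = y / 2" using Npos by (simp add: r_def)
    finally have v: "Im v = y / 2" .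
    have "cmod (F v) * (y / 2) powr p \<le> B" using FB[of v] y v by simp
    then have "cmod (F v) \<le> B / (y / 2) powr p" using y by (simp add: pos_le_divide_eq)
    moreover have "qfun (4 * N) F q = F v" unfolding qfun_def v_def using q0 by (simp only: if_False)
    ultimately show ?thesis by (simp only: powr_minus divide_inverse)
  qed
  moreover define q where "q = exp (2 * of_real pi * \<i> * w / of_nat (4 * N))"
  have cq: "cmod q = r * r"
  proof -
    have "cmod q = exp (- (2 * pi * y / real (4 * N)))" by (simp add: q_def y_def)
    also have "\<dots> = r * r" unfolding r_def exp_add[symmetric] by simp
    finally show ?thesis .
  qed
  ultimately have "cmod (qfun (4 * N) F q) \<le> B * (y / 2) powr (- p) * r ^ M / (1 - r)"
    by (intro holomorphic_tail_bound[OF F(3) r]) (use r van[OF C] in \<open>auto simp: cusp_coeff_def F_def\<close>)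
  moreover have "qfun (4 * N) F q = F w"
    unfolding q_def by (rule qfun_exp) (use Npos F(1) y in \<open>auto simp: y_def\<close>)
  ultimately have "cmod (F w) * y powr p \<le> B * (y / 2) powr (- p) * r ^ M / (1 - r) * y powr p"
    by (intro mult_right_mono) auto
  also have "\<dots> = B * (2 powr p * r ^ M / (1 - r))"
  proof -
    have "(y / 2) powr (- p) * y powr p = 2 powr p"
      using y by (simp add: powr_divide powr_minus field_simps)
    moreover have "B * s * t / v * u = B * (s * u * t / v)" for s t u v :: real by simp
    ultimately show ?thesis by metis
  qed
  also have "\<dots> \<le> B * (2 powr p * x0 ^ M / (1 - x0))"
    using r r_le x0 B0 by (intro mult_left_mono frac_le power_mono) auto
  also have "\<dots> \<le> B * (1 / 2)" using M B0 unfolding x0_def[symmetric] p_def[symmetric] by (rule mult_left_mono)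
  finally show ?thesis unfolding eq using F(2)[of w] y by (simp add: hnorm_def p_def y_def)
qed

text \<open>M depends on k and N alone, so \<open>hnorm_halve\<close> applies again to each bound
  that it has produced, and the bounds tend to 0.\<close>

lemma sturm_bound:
  "\<exists>M. \<forall>f\<in>S. (\<forall>C\<in>Gamma0_cosets N. \<forall>j<M. cusp_coeff k N (C, j) f = 0) \<longrightarrow> f = (\<lambda>z. 0)"
proof -
  define x0 where "x0 = exp (- pi / real (16 * N) * 2)"
  define K where "K = 2 powr (real k / 2 + 1 / 4) / (1 - x0)"
  have x0: "0 < x0" "x0 < 1" using Npos by (auto simp: x0_def)
  have "(\<lambda>M. K * x0 ^ M) \<longlonglongrightarrow> K * 0" by (intro tendsto_intros LIMSEQ_power_zero) (use x0 in auto)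
  then have "\<forall>\<^sub>F M in sequentially. K * x0 ^ M < 1 / 2" by (rule order_tendstoD) simp
  then obtain M where M: "K * x0 ^ M < 1 / 2" by (auto simp: eventually_sequentially)
  have "f = (\<lambda>z. 0)" if f: "f \<in> S" and van: "\<forall>C\<in>Gamma0_cosets N. \<forall>j<M. cusp_coeff k N (C, j) f = 0" for f
  proof
    fix z
    obtain B where B: "\<And>z. Im z > 0 \<Longrightarrow> hnorm k f z \<le> B" using hnorm_bounded_uhp[OF f] by blast
    show "f z = 0"
    proof (cases "Im z > 0")
      case True
      have "Im z > 0 \<Longrightarrow> hnorm k f z \<le> B * (1 / 2) ^ n" for n z
      proof (induction n arbitrary: z)
        case (Suc n)
        have "hnorm k f z \<le> B * (1 / 2) ^ n / 2"
          by (rule hnorm_halve[OF f Suc.IH _ _ Suc.prems, of M]) (use M van in \<open>auto simp: K_def x0_def\<close>)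
        then show ?case by simp
      qed (use B in simp)
      moreover have "(\<lambda>n. B * (1 / 2) ^ n) \<longlonglongrightarrow> B * 0"
        by (intro tendsto_intros LIMSEQ_power_zero) auto
      ultimately have "hnorm k f z \<le> B * 0"
        using True by (intro tendsto_lowerbound[of _ "B * 0"] always_eventually) auto
      then have "cmod (f z) * Im z powr (real k / 2 + 1 / 4) \<le> 0" by (simp add: hnorm_def)
      moreover have "Im z powr (real k / 2 + 1 / 4) > 0" using True by simp
      ultimately have "cmod (f z) \<le> 0" by (simp add: mult_le_0_iff)
      then show ?thesis by simp
    next
      case False
      then show ?thesis using f by (simp add: S_iff)
    qed
  qed
  then show ?thesis by blast
qed

lemma orthogonal_decomposition:
  assumes P: "P \<subseteq> S" "(\<lambda>z. 0) \<in> P" "\<And>p q. p \<in> P \<Longrightarrow> q \<in> P \<Longrightarrow> (\<lambda>z. p z + q z) \<in> P"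
    "\<And>p x. p \<in> P \<Longrightarrow> (\<lambda>z. x * p z) \<in> P" and f: "f \<in> S"
  shows "\<exists>p\<in>P. \<exists>g\<in>orth_complement k N P. f = (\<lambda>z. p z + g z)"
proof -
  obtain M where M: "\<And>f. f \<in> S \<Longrightarrow> (\<And>C j. C \<in> Gamma0_cosets N \<Longrightarrow> j < M \<Longrightarrow> cusp_coeff k N (C, j) f = 0) \<Longrightarrow> f = (\<lambda>z. 0)"
    using sturm_bound by blast
  have "\<exists>p\<in>P. \<forall>q\<in>P. petersson k N (\<lambda>z. f z + (-1) * p z) q = 0"
  proof (rule projection_exists[where I = "Gamma0_cosets N \<times> {..<M}" and \<phi> = "cusp_coeff k N", OF _ P _ _ _ f])
    show "finite (Gamma0_cosets N \<times> {..<M})" using finite_Gamma0_cosets[OF Npos] by simp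
    show "cusp_coeff k N i (\<lambda>z. p z + q z) = cusp_coeff k N i p + cusp_coeff k N i q"
      if "i \<in> Gamma0_cosets N \<times> {..<M}" "p \<in> P" "q \<in> P" for i p q
      using that P(1) by (cases i) (auto intro!: cusp_coeff_add)
    show "cusp_coeff k N i (\<lambda>z. x * p z) = x * cusp_coeff k N i p"
      if "i \<in> Gamma0_cosets N \<times> {..<M}" "p \<in> P" for i p x
      using that P(1) by (cases i) (auto intro!: cusp_coeff_scale)
    show "p = (\<lambda>z. 0)" if "p \<in> P" "\<And>i. i \<in> Gamma0_cosets N \<times> {..<M} \<Longrightarrow> cusp_coeff k N i p = 0" for p
      using that P(1) by (intro M) auto
  qed
  then obtain p where p: "p \<in> P" "\<And>q. q \<in> P \<Longrightarrow> petersson k N (\<lambda>z. f z + (-1) * p z) q = 0" by blast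
  define g where "g = (\<lambda>z. f z + (-1) * p z)"
  have "g \<in> S" unfolding g_def using p(1) P(1) by (intro S_add S_scale f) auto
  then have "g \<in> orth_complement k N P" using p(2) by (simp add: orth_complement_def g_def)
  moreover have "f = (\<lambda>z. p z + g z)" by (simp add: g_def)
  ultimately show ?thesis using p(1) by blast
qed

end

section \<open>Decomposition of level 4 and orthogonality criteria\<close>

lemma set_plus_funI: "f \<in> A \<Longrightarrow> g \<in> B \<Longrightarrow> (\<lambda>z. f z + g z) \<in> A + B"
  and set_plus_funE: "h \<in> A + B \<Longrightarrow> (\<And>f g. f \<in> A \<Longrightarrow> g \<in> B \<Longrightarrow> h = (\<lambda>z. f z + g z) \<Longrightarrow> thesis) \<Longrightarrow> thesis"
  by (auto simp: set_plus_def plus_fun_def)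

lemma has_fourier_expansion_add:
  "has_fourier_expansion h r f a \<Longrightarrow> has_fourier_expansion h r g b \<Longrightarrow>
    has_fourier_expansion h r (\<lambda>z. f z + g z) (\<lambda>n. a n + b n)"
  unfolding has_fourier_expansion_def distrib_right by (rule ballI, rule sums_add) (rule bspec, assumption+)+

lemma has_fourier_expansion_scale:
  "has_fourier_expansion h r f a \<Longrightarrow> has_fourier_expansion h r (\<lambda>z. x * f z) (\<lambda>n. x * a n)"
  unfolding has_fourier_expansion_def by (rule ballI, subst mult.assoc, rule sums_mult, rule bspec)

lemma plus_space4_add:
  assumes "f \<in> plus_space4 k" "g \<in> plus_space4 k"
  shows "(\<lambda>z. f z + g z) \<in> plus_space4 k"
proof -
  obtain a b where a: "f \<in> cusp_forms k 4" "has_fourier_expansion 1 0 f a" "\<forall>n. ((- 1) ^ k * int n) mod 4 \<notin> {0, 1} \<longrightarrow> a n = 0"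
    and b: "g \<in> cusp_forms k 4" "has_fourier_expansion 1 0 g b" "\<forall>n. ((- 1) ^ k * int n) mod 4 \<notin> {0, 1} \<longrightarrow> b n = 0"
    using assms unfolding plus_space4_def by blast
  have "has_fourier_expansion 1 0 (\<lambda>z. f z + g z) (\<lambda>n. a n + b n)"
    by (rule has_fourier_expansion_add[OF a(2) b(2)])
  moreover have "(\<lambda>z. f z + g z) \<in> cusp_forms k 4" by (rule cusp_forms_add[OF _ _ a(1) b(1)]) auto
  moreover have "\<forall>n. ((- 1) ^ k * int n) mod 4 \<notin> {0, 1} \<longrightarrow> a n + b n = 0" using a(3) b(3) by simp
  ultimately show ?thesis unfolding plus_space4_def by blast
qed

lemma plus_space4_scale:
  assumes "f \<in> plus_space4 k"
  shows "(\<lambda>z. x * f z) \<in> plus_space4 k"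
proof -
  obtain a where a: "f \<in> cusp_forms k 4" "has_fourier_expansion 1 0 f a" "\<forall>n. ((- 1) ^ k * int n) mod 4 \<notin> {0, 1} \<longrightarrow> a n = 0"
    using assms unfolding plus_space4_def by blast
  have "has_fourier_expansion 1 0 (\<lambda>z. x * f z) (\<lambda>n. x * a n)"
    by (rule has_fourier_expansion_scale[OF a(2)])
  moreover have "(\<lambda>z. x * f z) \<in> cusp_forms k 4" by (rule cusp_forms_scale[OF _ _ a(1)]) auto
  moreover have "\<forall>n. ((- 1) ^ k * int n) mod 4 \<notin> {0, 1} \<longrightarrow> x * a n = 0" using a(3) by simp
  ultimately show ?thesis unfolding plus_space4_def by blast
qed

lemma zero_cusp_form: "4 dvd N \<Longrightarrow> N > 0 \<Longrightarrow> (\<lambda>z. 0) \<in> cusp_forms k N"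
  by (simp add: cusp_forms_iff theta_inv_def cusp_decay_def hnorm_def) (meson gt_ex exp_ge_zero mult_nonneg_nonneg order_refl)

lemma zero_plus_space4: "(\<lambda>z. 0) \<in> plus_space4 k"
proof -
  have "has_fourier_expansion 1 0 (\<lambda>z. 0) (\<lambda>n. 0)" by (simp add: has_fourier_expansion_def)
  moreover have "(\<lambda>z. 0) \<in> cusp_forms k 4" by (rule zero_cusp_form) auto
  ultimately show ?thesis unfolding plus_space4_def by blast
qed

lemma plus_space4_subset: "plus_space4 k \<subseteq> cusp_forms k 4"
  by (auto simp: plus_space4_def)

lemma minus_space4_subset: "minus_space4 k n' m' \<subseteq> cusp_forms k 4"
  by (auto simp: minus_space4_def orth_complement_def)

text \<open>The plus space and its image under \<open>W4\<close> add up to a subspace, so the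
  projection to it leaves a remainder in the complement that defines S^-(4).\<close>

lemma cusp_forms_4_decomposition:
  assumes nm': "8 * n' - m' = (1 :: int)" and f: "f \<in> cusp_forms k 4"
  shows "\<exists>p\<in>plus_space4 k. \<exists>q\<in>plus_space4 k. \<exists>g\<in>minus_space4 k n' m'. f = (\<lambda>z. p z + W4 k n' m' q z + g z)"
proof -
  interpret F: form_space k 4 by unfold_locales auto
  let ?P = "plus_space4 k + W4 k n' m' ` plus_space4 k"
  have PI: "(\<lambda>z. p z + W4 k n' m' q z) \<in> ?P" if "p \<in> plus_space4 k" "q \<in> plus_space4 k" for p q
    by (intro set_plus_funI imageI that)
  have PE: "\<exists>p\<in>plus_space4 k. \<exists>q\<in>plus_space4 k. h = (\<lambda>z. p z + W4 k n' m' q z)" if "h \<in> ?P" for h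
    using that by (elim set_plus_funE imageE) blast
  have "\<exists>p\<in>?P. \<exists>g\<in>orth_complement k 4 ?P. f = (\<lambda>z. p z + g z)"
  proof (rule F.orthogonal_decomposition[OF _ _ _ _ f])
    show "?P \<subseteq> cusp_forms k 4"
    proof
      fix h assume "h \<in> ?P"
      from PE[OF this] obtain p q where "p \<in> plus_space4 k" "q \<in> plus_space4 k" "h = (\<lambda>z. p z + W4 k n' m' q z)" by blast
      then show "h \<in> cusp_forms k 4"
        using F.S_add[OF subsetD[OF plus_space4_subset] W4_cusp_forms[OF nm' subsetD[OF plus_space4_subset]]] by simp
    qed
    show "(\<lambda>z. 0) \<in> ?P"
      using PI[OF zero_plus_space4 zero_plus_space4] W4_scale[of k n' m' 0 "\<lambda>z. 0"] by simp
    show "(\<lambda>z. h z + h' z) \<in> ?P" if hh: "h \<in> ?P" "h' \<in> ?P" for h h'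
    proof -
      from PE[OF hh(1)] obtain p q where pq: "p \<in> plus_space4 k" "q \<in> plus_space4 k" "h = (\<lambda>z. p z + W4 k n' m' q z)" by blast
      from PE[OF hh(2)] obtain p' q' where pq': "p' \<in> plus_space4 k" "q' \<in> plus_space4 k" "h' = (\<lambda>z. p' z + W4 k n' m' q' z)" by blast
      have "(\<lambda>z. h z + h' z) = (\<lambda>z. (p z + p' z) + W4 k n' m' (\<lambda>z. q z + q' z) z)"
        unfolding W4_add pq(3) pq'(3) by (simp add: algebra_simps)
      then show ?thesis using PI[OF plus_space4_add[OF pq(1) pq'(1)] plus_space4_add[OF pq(2) pq'(2)]] by simp
    qed
    show "(\<lambda>z. x * h z) \<in> ?P" if h: "h \<in> ?P" for h x
    proof -
      from PE[OF h] obtain p q where pq: "p \<in> plus_space4 k" "q \<in> plus_space4 k" "h = (\<lambda>z. p z + W4 k n' m' q z)" by blast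
      have "(\<lambda>z. x * h z) = (\<lambda>z. (x * p z) + W4 k n' m' (\<lambda>z. x * q z) z)"
        unfolding W4_scale pq(3) by (simp add: algebra_simps)
      then show ?thesis using PI[OF plus_space4_scale[OF pq(1)] plus_space4_scale[OF pq(2)]] by simp
    qed
  qed
  then obtain h g where hg: "h \<in> ?P" "g \<in> minus_space4 k n' m'" "f = (\<lambda>z. h z + g z)"
    unfolding minus_space4_def by blast
  from PE[OF hg(1)] obtain p q where pq: "p \<in> plus_space4 k" "q \<in> plus_space4 k" "h = (\<lambda>z. p z + W4 k n' m' q z)" by blast
  have "f = (\<lambda>z. p z + W4 k n' m' q z + g z)" unfolding hg(3) pq(3) ..
  then show ?thesis using pq(1,2) hg(2) by blast
qed

text \<open>\<open>V4\<close> is an isometric involution which fixes level $4$ and for which $g + V_4 g$ has level $4$,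
  so it is the reflection in the subspace of forms of level $4$.\<close>

lemma V4_eq_minus_iff:
  assumes g: "g \<in> cusp_forms k 8"
  shows "V4 k g = (\<lambda>z. - g z) \<longleftrightarrow> (\<forall>h\<in>cusp_forms k 4. petersson k 8 g h = 0)"
proof -
  interpret F: form_space k 8 by unfold_locales auto
  have iso: "petersson k 8 (V4 k g) (V4 k h) = petersson k 8 g h" if "h \<in> cusp_forms k 8" for h
    by (rule F.isometry_preserves_petersson[OF V4_cusp_forms sq_norm_V4 V4_add V4_scale g that])
  have fix4: "petersson k 8 (V4 k g) h = petersson k 8 g h" if "h \<in> cusp_forms k 4" for h
    using iso[of h] that cusp_forms_4_8[of k] V4_fixes[OF that] by auto
  show ?thesis
  proof
    assume eq: "V4 k g = (\<lambda>z. - g z)"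
    show "\<forall>h\<in>cusp_forms k 4. petersson k 8 g h = 0"
    proof
      fix h assume "h \<in> cusp_forms k 4"
      from fix4[OF this] have "- petersson k 8 g h = petersson k 8 g h"
        unfolding eq using F.petersson_scale[of "-1" g h] by simp
      then show "petersson k 8 g h = 0" by simp
    qed
  next
    assume orth: "\<forall>h\<in>cusp_forms k 4. petersson k 8 g h = 0"
    define u where "u = (\<lambda>z. g z + V4 k g z)"
    have u4: "u \<in> cusp_forms k 4" unfolding u_def by (rule V4_trace[OF g])
    then have u8: "u \<in> cusp_forms k 8" using cusp_forms_4_8 by blast
    \<comment> \<open>As \<open>V4\<close> is an isometry fixing u, this is twice the product of g
      and u, which vanishes because u has level 4.\<close>
    have "petersson k 8 u u = petersson k 8 g u + petersson k 8 (V4 k g) u"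
      using F.petersson_add[OF g V4_cusp_forms[OF g] u8] by (simp only: u_def[symmetric])
    then have "petersson k 8 u u = 0" using fix4[OF u4] orth u4 by simp
    from F.petersson_definite[OF u8 this] show "V4 k g = (\<lambda>z. - g z)"
      unfolding u_def fun_eq_iff by (simp add: add_eq_0_iff)
  qed
qed

text \<open>An isometry that is its own inverse is self-adjoint.\<close>

lemma W8_self_adjoint:
  assumes nm: "16 * n - m = (1 :: int)" and f: "f \<in> cusp_forms k 8" and h: "h \<in> cusp_forms k 8"
  shows "petersson k 8 (W8 k n m f) h = petersson k 8 f (W8 k n m h)"
proof -
  interpret F: form_space k 8 by unfold_locales auto
  have "petersson k 8 (W8 k n m (W8 k n m f)) (W8 k n m h) = petersson k 8 (W8 k n m f) h"
    by (rule F.isometry_preserves_petersson[OF W8_cusp_forms[OF nm] sq_norm_W8[OF nm] W8_add W8_scale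
          W8_cusp_forms[OF nm f] h])
  then show ?thesis unfolding W8_W8[OF nm f] by simp
qed

text \<open>The five summands span S(4) + \<open>W8\<close> S(4): the first, second and fourth make
  up S(4), the third and fifth are images under \<open>W8\<close>, and the image of the plus space,
  absent from the list, is the plus space itself.\<close>

lemma minus_space8_iff:
  assumes nm': "8 * n' - m' = (1 :: int)" and nm: "16 * n - m = (1 :: int)" and f: "f \<in> cusp_forms k 8"
  shows "f \<in> minus_space8 k n' m' n m \<longleftrightarrow>
    (\<forall>h\<in>cusp_forms k 4. petersson k 8 f h = 0) \<and> (\<forall>h\<in>cusp_forms k 4. petersson k 8 f (W8 k n m h) = 0)"
proof -
  interpret F: form_space k 8 by unfold_locales auto
  let ?w4 = "W4 k n' m'" and ?w8 = "W8 k n m"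
  let ?P = "plus_space4 k" and ?M = "minus_space4 k n' m'"
  let ?U = "?P + ?w4 ` ?P + ?w8 ` ?w4 ` ?P + ?M + ?w8 ` ?M"
  have UI: "(\<lambda>z. p z + ?w4 q z + ?w8 (?w4 r) z + g z + ?w8 g' z) \<in> ?U"
    if "p \<in> ?P" "q \<in> ?P" "r \<in> ?P" "g \<in> ?M" "g' \<in> ?M" for p q r g g'
    by (intro set_plus_funI imageI that)
  have M: "f \<in> minus_space8 k n' m' n m \<longleftrightarrow> (\<forall>h\<in>?U. petersson k 8 f h = 0)"
    unfolding minus_space8_def orth_complement_def using f by simp
  have zero: "?w4 (\<lambda>z. 0) = (\<lambda>z. 0)" "?w8 (\<lambda>z. 0) = (\<lambda>z. 0)" "(\<lambda>z. 0) \<in> ?P" "(\<lambda>z. 0) \<in> ?M"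
  proof -
    interpret F4: form_space k 4 by unfold_locales auto
    show "?w4 (\<lambda>z. 0) = (\<lambda>z. 0)" using W4_scale[of k n' m' 0 "\<lambda>z. 0"] by simp
    show "?w8 (\<lambda>z. 0) = (\<lambda>z. 0)" using W8_scale[of k n m 0 "\<lambda>z. 0"] by simp
    show "(\<lambda>z. 0) \<in> ?P" by (rule zero_plus_space4)
    show "(\<lambda>z. 0) \<in> ?M"
      unfolding minus_space4_def orth_complement_def using zero_cusp_form[of 4 k] F4.petersson_zero(2) by simp
  qed
  show ?thesis
  proof
    assume "f \<in> minus_space8 k n' m' n m"
    then have orth: "\<And>h. h \<in> ?U \<Longrightarrow> petersson k 8 f h = 0" unfolding M by blast
    have "petersson k 8 f h = 0 \<and> petersson k 8 f (?w8 h) = 0" if h: "h \<in> cusp_forms k 4" for h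
    proof -
      obtain p q g where pqg: "p \<in> ?P" "q \<in> ?P" "g \<in> ?M" and h_eq: "h = (\<lambda>z. p z + ?w4 q z + g z)"
        using cusp_forms_4_decomposition[OF nm' h] by blast
      have "h = (\<lambda>z. p z + ?w4 q z + ?w8 (?w4 (\<lambda>z. 0)) z + g z + ?w8 (\<lambda>z. 0) z)"
        unfolding zero h_eq by simp
      then have hU: "h \<in> ?U" using UI[OF pqg(1,2) zero(3) pqg(3) zero(4)] by simp
      have "?w8 h = (\<lambda>z. p z + ?w4 (\<lambda>z. 0) z + ?w8 (?w4 q) z + (\<lambda>z. 0) z + ?w8 g z)"
        unfolding zero h_eq W8_add W8_plus_space[OF nm pqg(1)] by simp
      then have "?w8 h \<in> ?U" using UI[OF pqg(1) zero(3) pqg(2) zero(4) pqg(3)] by simp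
      then show ?thesis using orth hU by blast
    qed
    then show "(\<forall>h\<in>cusp_forms k 4. petersson k 8 f h = 0) \<and> (\<forall>h\<in>cusp_forms k 4. petersson k 8 f (?w8 h) = 0)" by blast
  next
    assume orth: "(\<forall>h\<in>cusp_forms k 4. petersson k 8 f h = 0) \<and> (\<forall>h\<in>cusp_forms k 4. petersson k 8 f (?w8 h) = 0)"
    \<comment> \<open>The product is additive on cusp forms, so membership in level 8 is carried
      along with orthogonality to f.\<close>
    define Z where "Z = {h \<in> cusp_forms k 8. petersson k 8 f h = 0}"
    have Z4: "h \<in> Z" "?w8 h \<in> Z" if "h \<in> cusp_forms k 4" for h
      using orth that subsetD[OF cusp_forms_4_8 that] W8_cusp_forms[OF nm] by (auto simp: Z_def)
    have Z_add: "A + B \<subseteq> Z" if AB: "A \<subseteq> Z" "B \<subseteq> Z" for A B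
    proof
      fix h assume "h \<in> A + B"
      then obtain u v where "u \<in> A" "v \<in> B" and h: "h = (\<lambda>z. u z + v z)" by (rule set_plus_funE)
      then have "u \<in> Z" "v \<in> Z" using AB by auto
      then show "h \<in> Z" unfolding h Z_def using F.S_add[of u v] F.petersson_add_right[of u v f] f by simp
    qed
    have "?U \<subseteq> Z"
    proof (intro Z_add)
      have P4: "h \<in> cusp_forms k 4" "?w4 h \<in> cusp_forms k 4" if "h \<in> ?P" for h
        using subsetD[OF plus_space4_subset that] W4_cusp_forms[OF nm'] by auto
      have M4: "h \<in> cusp_forms k 4" if "h \<in> ?M" for h
        by (rule subsetD[OF minus_space4_subset that])
      show "?P \<subseteq> Z" "?w4 ` ?P \<subseteq> Z" "?w8 ` ?w4 ` ?P \<subseteq> Z"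
        using Z4(1)[OF P4(1)] Z4(1)[OF P4(2)] Z4(2)[OF P4(2)] by blast+
      show "?M \<subseteq> Z" "?w8 ` ?M \<subseteq> Z" using Z4[OF M4] by blast+
    qed
    then show "f \<in> minus_space8 k n' m' n m" unfolding M by (auto simp: Z_def)
  qed
qed

theorem theorem6:
  fixes k :: nat and n' m' n m :: int and f :: "complex \<Rightarrow> complex"
  assumes "k > 0"
    and "8 * n' - m' = 1"
    and "16 * n - m = 1"
    and "f \<in> cusp_forms k 8"
  shows "f \<in> minus_space8 k n' m' n m \<longleftrightarrow> V4 k f = - f \<and> - f = V4' k n m f"
proof -
  note nm = assms(3) and f = assms(4)
  define w where "w = W8 k n m f"
  have w: "w \<in> cusp_forms k 8" unfolding w_def by (rule W8_cusp_forms[OF nm f])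
  have W8_minus: "W8 k n m (\<lambda>z. - g z) = (\<lambda>z. - W8 k n m g z)" for g
    using W8_scale[of k n m "-1" g] by simp
  have neg: "- f = (\<lambda>z. - f z)" by (simp add: fun_Compl_def)
  \<comment> \<open>Applying the involution \<open>W8\<close> to both sides turns the condition on f
    into the eigenvalue condition for \<open>V4\<close> at w; self-adjointness later returns from w
    to f.\<close>
  have "- f = V4' k n m f \<longleftrightarrow> V4 k w = (\<lambda>z. - w z)"
  proof
    assume "- f = V4' k n m f"
    then have "W8 k n m (W8 k n m (V4 k w)) = W8 k n m (\<lambda>z. - f z)"
      unfolding neg V4'_def w_def by simp
    then show "V4 k w = (\<lambda>z. - w z)"
      unfolding W8_W8[OF nm V4_cusp_forms[OF w]] W8_minus w_def[symmetric] .
  next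
    assume eq: "V4 k w = (\<lambda>z. - w z)"
    show "- f = V4' k n m f"
      unfolding neg V4'_def w_def[symmetric] eq W8_minus unfolding w_def W8_W8[OF nm f] ..
  qed
  also have "\<dots> \<longleftrightarrow> (\<forall>h\<in>cusp_forms k 4. petersson k 8 f (W8 k n m h) = 0)"
    unfolding V4_eq_minus_iff[OF w]
    by (rule ball_cong[OF refl]) (simp add: w_def W8_self_adjoint[OF nm f subsetD[OF cusp_forms_4_8]])
  finally show ?thesis
    unfolding minus_space8_iff[OF assms(2) nm f] neg V4_eq_minus_iff[OF f] by blast
qed

end
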